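(* Let $K=K_1\times\cdots\times K_n$, where each $K_j$ is a regular compact subset of $\mathbb C$. Let $V_{\alpha(i)}\in\mathcal P(\alpha(i))$ be the monic orthogonal polynomial for $\nu_K$ with leading term $z^{\alpha(i)}=z_1^{\alpha_1}\cdots z_n^{\alpha_n}$. Then $$\|V_{\alpha(i)}\|_{L^2(\nu_K)}\ge\prod_{j=1}^n\mathrm{Cap}(K_j)^{\alpha_j},$$ and hence $[W_{2,\alpha(i)}(K,1)]^2\ge1$. Equality holds in the displayed inequality for a given $\alpha(i)$ if and only if, for each $j\in\{1,\dots,n\}$, either $\alpha_j=0$, or $\partial\Omega_{K_j}=R_{\alpha_j}^{-1}(\partial\mathbb D)$ for some polynomial $R_{\alpha_j}$ of degree $\alpha_j$. In the case of equality, for every $c\in\mathbb N$ one also has $\|V_{c\alpha(i)}\|_{L^2(\nu_K)}=\prod_{j=1}^n\mathrm{Cap}(K_j)^{c\alpha_j}$, where $V_{c\alpha(i)}$ is the monic orthogonal polynomial for $\nu_K$ with leading term $z^{c\alpha(i)}$.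
   Context: Monomials $z^\alpha=z_1^{\alpha_1}\cdots z_n^{\alpha_n}$, $\alpha\in\mathbb N_0^n$, are enumerated as $e_0=1,e_1,e_2,\dots$ with $e_i=z^{\alpha(i)}$. The enumeration is such that $|\alpha(i)|=\alpha_1+\dots+\alpha_n$ is non-decreasing in $i$. Among multi-indices of equal length it is ordered lexicographically: for $|\alpha|=|\beta|$, $\beta\prec\alpha$ iff for some $l$ one has $\alpha_l<\beta_l$ and $\alpha_k=\beta_k$ for all $k<l$. $\mathcal P(\alpha(i))$ denotes the set of polynomials of the form $e_i+\sum_{j<i}c_je_j$ with $c_j\in\mathbb C$. For compact $K\subset\mathbb C^n$, $\|\cdot\|_K$ denotes the sup norm on $K$. Set $t_i(K)=\inf\{\|P\|_K:P\in\mathcal P(\alpha(i))\}$ and $\tau^-(K)=\liminf_{i\to\infty} t_i(K)^{1/|\alpha(i)|}$. $\nu_K$ is the normalized Monge–Ampère measure of $K$; for this product set it equals $\mu_{K_1}\otimes\cdots\otimes\mu_{K_n}$, with $\mu_{K_j}$ the equilibrium measure of $K_j$. The monic orthogonal polynomial for $\nu_K$ in $\mathcal P(\alpha(i))$ is the minimizer of the $L^2(\nu_K)$-norm there. $W_{2,\alpha(i)}(K,1)=\|V_{\alpha(i)}\|_{L^2(\nu_K)}/[\tau^-(K)]^{|\alpha(i)|}$. $\mathrm{Cap}$ is logarithmic capacity. A compact $E\subset\mathbb C$ is regular if its Green function with pole at infinity is continuous. $\Omega_{E}$ denotes the unbounded component of $\overline{\mathbb C}\setminus E$. *)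

theory Defs
  imports "HOL-Probability.Probability" "HOL-Computational_Algebra.Polynomial"
begin

text \<open>Points of C^n are functions nat => complex (only coordinates j < n matter);
  multi-indices are functions nat => nat vanishing from n on.\<close>

definition multi_indices :: "nat \<Rightarrow> (nat \<Rightarrow> nat) set" where
  "multi_indices n = {\<beta>. \<forall>j\<ge>n. \<beta> j = 0}"

definition mdeg :: "nat \<Rightarrow> (nat \<Rightarrow> nat) \<Rightarrow> nat" where
  "mdeg n \<beta> = (\<Sum>j<n. \<beta> j)"

definition monom_n :: "nat \<Rightarrow> (nat \<Rightarrow> nat) \<Rightarrow> (nat \<Rightarrow> complex) \<Rightarrow> complex" where
  "monom_n n \<beta> z = (\<Prod>j<n. z j ^ \<beta> j)"

definition grlex_less :: "nat \<Rightarrow> (nat \<Rightarrow> nat) \<Rightarrow> (nat \<Rightarrow> nat) \<Rightarrow> bool" where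
  "grlex_less n \<beta> \<alpha> \<longleftrightarrow> mdeg n \<beta> < mdeg n \<alpha> \<or>
     (mdeg n \<beta> = mdeg n \<alpha> \<and> (\<exists>l<n. \<alpha> l < \<beta> l \<and> (\<forall>k<l. \<alpha> k = \<beta> k)))"

definition mi_enum :: "nat \<Rightarrow> nat \<Rightarrow> (nat \<Rightarrow> nat)" where
  "mi_enum n i = (THE \<beta>. \<beta> \<in> multi_indices n \<and>
       card {\<gamma> \<in> multi_indices n. grlex_less n \<gamma> \<beta>} = i)"

definition monic_polys :: "nat \<Rightarrow> (nat \<Rightarrow> nat) \<Rightarrow> ((nat \<Rightarrow> complex) \<Rightarrow> complex) set" where
  "monic_polys n \<alpha> = {p. \<exists>c :: (nat \<Rightarrow> nat) \<Rightarrow> complex.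
      p = (\<lambda>z. monom_n n \<alpha> z +
             (\<Sum>\<beta>\<in>{\<beta> \<in> multi_indices n. grlex_less n \<beta> \<alpha>}. c \<beta> * monom_n n \<beta> z))}"

definition l2norm :: "(nat \<Rightarrow> complex) measure \<Rightarrow> ((nat \<Rightarrow> complex) \<Rightarrow> complex) \<Rightarrow> real" where
  "l2norm \<nu> p = sqrt (\<integral>z. (cmod (p z))\<^sup>2 \<partial>\<nu>)"

definition is_monic_orth_poly ::
  "nat \<Rightarrow> (nat \<Rightarrow> complex) measure \<Rightarrow> (nat \<Rightarrow> nat) \<Rightarrow> ((nat \<Rightarrow> complex) \<Rightarrow> complex) \<Rightarrow> bool" where
  "is_monic_orth_poly n \<nu> \<alpha> V \<longleftrightarrow>
     V \<in> monic_polys n \<alpha> \<and> (\<forall>P \<in> monic_polys n \<alpha>. l2norm \<nu> V \<le> l2norm \<nu> P)"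

definition sup_norm :: "(nat \<Rightarrow> complex) set \<Rightarrow> ((nat \<Rightarrow> complex) \<Rightarrow> complex) \<Rightarrow> real" where
  "sup_norm K p = (SUP z\<in>K. cmod (p z))"

definition cheb_t :: "nat \<Rightarrow> (nat \<Rightarrow> complex) set \<Rightarrow> (nat \<Rightarrow> nat) \<Rightarrow> real" where
  "cheb_t n K \<alpha> = (INF P\<in>monic_polys n \<alpha>. sup_norm K P)"

definition tau_minus :: "nat \<Rightarrow> (nat \<Rightarrow> complex) set \<Rightarrow> ereal" where
  "tau_minus n K = liminf (\<lambda>i. ereal (cheb_t n K (mi_enum n i) powr (1 / real (mdeg n (mi_enum n i)))))"

definition W2 :: "nat \<Rightarrow> (nat \<Rightarrow> complex) set \<Rightarrow> (nat \<Rightarrow> complex) measure \<Rightarrow> (nat \<Rightarrow> nat)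
    \<Rightarrow> ((nat \<Rightarrow> complex) \<Rightarrow> complex) \<Rightarrow> real" where
  "W2 n K \<nu> \<alpha> V = l2norm \<nu> V / (real_of_ereal (tau_minus n K)) ^ mdeg n \<alpha>"

definition prob_on :: "complex set \<Rightarrow> complex measure \<Rightarrow> bool" where
  "prob_on E \<mu> \<longleftrightarrow> prob_space \<mu> \<and> sets \<mu> = sets borel \<and> emeasure \<mu> E = 1"

definition log_kernel_pos :: "complex \<Rightarrow> complex \<Rightarrow> ennreal" where
  "log_kernel_pos z w = (if z = w then \<infinity> else ennreal (max 0 (- ln (cmod (z - w)))))"

definition log_kernel_neg :: "complex \<Rightarrow> complex \<Rightarrow> real" where
  "log_kernel_neg z w = (if z = w then 0 else max 0 (ln (cmod (z - w))))"

definition log_energy :: "complex measure \<Rightarrow> ereal" where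
  "log_energy \<mu> = enn2ereal (\<integral>\<^sup>+z. (\<integral>\<^sup>+w. log_kernel_pos z w \<partial>\<mu>) \<partial>\<mu>)
                   - ereal (\<integral>z. (\<integral>w. log_kernel_neg z w \<partial>\<mu>) \<partial>\<mu>)"

definition robin_const :: "complex set \<Rightarrow> ereal" where
  "robin_const E = (INF \<mu>\<in>{\<mu>. prob_on E \<mu>}. log_energy \<mu>)"

definition log_capacity :: "complex set \<Rightarrow> real" where
  "log_capacity E = (if robin_const E = \<infinity> then 0 else exp (- real_of_ereal (robin_const E)))"

definition equilibrium_measure :: "complex set \<Rightarrow> complex measure \<Rightarrow> bool" where
  "equilibrium_measure E \<mu> \<longleftrightarrow> prob_on E \<mu> \<and> log_energy \<mu> = robin_const E"

text \<open>Green function of E with pole at infinity (extended by 0 off the unbounded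
  complementary component), given by the Siciak--Zaharjuta / Bernstein--Walsh formula.\<close>
definition green_infty :: "complex set \<Rightarrow> complex \<Rightarrow> ereal" where
  "green_infty E z = Sup ({0} \<union> {ereal (ln (cmod (poly p z)) / real (degree p)) | p.
      degree p \<ge> 1 \<and> (\<forall>w\<in>E. cmod (poly p w) \<le> 1) \<and> poly p z \<noteq> 0})"

definition regular_compact :: "complex set \<Rightarrow> bool" where
  "regular_compact E \<longleftrightarrow> compact E \<and> E \<noteq> {} \<and> (\<forall>z. green_infty E z < \<infinity>) \<and>
     continuous_on UNIV (\<lambda>z. real_of_ereal (green_infty E z))"

definition unbounded_component :: "complex set \<Rightarrow> complex set" where
  "unbounded_component E = \<Union>{C. C \<in> components (- E) \<and> \<not> bounded C}"

end

theory Submission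
  imports Defs "HOL-Complex_Analysis.Complex_Analysis"
    "HOL-Computational_Algebra.Fundamental_Theorem_Algebra"
begin

text \<open>For a product measure the monic orthogonal polynomial with leading term \<open>z^\<alpha>\<close> has the norm of
  the product of the one-variable ones, so everything reduces to one regular compact set \<open>K\<close> with
  equilibrium measure \<open>\<mu>\<close> and \<open>Cap K = exp I\<close>. By Frostman's theorem the logarithmic potential of
  \<open>\<mu>\<close> is at least \<open>I\<close> everywhere, so Jensen's inequality gives \<open>exp (d I) \<le> \<integral> \<bar>P\<bar> d\<mu>\<close> for a monic
  \<open>P\<close> of degree \<open>d\<close>; together with \<open>\<integral> (\<bar>P\<bar> / exp (d I) - 1)^2 d\<mu> \<ge> 0\<close> this yields the lower bound, and
  in case of equality \<open>\<bar>P\<bar>\<close> is constant \<open>\<mu>\<close>-almost everywhere. Then the Green function of \<open>K\<close> equals both the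
  normalized potential and \<open>ln \<bar>R\<bar> / d\<close>, \<open>R = P / exp (d I)\<close>, on the unbounded component, because these
  functions have the same mean over large circles and the maximum principle propagates equality.
  Weak limits of Leja points show that the sup norms of the Leja polynomials grow at most like the
  capacity along a subsequence; this bounds the Green function from below and \<open>\<tau>\<^sup>-\<close> from above.\<close>

text \<open>Two descriptions of one function have to meet. Regularity speaks about
  \<open>green_infty\<close>, a supremum over polynomials, while the equilibrium measure controls
  only its potential, which is evaluated off the compact set. Their identification on the unbounded
  component turns a modulus that is constant almost everywhere into a statement about the boundary:
  continuity of the Green function carries the information to the frontier, where the potential
  alone gives none. Large circles serve here because means over them are exact: they see only total
  mass, respectively leading coefficient and degree. The kernel ln |z - w| is unbounded and energies
  may be infinite, so energies are expressed by the continuous kernel ln (max \<delta> |z - w|),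
  with estimates for all \<delta> > 0. With this sign the equilibrium energy is maximal and I = ln
  Cap. That I is finite is not built into the notion of equilibrium measure; it is derived from the
  finiteness of the Green function. For the normalized norm it suffices that the constant
  \<open>tau_minus\<close> is positive and at most each Cap(K_j).\<close>

section \<open>Means over circles\<close>

definition unit_exp :: "real \<Rightarrow> complex" where
  "unit_exp t = exp (2 * of_real pi * \<i> * of_real t)"

text \<open>A measure rather than an integral over a set, so that Fubini's theorem applies to its
  product with the measure of a potential.\<close>

definition circ :: "real measure" where
  "circ = restrict_space lborel {0..1}"

definition circle_mean :: "(complex \<Rightarrow> real) \<Rightarrow> complex \<Rightarrow> complex \<Rightarrow> real" where
  "circle_mean u z r = (\<integral>t. u (z + r * unit_exp t) \<partial>circ)"

lemma norm_unit_exp [simp]: "cmod (unit_exp t) = 1"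
  by (simp add: unit_exp_def norm_exp_eq_Re)

lemma continuous_unit_exp: "continuous_on A unit_exp"
  unfolding unit_exp_def by (intro continuous_intros)

lemma unit_exp_surj:
  assumes "cmod w = 1"
  obtains t where "t \<in> {0..1}" "w = unit_exp t"
proof -
  have "w \<in> path_image (circlepath 0 1)" using assms by (simp add: path_image_circlepath)
  then obtain t where "t \<in> {0..1}" "w = circlepath 0 1 t" unfolding path_image_def by auto
  then show ?thesis using that[of t] by (simp add: circlepath unit_exp_def)
qed

lemma prob_space_circ: "prob_space circ"
  by (rule prob_spaceI) (simp add: circ_def space_restrict_space emeasure_restrict_space)

lemma integrable_circ:
  fixes f :: "real \<Rightarrow> 'a :: euclidean_space"
  assumes "continuous_on {0..1} f"
  shows "integrable circ f"
  using borel_integrable_atLeastAtMost'[OF assms]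
  by (simp add: circ_def set_integrable_def integrable_restrict_space)

lemma integral_circ:
  fixes f :: "real \<Rightarrow> 'a :: euclidean_space"
  assumes "continuous_on {0..1} f"
  shows "integral\<^sup>L circ f = integral {0..1} f"
  using set_borel_integral_eq_integral(2)[OF borel_integrable_atLeastAtMost'[OF assms]]
  by (simp add: circ_def set_lebesgue_integral_def integral_restrict_space)

lemma borel_measurable_circ:
  assumes "f \<in> borel_measurable borel"
  shows "f \<in> borel_measurable circ"
  unfolding circ_def using assms by (simp add: measurable_restrict_space1)

lemma continuous_on_circle:
  assumes "continuous_on (sphere z (cmod r)) u"
  shows "continuous_on A (\<lambda>t. u (z + r * unit_exp t))"
proof -
  have "(\<lambda>t. z + r * unit_exp t) ` A \<subseteq> sphere z (cmod r)"
    by (auto simp: dist_norm norm_mult)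
  then show ?thesis
    by (intro continuous_on_compose2[OF assms]) (auto intro!: continuous_intros continuous_unit_exp)
qed

lemma integrable_circle:
  fixes u :: "complex \<Rightarrow> real"
  assumes "continuous_on (sphere z (cmod r)) u"
  shows "integrable circ (\<lambda>t. u (z + r * unit_exp t))"
  by (intro integrable_circ continuous_on_circle assms)

lemma circle_mean_const [simp]: "circle_mean (\<lambda>_. c) z r = c"
proof -
  interpret prob_space circ by (rule prob_space_circ)
  show ?thesis by (simp add: circle_mean_def prob_space)
qed

lemma circle_mean_cong:
  assumes "\<And>x. x \<in> sphere z (cmod r) \<Longrightarrow> u x = v x"
  shows "circle_mean u z r = circle_mean v z r"
  unfolding circle_mean_def using assms by (intro Bochner_Integration.integral_cong) (auto simp: dist_norm norm_mult)

lemma circle_mean_add: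
  assumes "continuous_on (sphere z (cmod r)) u" "continuous_on (sphere z (cmod r)) v"
  shows "circle_mean (\<lambda>x. u x + v x) z r = circle_mean u z r + circle_mean v z r"
  unfolding circle_mean_def by (intro Bochner_Integration.integral_add integrable_circle assms)

lemma circle_mean_diff:
  assumes "continuous_on (sphere z (cmod r)) u" "continuous_on (sphere z (cmod r)) v"
  shows "circle_mean (\<lambda>x. u x - v x) z r = circle_mean u z r - circle_mean v z r"
  unfolding circle_mean_def by (intro Bochner_Integration.integral_diff integrable_circle assms)

lemma circle_mean_scale: "circle_mean (\<lambda>x. c * u x) z r = c * circle_mean u z r"
  unfolding circle_mean_def by simp

lemma circle_mean_mono:
  assumes "continuous_on (sphere z (cmod r)) u" "continuous_on (sphere z (cmod r)) v"
    and "\<And>x. x \<in> sphere z (cmod r) \<Longrightarrow> u x \<le> v x"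
  shows "circle_mean u z r \<le> circle_mean v z r"
  unfolding circle_mean_def using assms
  by (intro Bochner_Integration.integral_mono integrable_circle) (auto simp: dist_norm norm_mult)

text \<open>Turns a comparison of means into pointwise equality: by continuity the integrand
  vanishes for every parameter, and \<open>unit_exp\<close> reaches every point of the
  circle.\<close>

lemma circle_mean_nonpos_imp_zero:
  assumes u: "continuous_on (sphere z (cmod r)) u"
    and nn: "\<And>x. x \<in> sphere z (cmod r) \<Longrightarrow> 0 \<le> u x" and m: "circle_mean u z r \<le> 0"
    and x: "x \<in> sphere z (cmod r)"
  shows "u x = 0"
proof (cases "r = 0")
  case True
  have "circle_mean u z r = circle_mean (\<lambda>_. u z) z r"
    using True by (intro circle_mean_cong) simp
  then have "circle_mean u z r = u z" by simp
  then show ?thesis using nn[of z] m x True by simp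
next
  case False
  define f where "f t = u (z + r * unit_exp t)" for t
  have cf: "continuous_on {0..1} f" unfolding f_def by (rule continuous_on_circle[OF u])
  have nf: "f t \<ge> 0" for t unfolding f_def by (intro nn) (auto simp: dist_norm norm_mult)
  have "integral {0..1} f \<le> 0"
    using m integral_circ[OF cf] by (simp add: circle_mean_def f_def[symmetric])
  moreover have "integral {0..1} f \<ge> 0"
    by (intro integral_nonneg integrable_continuous_real cf) (auto simp: nf)
  ultimately have "\<forall>t\<in>{0..1}. f t = 0"
    using integral_eq_0_iff[OF cf] nf by auto
  moreover obtain t where "t \<in> {0..1}" "(x - z) / r = unit_exp t"
    using x False by (elim unit_exp_surj[of "(x - z) / r", rotated]) (auto simp: norm_divide dist_norm norm_minus_commute)
  moreover from this have "x = z + r * unit_exp t" using False by (simp add: field_simps)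
  ultimately show ?thesis by (auto simp: f_def)
qed

text \<open>Radii for which a zero lies on the circle can be left out at first and recovered by this
  continuity.\<close>

lemma continuous_circle_mean_radius:
  assumes "continuous_on UNIV u"
  shows "continuous_on UNIV (\<lambda>s. circle_mean u z (of_real s))"
proof -
  have "continuous_on UNIV (\<lambda>s. integral (cbox 0 1) (\<lambda>t. u (z + of_real s * unit_exp t)))"
    by (rule integral_continuous_on_param)
       (auto simp: case_prod_unfold intro!: continuous_on_compose2[OF assms] continuous_intros
             continuous_on_compose2[OF continuous_unit_exp[of UNIV]])
  moreover have "circle_mean u z (of_real s) = integral (cbox 0 1) (\<lambda>t. u (z + of_real s * unit_exp t))" for s
    unfolding circle_mean_def
    by (subst integral_circ) (auto intro!: continuous_on_circle continuous_on_subset[OF assms])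
  ultimately show ?thesis by simp
qed

lemma holomorphic_circle_mean:
  assumes "f holomorphic_on ball 0 R" "R > 1"
  shows "(\<integral>t. f (unit_exp t) \<partial>circ) = f 0"
proof -
  have "f holomorphic_on cball 0 1" using assms by (auto intro: holomorphic_on_subset)
  from Cauchy_integral_circlepath_simple[OF this, of 0]
  have "((\<lambda>u. f u / u) has_contour_integral 2 * of_real pi * \<i> * f 0) (circlepath 0 1)" by simp
  then have "((\<lambda>x. f (circlepath 0 1 x) / circlepath 0 1 x *
      vector_derivative (circlepath 0 1) (at x within {0..1})) has_integral 2 * of_real pi * \<i> * f 0) {0..1}"
    unfolding has_contour_integral_def .
  moreover have "f (circlepath 0 1 x) / circlepath 0 1 x *
      vector_derivative (circlepath 0 1) (at x within {0..1}) = 2 * of_real pi * \<i> * f (unit_exp x)"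
    if "x \<in> {0..1}" for x
    using that unfolding vector_derivative_circlepath01[OF that[unfolded atLeastAtMost_iff, THEN conjunct1] that[unfolded atLeastAtMost_iff, THEN conjunct2]]
    by (simp add: circlepath unit_exp_def)
  ultimately have "((\<lambda>x. 2 * of_real pi * \<i> * f (unit_exp x)) has_integral 2 * of_real pi * \<i> * f 0) {0..1}"
    by (metis (no_types, lifting) has_integral_cong)
  from has_integral_mult_right[OF this, of "1 / (2 * of_real pi * \<i>)"]
  have "((\<lambda>x. f (unit_exp x)) has_integral f 0) {0..1}" by simp
  moreover have "continuous_on {0..1} (\<lambda>x. f (unit_exp x))"
    by (rule continuous_on_compose2[OF holomorphic_on_imp_continuous_on[OF assms(1)] continuous_unit_exp])
       (use assms in auto)
  ultimately show ?thesis by (simp add: integral_circ integral_unique)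
qed

text \<open>Up to the constant ln |b| the integrand is the real part of Ln (1 + (a / b) x) at x =
  \<open>unit_exp t\<close>. This function is holomorphic on a disc of radius R > 1, chosen such
  that R |a| < |b| keeps the argument off the branch cut, so its mean is its value 0 at the
  centre.\<close>

lemma mean_ln_outside:
  assumes "cmod a < cmod b"
  shows "(\<integral>t. ln (cmod (b + a * unit_exp t)) \<partial>circ) = ln (cmod b)"
proof -
  have b: "b \<noteq> 0" using assms by auto
  obtain R where R: "R > 1" "R * cmod a < cmod b"
  proof (cases "a = 0")
    case True then show ?thesis using that[of 2] b by auto
  next
    case False
    then have "1 < cmod b / cmod a" using assms by (simp add: field_simps)
    then obtain R where "1 < R" "R < cmod b / cmod a" using dense by blast
    then show ?thesis using that[of R] False by (simp add: field_simps)
  qed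
  define f where "f x = Ln (1 + a / b * x)" for x
  have re: "1 + a / b * x \<notin> \<real>\<^sub>\<le>\<^sub>0" if "cmod x < R" for x
  proof -
    have "cmod (a / b * x) = cmod a * cmod x / cmod b" by (simp add: norm_mult norm_divide)
    also have "\<dots> \<le> R * cmod a / cmod b" using that
      by (intro divide_right_mono) (auto simp: mult.commute[of R] intro!: mult_left_mono)
    also have "\<dots> < 1" using R b by (simp add: field_simps)
    finally have "\<bar>Re (a / b * x)\<bar> < 1" using abs_Re_le_cmod[of "a / b * x"] by linarith
    then show ?thesis by (auto simp: complex_nonpos_Reals_iff)
  qed
  have hol: "f holomorphic_on ball 0 R" unfolding f_def
    by (intro holomorphic_intros) (use re in auto)
  have cont: "continuous_on {0..1} (\<lambda>t. f (unit_exp t))"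
    by (rule continuous_on_compose2[OF holomorphic_on_imp_continuous_on[OF hol] continuous_unit_exp]) (use R in auto)
  have "(\<integral>t. Re (f (unit_exp t)) \<partial>circ) = Re (\<integral>t. f (unit_exp t) \<partial>circ)"
    by (rule integral_Re[OF integrable_circ[OF cont]])
  also have "\<dots> = 0" using holomorphic_circle_mean[OF hol R(1)] by (simp add: f_def)
  finally have 0: "(\<integral>t. Re (f (unit_exp t)) \<partial>circ) = 0" .
  interpret prob_space circ by (rule prob_space_circ)
  have "ln (cmod (b + a * unit_exp t)) = ln (cmod b) + Re (f (unit_exp t))" for t
  proof -
    have nz: "1 + a / b * unit_exp t \<noteq> 0" using re[of "unit_exp t"] R by auto
    have "b + a * unit_exp t = b * (1 + a / b * unit_exp t)" using b by (simp add: field_simps)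
    then show ?thesis using nz b by (simp add: norm_mult ln_mult f_def)
  qed
  then show ?thesis
    using 0 by (simp add: Bochner_Integration.integral_add integrable_Re[OF integrable_circ[OF cont]] prob_space)
qed

text \<open>For |a| > |b|, multiplication by the conjugate of \<open>unit_exp t\<close> exchanges
  the roles of a and b up to conjugation and preserves the modulus. Equal moduli are excluded
  because the argument of the logarithm then vanishes somewhere on the circle.\<close>

lemma mean_ln:
  assumes "cmod a \<noteq> cmod b"
  shows "(\<integral>t. ln (cmod (b + a * unit_exp t)) \<partial>circ) = ln (max (cmod a) (cmod b))"
proof (cases "cmod a < cmod b")
  case True then show ?thesis by (simp add: mean_ln_outside max_def)
next
  case False
  have "cmod (b + a * unit_exp t) = cmod (cnj a + cnj b * unit_exp t)" for t
  proof -
    have *: "unit_exp t * cnj (unit_exp t) = 1"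
      using complex_norm_square[of "unit_exp t"] by simp
    have "cmod (b + a * unit_exp t) = cmod ((b + a * unit_exp t) * cnj (unit_exp t))" by (simp add: norm_mult)
    also have "(b + a * unit_exp t) * cnj (unit_exp t) = cnj (cnj b * unit_exp t + cnj a)"
      using * by (simp add: algebra_simps)
    finally show ?thesis by (simp add: add.commute del: complex_cnj_add)
  qed
  then show ?thesis using False assms mean_ln_outside[of "cnj b" "cnj a"] by (simp add: max_def)
qed

lemma circle_mean_ln:
  assumes "cmod (z - w) \<noteq> cmod r"
  shows "circle_mean (\<lambda>x. ln (cmod (x - w))) z r = ln (max (cmod r) (cmod (z - w)))"
  using mean_ln[of r "z - w"] assms by (simp add: circle_mean_def algebra_simps)

section \<open>Jensen's formula for polynomials\<close>

lemma poly_split: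
  fixes P :: "complex poly"
  assumes "P \<noteq> 0"
  obtains ws where "P = smult (lead_coeff P) (\<Prod>w\<leftarrow>ws. [:- w, 1:])" "length ws = degree P"
    "\<And>w. w \<in> set ws \<longleftrightarrow> poly P w = 0"
proof -
  have "\<exists>ws. P = smult (lead_coeff P) (\<Prod>w\<leftarrow>ws. [:- w, 1:]) \<and> length ws = degree P"
    using assms
  proof (induction "degree P" arbitrary: P)
    case 0
    then obtain c where "P = [:c:]" by (metis degree_eq_zeroE)
    then show ?case using 0 by (intro exI[of _ "[]"]) auto
  next
    case (Suc n)
    obtain w where "poly P w = 0" using alg_closed_imp_poly_has_root[of P] Suc(2) by auto
    then obtain Q where PQ: "P = [:-w, 1:] * Q" by (metis dvdE poly_eq_0_iff_dvd)
    then have Q: "Q \<noteq> 0" using Suc(3) by auto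
    have "degree P = Suc (degree Q)" unfolding PQ by (subst degree_mult_eq) (use Q in auto)
    then obtain ws where ws: "Q = smult (lead_coeff Q) (\<Prod>w\<leftarrow>ws. [:- w, 1:])" "length ws = degree Q"
      using Suc(1)[of Q] Suc(2) Q by auto
    have "lead_coeff P = lead_coeff Q" unfolding PQ by (simp only: lead_coeff_mult) simp
    then have "P = smult (lead_coeff P) (\<Prod>w\<leftarrow>w # ws. [:- w, 1:])"
      unfolding PQ using ws(1) by (simp only: list.map prod_list.Cons mult_smult_right[symmetric])
    moreover have "length (w # ws) = degree P" using ws(2) \<open>degree P = Suc (degree Q)\<close> by simp
    ultimately show ?case by blast
  qed
  then obtain ws where ws: "P = smult (lead_coeff P) (\<Prod>w\<leftarrow>ws. [:- w, 1:])" "length ws = degree P" by blast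
  have "poly (\<Prod>w\<leftarrow>us. [:- w, 1:]) x = 0 \<longleftrightarrow> x \<in> set us" for us and x :: complex
    by (induction us) auto
  moreover have "poly P x = lead_coeff P * poly (\<Prod>w\<leftarrow>ws. [:- w, 1:]) x" for x
    by (subst ws(1)) simp
  ultimately show ?thesis using that[OF ws] assms by auto
qed

lemma poly_prod_roots: "poly (\<Prod>w\<leftarrow>ws. [:- w, 1:]) z = (\<Prod>w\<leftarrow>ws. z - w)"
  for z :: complex
  by (induction ws) (auto simp: algebra_simps)

lemma ln_norm_prod_list:
  assumes "\<And>w. w \<in> set ws \<Longrightarrow> z \<noteq> w"
  shows "ln (cmod (\<Prod>w\<leftarrow>ws. z - w)) = (\<Sum>w\<leftarrow>ws. ln (cmod (z - w)))"
  using assms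
proof (induction ws)
  case (Cons a ws)
  moreover have "(\<Prod>w\<leftarrow>ws. z - w) \<noteq> 0" using Cons.prems by (auto simp: prod_list_zero_iff)
  ultimately show ?case by (simp add: norm_mult ln_mult)
qed simp

lemma circle_mean_sum_ln:
  assumes "\<And>w. w \<in> set ws \<Longrightarrow> cmod (z - w) \<noteq> cmod r"
  shows "circle_mean (\<lambda>x. \<Sum>w\<leftarrow>ws. ln (cmod (x - w))) z r = (\<Sum>w\<leftarrow>ws. ln (max (cmod r) (cmod (z - w))))"
  using assms
proof (induction ws)
  case (Cons a ws)
  have c: "continuous_on (sphere z (cmod r)) (\<lambda>x. ln (cmod (x - w)))" if "w \<in> set (a # ws)" for w
    by (intro continuous_intros) (use Cons.prems[OF that] in \<open>auto simp: dist_norm\<close>)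
  have "continuous_on (sphere z (cmod r)) (\<lambda>x. \<Sum>w\<leftarrow>us. ln (cmod (x - w)))" if "set us \<subseteq> set ws" for us
    using that by (induction us) (auto intro!: continuous_intros c)
  then show ?case using Cons c by (simp add: circle_mean_add circle_mean_ln)
qed simp

lemma ln_cmod_poly:
  fixes P :: "complex poly"
  assumes "P = smult (lead_coeff P) (\<Prod>w\<leftarrow>ws. [:- w, 1:])" "poly P z \<noteq> 0"
  shows "ln (cmod (poly P z)) = ln (cmod (lead_coeff P)) + (\<Sum>w\<leftarrow>ws. ln (cmod (z - w)))"
proof -
  have eq: "poly P z = lead_coeff P * (\<Prod>w\<leftarrow>ws. z - w)"
    by (subst assms(1)) (simp add: poly_prod_roots)
  then have nz: "(\<Prod>w\<leftarrow>ws. z - w) \<noteq> 0" "lead_coeff P \<noteq> 0" using assms(2) by auto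
  have "z \<noteq> w" if "w \<in> set ws" for w using nz(1) that by (auto simp: prod_list_zero_iff)
  then show ?thesis using nz by (simp add: eq norm_mult ln_mult ln_norm_prod_list)
qed

text \<open>Jensen's formula: a zero at distance s from the centre contributes ln (max |r| s). This
  is at least ln s, which gives the mean inequality; it is ln s for a zero outside the closed disc
  and ln |r| for a zero inside, which gives the two exact formulas.\<close>

lemma circle_mean_ln_poly:
  fixes P :: "complex poly"
  assumes "P \<noteq> 0" "P = smult (lead_coeff P) (\<Prod>w\<leftarrow>ws. [:- w, 1:])"
    and "\<And>w. w \<in> set ws \<Longrightarrow> cmod (z - w) \<noteq> cmod r"
  shows "circle_mean (\<lambda>x. ln (cmod (poly P x))) z r =
    ln (cmod (lead_coeff P)) + (\<Sum>w\<leftarrow>ws. ln (max (cmod r) (cmod (z - w))))"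
proof -
  have nz: "poly P x \<noteq> 0" if "x \<in> sphere z (cmod r)" for x
  proof -
    have "poly P x = lead_coeff P * (\<Prod>w\<leftarrow>ws. x - w)"
      by (subst assms(2)) (simp add: poly_prod_roots)
    moreover have "x \<noteq> w" if "w \<in> set ws" for w using assms(3)[OF that] \<open>x \<in> _\<close> by (auto simp: dist_norm)
    ultimately show ?thesis using assms(1) by (auto simp: prod_list_zero_iff)
  qed
  have c: "continuous_on (sphere z (cmod r)) (\<lambda>x. \<Sum>w\<leftarrow>us. ln (cmod (x - w)))" if "set us \<subseteq> set ws" for us
    using that by (induction us) (auto intro!: continuous_intros simp: dist_norm dest: assms(3))
  have "circle_mean (\<lambda>x. ln (cmod (poly P x))) z r =
      circle_mean (\<lambda>x. ln (cmod (lead_coeff P)) + (\<Sum>w\<leftarrow>ws. ln (cmod (x - w)))) z r"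
    by (intro circle_mean_cong ln_cmod_poly[OF assms(2)] nz)
  also have "\<dots> = ln (cmod (lead_coeff P)) + (\<Sum>w\<leftarrow>ws. ln (max (cmod r) (cmod (z - w))))"
    using circle_mean_sum_ln[OF assms(3)] c[of ws] by (subst circle_mean_add) auto
  finally show ?thesis .
qed

lemma circle_mean_ln_poly_ge:
  fixes P :: "complex poly"
  assumes "poly P z \<noteq> 0" "\<And>x. x \<in> sphere z (cmod r) \<Longrightarrow> poly P x \<noteq> 0"
  shows "ln (cmod (poly P z)) \<le> circle_mean (\<lambda>x. ln (cmod (poly P x))) z r"
proof -
  have P: "P \<noteq> 0" using assms by auto
  from poly_split[OF this] obtain ws where ws: "P = smult (lead_coeff P) (\<Prod>w\<leftarrow>ws. [:- w, 1:])"
    "\<And>w. w \<in> set ws \<longleftrightarrow> poly P w = 0" by metis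
  have "cmod (z - w) \<noteq> cmod r" if "w \<in> set ws" for w
    using assms(2)[of w] ws(2) that by (auto simp: dist_norm)
  note 1 = circle_mean_ln_poly[OF P ws(1) this]
  have "(\<Sum>w\<leftarrow>ws. ln (cmod (z - w))) \<le> (\<Sum>w\<leftarrow>ws. ln (max (cmod r) (cmod (z - w))))"
  proof (rule sum_list_mono)
    fix w assume "w \<in> set ws"
    then have "z \<noteq> w" using assms(1) ws(2) by auto
    then show "ln (cmod (z - w)) \<le> ln (max (cmod r) (cmod (z - w)))" by (intro ln_mono) auto
  qed
  then show ?thesis using 1 ln_cmod_poly[OF ws(1) assms(1)] by simp
qed

lemma circle_mean_ln_poly_eq:
  fixes P :: "complex poly"
  assumes "\<And>x. x \<in> cball z (cmod r) \<Longrightarrow> poly P x \<noteq> 0"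
  shows "circle_mean (\<lambda>x. ln (cmod (poly P x))) z r = ln (cmod (poly P z))"
proof -
  have Pz: "poly P z \<noteq> 0" and P: "P \<noteq> 0" using assms[of z] by auto
  from poly_split[OF P] obtain ws where ws: "P = smult (lead_coeff P) (\<Prod>w\<leftarrow>ws. [:- w, 1:])"
    "\<And>w. w \<in> set ws \<longleftrightarrow> poly P w = 0" by metis
  have *: "cmod (z - w) > cmod r" if "w \<in> set ws" for w
    using assms[of w] ws(2) that by (force simp: dist_norm)
  then have "cmod (z - w) \<noteq> cmod r" if "w \<in> set ws" for w using that by fastforce
  note 1 = circle_mean_ln_poly[OF P ws(1) this]
  have "map (\<lambda>w. ln (max (cmod r) (cmod (z - w)))) ws = map (\<lambda>w. ln (cmod (z - w))) ws"
    by (intro map_cong refl) (use * in \<open>force simp: max_def\<close>)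
  then show ?thesis using 1 ln_cmod_poly[OF ws(1) Pz] by (simp only:)
qed

lemma circle_mean_ln_poly_large:
  fixes P :: "complex poly"
  assumes "P \<noteq> 0" "\<And>x. poly P x = 0 \<Longrightarrow> cmod (z - x) < cmod r"
  shows "circle_mean (\<lambda>x. ln (cmod (poly P x))) z r = ln (cmod (lead_coeff P)) + degree P * ln (cmod r)"
proof -
  from poly_split[OF assms(1)] obtain ws where ws: "P = smult (lead_coeff P) (\<Prod>w\<leftarrow>ws. [:- w, 1:])"
    "length ws = degree P" "\<And>w. w \<in> set ws \<longleftrightarrow> poly P w = 0" by metis
  have *: "cmod (z - w) < cmod r" if "w \<in> set ws" for w
    using assms(2)[of w] ws(3) that by auto
  then have "cmod (z - w) \<noteq> cmod r" if "w \<in> set ws" for w using that by fastforce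
  note 1 = circle_mean_ln_poly[OF assms(1) ws(1) this]
  have "map (\<lambda>w. ln (max (cmod r) (cmod (z - w)))) ws = map (\<lambda>w. ln (cmod r)) ws"
    by (intro map_cong refl) (use * in \<open>force simp: max_def\<close>)
  then have "(\<Sum>w\<leftarrow>ws. ln (max (cmod r) (cmod (z - w)))) = (\<Sum>w\<leftarrow>ws. ln (cmod r))" by (simp only:)
  then show ?thesis using 1 ws(2) by (simp add: sum_list_triv)
qed

text \<open>The radii for which a zero lies on the circle form a finite set, and both sides are
  continuous in the radius.\<close>
lemma ln_max_poly_submean:
  fixes P :: "complex poly"
  shows "ln (max 1 (cmod (poly P z))) \<le> circle_mean (\<lambda>x. ln (max 1 (cmod (poly P x)))) z (of_real r)"
proof -
  define u where "u x = ln (max 1 (cmod (poly P x)))" for x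
  have cu: "continuous_on A u" for A unfolding u_def
    by (intro continuous_intros continuous_on_max) (auto simp: less_max_iff_disj max_def)
  have u0: "u x \<ge> 0" for x unfolding u_def by simp
  show ?thesis
  proof (cases "cmod (poly P z) \<le> 1")
    case True
    then have "ln (max 1 (cmod (poly P z))) = circle_mean (\<lambda>_. 0) z (of_real r)" by (simp add: max_def)
    also have "\<dots> \<le> circle_mean u z (of_real r)" by (intro circle_mean_mono cu) (auto simp: u0)
    finally show ?thesis unfolding u_def .
  next
    case False
    then have Pz: "poly P z \<noteq> 0" by auto
    then have P: "P \<noteq> 0" by auto
    \<comment> \<open>Both signs are collected because \<open>r\<close> is an arbitrary real number
      and the limit in \<open>s\<close> is two-sided.\<close>
    define B where "B = (\<lambda>w. cmod (z - w)) ` {w. poly P w = 0} \<union> (\<lambda>w. - cmod (z - w)) ` {w. poly P w = 0}"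
    have B: "finite B" unfolding B_def using poly_roots_finite[OF P] by auto
    have "u z \<le> circle_mean u z (of_real s)" if "s \<notin> B" for s
    proof -
      have nz: "poly P x \<noteq> 0" if "x \<in> sphere z (cmod (of_real s))" for x
      proof
        assume "poly P x = 0"
        then have "cmod (z - x) \<in> B" "- cmod (z - x) \<in> B" by (auto simp: B_def)
        then show False using \<open>s \<notin> B\<close> that by (auto simp: dist_norm abs_if split: if_splits)
      qed
      have "u z = ln (cmod (poly P z))" using False by (simp add: u_def max_def)
      also have "\<dots> \<le> circle_mean (\<lambda>x. ln (cmod (poly P x))) z (of_real s)"
        by (rule circle_mean_ln_poly_ge[OF Pz nz])
      also have "\<dots> \<le> circle_mean u z (of_real s)"
        unfolding u_def using nz
        by (intro circle_mean_mono cu[unfolded u_def] continuous_intros) (auto simp: less_max_iff_disj)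
      finally show ?thesis .
    qed
    then have "eventually (\<lambda>s. u z \<le> circle_mean u z (of_real s)) (at r)"
      using islimpt_finite[OF B, of r] unfolding islimpt_iff_eventually
      by (auto elim!: eventually_mono simp: not_frequently)
    moreover have "((\<lambda>s. circle_mean u z (of_real s)) \<longlongrightarrow> circle_mean u z (of_real r)) (at r)"
      using continuous_circle_mean_radius[OF cu] by (simp add: continuous_on_def)
    ultimately have "u z \<le> circle_mean u z (of_real r)"
      by (intro tendsto_lowerbound[of _ _ "at r"]) auto
    then show ?thesis unfolding u_def .
  qed
qed

section \<open>Mean value inequalities and maximum principles\<close>

text \<open>The zero set is closed by continuity. It is open because every point y near a zero x
  lies on the circle about x of radius dist x y, and a nonnegative function whose mean there is at
  most 0 vanishes on it. Connectedness does the rest.\<close>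

lemma supermean_zero_propagates:
  fixes v :: "complex \<Rightarrow> real"
  assumes G: "open G" "connected G" and v: "continuous_on G v" and nn: "\<And>z. z \<in> G \<Longrightarrow> 0 \<le> v z"
    and sm: "\<And>z r. z \<in> G \<Longrightarrow> 0 < r \<Longrightarrow> cball z r \<subseteq> G \<Longrightarrow> v z = 0 \<Longrightarrow> circle_mean v z (of_real r) \<le> 0"
    and z0: "z0 \<in> G" "v z0 = 0" and z: "z \<in> G"
  shows "v z = 0"
proof -
  let ?Z = "{x \<in> G. v x = 0}"
  have "closedin (top_of_set G) ?Z"
    using continuous_closedin_preimage_constant[OF v] by (simp add: vimage_def Collect_conj_eq Int_commute)
  moreover have "openin (top_of_set G) ?Z"
  proof -
    have "open ?Z" unfolding open_contains_ball
    proof safe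
      fix x assume x: "x \<in> G" "v x = 0"
      then obtain e where e: "e > 0" "cball x e \<subseteq> G" using G(1) open_contains_cball by blast
      have "y \<in> ?Z" if "y \<in> ball x e" for y
      proof -
        have yG: "y \<in> G" using that e by auto
        have "v y = 0"
        proof (cases "y = x")
          case False
          define r where "r = dist x y"
          have r: "0 < r" "cball x r \<subseteq> G" using False that e by (auto simp: r_def)
          have s: "sphere x (cmod (of_real r)) \<subseteq> G" using r by auto
          show ?thesis
            by (rule circle_mean_nonpos_imp_zero[of x "of_real r" v y])
               (use s sm[OF x(1) r x(2)] r_def nn in \<open>auto intro: continuous_on_subset[OF v]\<close>)
        qed (use x in auto)
        then show ?thesis using yG by auto
      qed
      then show "\<exists>e>0. ball x e \<subseteq> ?Z" using e by blast
    qed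
    then show ?thesis unfolding openin_open_eq[OF G(1)] by auto
  qed
  ultimately have "?Z = {} \<or> ?Z = G" using G(2)[unfolded connected_clopen, rule_format, of ?Z] by simp
  then show ?thesis using z0 z by auto
qed

text \<open>Among the maximum points, one with largest real part cannot be interior.\<close>
lemma compact_max_principle:
  fixes \<psi> :: "complex \<Rightarrow> real"
  assumes D: "compact D" and c: "continuous_on D \<psi>"
    and fr: "\<And>z. z \<in> frontier D \<Longrightarrow> \<psi> z \<le> B"
    and loc: "\<And>z. z \<in> interior D \<Longrightarrow> \<psi> z > B \<Longrightarrow> (\<And>x. x \<in> D \<Longrightarrow> \<psi> x \<le> \<psi> z) \<Longrightarrow>
       \<exists>e>0. \<forall>x\<in>ball z e. \<psi> x = \<psi> z"
    and z: "z \<in> D"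
  shows "\<psi> z \<le> B"
proof (rule ccontr)
  assume neg: "\<not> \<psi> z \<le> B"
  obtain m where m: "m \<in> D" "\<And>x. x \<in> D \<Longrightarrow> \<psi> x \<le> \<psi> m"
    using continuous_attains_sup[OF D _ c] z by blast
  have mB: "\<psi> m > B" using m(2)[OF z] neg by linarith
  let ?Z = "{x \<in> D. \<psi> x = \<psi> m}"
  have "closed ?Z" using continuous_closed_preimage_constant[OF c compact_imp_closed[OF D]] .
  then have "compact (D \<inter> ?Z)" by (rule compact_Int_closed[OF D])
  moreover have "D \<inter> ?Z = ?Z" by auto
  ultimately have "compact ?Z" by simp
  moreover have "?Z \<noteq> {}" using m by blast
  ultimately obtain y where y: "y \<in> ?Z" "\<And>x. x \<in> ?Z \<Longrightarrow> Re x \<le> Re y"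
    using continuous_attains_sup[of ?Z Re] continuous_on_Re[OF continuous_on_id] by blast
  have "y \<notin> frontier D" using fr[of y] y mB by auto
  then have yi: "y \<in> interior D" using y compact_imp_closed[OF D] by (simp add: frontier_def)
  then obtain e where e: "e > 0" "\<forall>x\<in>ball y e. \<psi> x = \<psi> y"
    using loc[of y] y m mB by auto
  obtain e' where e': "e' > 0" "ball y e' \<subseteq> D" using yi mem_interior by blast
  define x where "x = y + of_real (min e e' / 2)"
  have "x \<in> ball y e \<inter> ball y e'" using e(1) e'(1) by (auto simp: x_def dist_norm)
  then have "x \<in> D" "\<psi> x = \<psi> y" using e'(2) e(2) by blast+
  then have "x \<in> ?Z" using y(1) by simp
  then have "Re x \<le> Re y" using y(2) by blast
  then show False using e(1) e'(1) by (simp add: x_def)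
qed

text \<open>Made for exhausting unbounded regions: the domain lies between a level set and a large
  circle, and the two kinds of frontier points receive separate estimates.\<close>

lemma frontier_superlevel_cball:
  fixes f :: "complex \<Rightarrow> real"
  assumes f: "continuous_on UNIV f" and x: "x \<in> frontier ({x. s \<le> f x} \<inter> cball 0 \<rho>)"
  shows "f x = s \<or> cmod x = \<rho>"
proof (rule ccontr)
  let ?D = "{x. s \<le> f x} \<inter> cball 0 \<rho>" and ?U = "{x. s < f x} \<inter> ball 0 \<rho>"
  assume neg: "\<not> ?thesis"
  have "closed {x. s \<le> f x}" by (intro closed_Collect_le continuous_on_const f)
  then have "closed ?D" by auto
  then have "x \<in> ?D" "x \<notin> interior ?D" using x by (auto simp: frontier_def)
  moreover from this have "x \<in> ?U" using neg by auto
  moreover have "open {x. s < f x}" by (intro open_Collect_less continuous_on_const f)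
  then have "open ?U" by auto
  moreover have "?U \<subseteq> ?D" by auto
  ultimately show False using interiorI by blast
qed

text \<open>Supplies the local constancy asked for by \<open>compact_max_principle\<close>: each
  point of the ball lies on a circle about z over which v z - v is nonnegative with mean at most
  0.\<close>

lemma local_const_of_mean:
  fixes v :: "complex \<Rightarrow> real"
  assumes v: "continuous_on (ball z e) v" and nn: "\<And>x. x \<in> ball z e \<Longrightarrow> v x \<le> v z"
    and sm: "\<And>r. 0 < r \<Longrightarrow> r < e \<Longrightarrow> circle_mean v z (of_real r) \<ge> v z" and x: "x \<in> ball z e"
  shows "v x = v z"
proof (cases "x = z")
  case False
  define r where "r = dist z x"
  have r: "0 < r" "r < e" using False x by (auto simp: r_def)
  have s: "sphere z (cmod (of_real r)) \<subseteq> ball z e" using r by auto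
  have c: "continuous_on (sphere z (cmod (of_real r))) v" using continuous_on_subset[OF v s] .
  have "circle_mean (\<lambda>x. v z - v x) z (of_real r) = v z - circle_mean v z (of_real r)"
    using c by (subst circle_mean_diff) auto
  then have "circle_mean (\<lambda>x. v z - v x) z (of_real r) \<le> 0" using sm[OF r] by simp
  then have "v z - v x = 0"
    by (intro circle_mean_nonpos_imp_zero[of z "of_real r" "\<lambda>x. v z - v x" x] continuous_intros c)
       (use s nn r_def in auto)
  then show ?thesis by simp
qed auto

subsection \<open>Logarithmic potentials\<close>

text \<open>The sign is that of a subharmonic function. The indicator cuts the measure down to a
  compact set that may carry only part of its mass, as happens in the proof of Frostman's
  theorem.\<close>

definition logpot :: "complex measure \<Rightarrow> complex set \<Rightarrow> complex \<Rightarrow> real" where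
  "logpot M A z = (\<integral>w. indicator A w * ln (cmod (z - w)) \<partial>M)"

context
  fixes M :: "complex measure" and A :: "complex set"
  assumes fin: "finite_measure M" and sM: "sets M = sets borel" and A: "compact A"
begin

lemma A_borel [measurable]: "A \<in> sets M"
  using A sM by (simp add: borel_closed compact_imp_closed)

lemma kernel_bound:
  assumes s: "0 < s" "\<And>w. w \<in> A \<Longrightarrow> s \<le> cmod (z - w)" "\<And>w. w \<in> A \<Longrightarrow> cmod (z - w) \<le> t"
  shows "\<bar>indicator A w * ln (cmod (z - w))\<bar> \<le> \<bar>ln s\<bar> + \<bar>ln t\<bar>"
proof (cases "w \<in> A")
  case True
  then have "s \<le> cmod (z - w)" "cmod (z - w) \<le> t" using s by auto
  then have "ln s \<le> ln (cmod (z - w))" "ln (cmod (z - w)) \<le> ln t" using s(1)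
    by (auto intro!: ln_mono)
  then show ?thesis using True by auto
qed auto

lemma kernel_measurable [measurable]:
  "(\<lambda>w. indicator A w * ln (cmod (z - w))) \<in> borel_measurable M"
proof -
  have "(\<lambda>w. ln (cmod (z - w))) \<in> borel_measurable M"
    unfolding measurable_cong_sets[OF sM refl] by measurable
  then show ?thesis by (intro borel_measurable_times borel_measurable_indicator A_borel)
qed

lemma kernel_bounds_exist:
  assumes "compact C" "C \<inter> A = {}"
  obtains s t where "0 < s" "\<And>z w. z \<in> C \<Longrightarrow> w \<in> A \<Longrightarrow> s \<le> cmod (z - w)"
    "\<And>z w. z \<in> C \<Longrightarrow> w \<in> A \<Longrightarrow> cmod (z - w) \<le> t"
proof -
  obtain s where s: "0 < s" "\<And>z w. z \<in> C \<Longrightarrow> w \<in> A \<Longrightarrow> s \<le> dist z w"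
    using separate_compact_closed[OF assms(1) compact_imp_closed[OF A] assms(2)] by blast
  have "bounded C" "bounded A" using assms A by (auto simp: compact_imp_bounded)
  then obtain a b where "\<forall>z\<in>C. cmod z \<le> a" "\<forall>z\<in>A. cmod z \<le> b" by (auto simp: bounded_iff)
  then have "cmod (z - w) \<le> a + b" if "z \<in> C" "w \<in> A" for z w
    using that norm_triangle_ineq4[of z w] by fastforce
  then show ?thesis using that s by (auto simp: dist_norm)
qed

lemma logpot_integrable:
  assumes "z \<notin> A"
  shows "integrable M (\<lambda>w. indicator A w * ln (cmod (z - w)))"
proof -
  interpret finite_measure M by (rule fin)
  have "compact {z}" "{z} \<inter> A = {}" using assms by auto
  then obtain s t where st: "0 < s" "\<And>x w. x \<in> {z} \<Longrightarrow> w \<in> A \<Longrightarrow> s \<le> cmod (x - w)"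
      "\<And>x w. x \<in> {z} \<Longrightarrow> w \<in> A \<Longrightarrow> cmod (x - w) \<le> t"
    by (rule kernel_bounds_exist) blast
  from kernel_bound[OF st(1) st(2,3)[OF singletonI]] show ?thesis
    by (intro integrable_const_bound[of _ "\<bar>ln s\<bar> + \<bar>ln t\<bar>"]) auto
qed

lemma logpot_continuous: "continuous_on (- A) (logpot M A)"
proof -
  interpret finite_measure M by (rule fin)
  have "isCont (logpot M A) z" if z: "z \<notin> A" for z
  proof (rule continuous_at_sequentiallyI)
    fix X :: "nat \<Rightarrow> complex" assume X: "X \<longlonglongrightarrow> z"
    have "open (- A)" using A by (simp add: compact_imp_closed open_Compl)
    then obtain e where e: "e > 0" "cball z e \<subseteq> - A" using z open_contains_cball[of "- A"] by blast
    then have dis: "cball z e \<inter> A = {}" by auto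
    obtain s t where st: "0 < s" "\<And>x w. x \<in> cball z e \<Longrightarrow> w \<in> A \<Longrightarrow> s \<le> cmod (x - w)"
        "\<And>x w. x \<in> cball z e \<Longrightarrow> w \<in> A \<Longrightarrow> cmod (x - w) \<le> t"
      by (rule kernel_bounds_exist[OF compact_cball dis]) blast
    have ev: "eventually (\<lambda>n. X n \<in> cball z e) sequentially"
      using tendstoD[OF X e(1)] by eventually_elim (auto simp: dist_commute)
    then obtain N where N: "\<And>n. n \<ge> N \<Longrightarrow> X n \<in> cball z e" by (auto simp: eventually_sequentially)
    have "(\<lambda>n. logpot M A (X (n + N))) \<longlonglongrightarrow> logpot M A z"
      unfolding logpot_def
    proof (rule integral_dominated_convergence[where w = "\<lambda>_. \<bar>ln s\<bar> + \<bar>ln t\<bar>"])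
      show "AE w in M. (\<lambda>n. indicator A w * ln (cmod (X (n + N) - w))) \<longlonglongrightarrow> indicator A w * ln (cmod (z - w))"
      proof (rule AE_I2)
        fix w
        show "(\<lambda>n. indicator A w * ln (cmod (X (n + N) - w))) \<longlonglongrightarrow> indicator A w * ln (cmod (z - w))"
        proof (cases "w \<in> A")
          case True
          then have "z \<noteq> w" using z by auto
          then show ?thesis by (intro tendsto_intros LIMSEQ_ignore_initial_segment X) auto
        qed auto
      qed
      show "AE x in M. norm (indicator A x * ln (cmod (X (i + N) - x))) \<le> \<bar>ln s\<bar> + \<bar>ln t\<bar>" for i
        using kernel_bound[of s "X (i + N)" t] st N[of "i + N"] by auto
    qed auto
    then show "(\<lambda>n. logpot M A (X n)) \<longlonglongrightarrow> logpot M A z" by (rule LIMSEQ_offset)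
  qed
  then show ?thesis by (auto intro!: continuous_at_imp_continuous_on)
qed

text \<open>Fubini's theorem reduces the mean of the potential to the mean of a single logarithm; it
  applies because the circle has positive distance from A, so that the kernel is bounded.\<close>

lemma logpot_circle_mean:
  assumes "\<And>w. w \<in> A \<Longrightarrow> cmod (z - w) \<noteq> cmod r"
  shows "circle_mean (logpot M A) z r = (\<integral>w. indicator A w * ln (max (cmod r) (cmod (z - w))) \<partial>M)"
proof -
  interpret finite_measure M by (rule fin)
  interpret C: prob_space circ by (rule prob_space_circ)
  interpret P: pair_sigma_finite circ M ..
  have dis: "sphere z (cmod r) \<inter> A = {}" using assms by (auto simp: dist_norm)
  obtain s t where st: "0 < s" "\<And>x w. x \<in> sphere z (cmod r) \<Longrightarrow> w \<in> A \<Longrightarrow> s \<le> cmod (x - w)"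
        "\<And>x w. x \<in> sphere z (cmod r) \<Longrightarrow> w \<in> A \<Longrightarrow> cmod (x - w) \<le> t"
    by (rule kernel_bounds_exist[OF compact_sphere dis]) blast
  let ?f = "\<lambda>(x, w). indicator A w * ln (cmod (z + r * unit_exp x - w))"
  have fm: "finite_measure (circ \<Otimes>\<^sub>M M)"
  proof
    show "emeasure (circ \<Otimes>\<^sub>M M) (space (circ \<Otimes>\<^sub>M M)) \<noteq> \<infinity>"
      by (simp add: space_pair_measure emeasure_pair_measure_Times ennreal_mult_eq_top_iff C.emeasure_space_1)
  qed
  have un: "unit_exp \<in> borel_measurable borel"
    by (intro borel_measurable_continuous_onI continuous_unit_exp)
  have [measurable]: "unit_exp \<in> circ \<rightarrow>\<^sub>M borel" by (rule borel_measurable_circ[OF un])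
  have id [measurable]: "(\<lambda>w. w) \<in> M \<rightarrow>\<^sub>M borel" by (simp add: measurable_def sM sets_eq_imp_space_eq[OF sM])
  have m: "?f \<in> borel_measurable (circ \<Otimes>\<^sub>M M)" by measurable
  have "integrable (circ \<Otimes>\<^sub>M M) ?f"
  proof (rule finite_measure.integrable_const_bound[OF fm _ m, of "\<bar>ln s\<bar> + \<bar>ln t\<bar>"], rule AE_I2)
    fix y show "norm (?f y) \<le> \<bar>ln s\<bar> + \<bar>ln t\<bar>"
      using kernel_bound[of s "z + r * unit_exp (fst y)" t "snd y"] st
      by (cases y) (auto simp: dist_norm norm_mult)
  qed
  from P.Fubini_integral[OF this]
  have "circle_mean (logpot M A) z r = (\<integral>w. (\<integral>x. indicator A w * ln (cmod (z + r * unit_exp x - w)) \<partial>circ) \<partial>M)"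
    by (simp add: circle_mean_def logpot_def)
  also have "\<dots> = (\<integral>w. indicator A w * ln (max (cmod r) (cmod (z - w))) \<partial>M)"
  proof (rule Bochner_Integration.integral_cong[OF refl])
    fix w
    show "(\<integral>x. indicator A w * ln (cmod (z + r * unit_exp x - w)) \<partial>circ) = indicator A w * ln (max (cmod r) (cmod (z - w)))"
      using circle_mean_ln[of z w r] assms[of w] by (cases "w \<in> A") (auto simp: circle_mean_def)
  qed
  finally show ?thesis .
qed

lemma logpot_mean_eq:
  assumes "cball z r \<inter> A = {}" "0 < r"
  shows "circle_mean (logpot M A) z (of_real r) = logpot M A z"
proof -
  have *: "cmod (z - w) > r" if "w \<in> A" for w
  proof -
    have "w \<notin> cball z r" using assms(1) that by blast
    then show ?thesis by (simp add: dist_norm)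
  qed
  have "circle_mean (logpot M A) z (of_real r) = (\<integral>w. indicator A w * ln (max (cmod (of_real r)) (cmod (z - w))) \<partial>M)"
  proof (rule logpot_circle_mean)
    show "cmod (z - w) \<noteq> cmod (of_real r)" if "w \<in> A" for w using *[OF that] assms(2) by simp
  qed
  also have "\<dots> = logpot M A z" unfolding logpot_def
  proof (rule Bochner_Integration.integral_cong[OF refl])
    show "indicator A w * ln (max (cmod (of_real r)) (cmod (z - w))) = indicator A w * ln (cmod (z - w))" for w
      using *[of w] assms(2) by (cases "w \<in> A") auto
  qed
  finally show ?thesis .
qed

text \<open>An exact substitute for the expansion of the potential at infinity.\<close>

lemma logpot_mean_large:
  assumes "A \<subseteq> ball z r" "0 < r"
  shows "circle_mean (logpot M A) z (of_real r) = measure M A * ln r"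
proof -
  have *: "cmod (z - w) < r" if "w \<in> A" for w
  proof -
    have "w \<in> ball z r" using assms(1) that by blast
    then show ?thesis by (simp add: dist_norm)
  qed
  have "circle_mean (logpot M A) z (of_real r) = (\<integral>w. indicator A w * ln (max (cmod (of_real r)) (cmod (z - w))) \<partial>M)"
  proof (rule logpot_circle_mean)
    show "cmod (z - w) \<noteq> cmod (of_real r)" if "w \<in> A" for w using *[OF that] assms(2) by simp
  qed
  also have "\<dots> = (\<integral>w. indicator A w * ln r \<partial>M)"
  proof (rule Bochner_Integration.integral_cong[OF refl])
    show "indicator A w * ln (max (cmod (of_real r)) (cmod (z - w))) = indicator A w * ln r" for w
      using *[of w] assms(2) by (cases "w \<in> A") auto
  qed
  also have "\<dots> = measure M A * ln r" by simp
  finally show ?thesis .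
qed

lemma logpot_lower:
  assumes "\<And>w. w \<in> A \<Longrightarrow> s \<le> cmod (z - w)" "0 < s"
  shows "measure M A * ln s \<le> logpot M A z"
proof -
  interpret finite_measure M by (rule fin)
  have "z \<notin> A" using assms by force
  have "measure M A * ln s = (\<integral>w. indicator A w * ln s \<partial>M)" by simp
  also have "\<dots> \<le> logpot M A z" unfolding logpot_def
    by (intro integral_mono logpot_integrable \<open>z \<notin> A\<close> integrable_mult_left integrable_real_indicator)
       (use assms in \<open>auto simp: indicator_def intro!: ln_mono emeasure_finite simp: less_top[symmetric]\<close>)
  finally show ?thesis .
qed

end

subsection \<open>Truncated logarithmic kernel\<close>

text \<open>Truncation makes the kernel Lipschitz with constant 1 / \<delta>, so potentials are
  continuous and weak limits apply. For x \<noteq> 0 the values decrease to the logarithm and agree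
  with it once \<delta> \<le> |x|.\<close>

definition trunc_ln :: "real \<Rightarrow> complex \<Rightarrow> real" where
  "trunc_ln \<delta> x = ln (max \<delta> (cmod x))"

definition trunc_pot :: "complex measure \<Rightarrow> real \<Rightarrow> complex \<Rightarrow> real" where
  "trunc_pot \<nu> \<delta> z = (\<integral>w. trunc_ln \<delta> (z - w) \<partial>\<nu>)"

definition trunc_energy :: "complex measure \<Rightarrow> real \<Rightarrow> real" where
  "trunc_energy \<nu> \<delta> = (\<integral>z. trunc_pot \<nu> \<delta> z \<partial>\<nu>)"

lemma trunc_ln_ge: "0 < \<delta> \<Longrightarrow> ln \<delta> \<le> trunc_ln \<delta> x"
  unfolding trunc_ln_def by (intro ln_mono) auto

lemma trunc_ln_le: "0 < \<delta> \<Longrightarrow> cmod x \<le> t \<Longrightarrow> trunc_ln \<delta> x \<le> ln (max \<delta> t)"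
  unfolding trunc_ln_def by (intro ln_mono) auto

lemma trunc_ln_mono: "0 < \<delta> \<Longrightarrow> \<delta> \<le> \<delta>' \<Longrightarrow> trunc_ln \<delta> x \<le> trunc_ln \<delta>' x"
  unfolding trunc_ln_def by (intro ln_mono) auto

lemma trunc_ln_ge_ln: "0 < \<delta> \<Longrightarrow> x \<noteq> 0 \<Longrightarrow> ln (cmod x) \<le> trunc_ln \<delta> x"
  unfolding trunc_ln_def by (intro ln_mono) auto

lemma trunc_ln_eq: "\<delta> \<le> cmod x \<Longrightarrow> trunc_ln \<delta> x = ln (cmod x)"
  unfolding trunc_ln_def by (simp add: max_def)

lemma trunc_ln_minus_commute: "trunc_ln \<delta> (x - y) = trunc_ln \<delta> (y - x)"
  by (simp add: trunc_ln_def norm_minus_commute)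

lemma trunc_ln_lipschitz:
  assumes "0 < \<delta>"
  shows "\<bar>trunc_ln \<delta> x - trunc_ln \<delta> y\<bar> \<le> dist x y / \<delta>"
proof -
  have *: "ln a - ln b \<le> \<bar>a - b\<bar> / \<delta>" if "a \<ge> \<delta>" "b \<ge> \<delta>" for a b :: real
  proof -
    have ab: "a > 0" "b > 0" using that assms by auto
    then have "ln a - ln b = ln (a / b)" by (simp add: ln_div)
    also have "\<dots> \<le> a / b - 1" using ab by (intro ln_le_minus_one) auto
    also have "\<dots> = (a - b) / b" using ab by (simp add: field_simps)
    also have "\<dots> \<le> \<bar>a - b\<bar> / b" using ab by (intro divide_right_mono) auto
    also have "\<dots> \<le> \<bar>a - b\<bar> / \<delta>" using that assms by (intro divide_left_mono) auto
    finally show ?thesis .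
  qed
  have d: "\<bar>max \<delta> (cmod x) - max \<delta> (cmod y)\<bar> \<le> dist x y"
    using norm_triangle_ineq3[of x y] by (auto simp: dist_norm max_def)
  then have "\<bar>max \<delta> (cmod x) - max \<delta> (cmod y)\<bar> / \<delta> \<le> dist x y / \<delta>"
    using assms by (intro divide_right_mono) auto
  then show ?thesis
    using *[of "max \<delta> (cmod x)" "max \<delta> (cmod y)"] *[of "max \<delta> (cmod y)" "max \<delta> (cmod x)"]
    unfolding trunc_ln_def by (simp add: abs_le_iff abs_minus_commute)
qed

lemma continuous_trunc_ln [continuous_intros]:
  assumes "0 < \<delta>" "continuous_on A f"
  shows "continuous_on A (\<lambda>x. trunc_ln \<delta> (f x))"
  unfolding trunc_ln_def using assms by (intro continuous_intros) (auto simp: less_max_iff_disj max_def)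

lemma measurable_trunc_ln [measurable]: "trunc_ln \<delta> \<in> borel_measurable borel"
  unfolding trunc_ln_def by measurable

lemma trunc_ln_abs:
  assumes "0 < \<delta>" "cmod x \<le> t"
  shows "\<bar>trunc_ln \<delta> x\<bar> \<le> \<bar>ln \<delta>\<bar> + \<bar>ln (max \<delta> t)\<bar>"
  using trunc_ln_ge[OF assms(1), of x] trunc_ln_le[OF assms] by linarith

locale bounded_prob = prob_space \<nu> for \<nu> :: "complex measure" +
  fixes r :: real
  assumes sets_nu: "sets \<nu> = sets borel" and AE_bounded: "AE w in \<nu>. cmod w \<le> r"
begin

lemma id_measurable [measurable]: "(\<lambda>w. w) \<in> \<nu> \<rightarrow>\<^sub>M borel"
  using sets_nu by (simp add: measurable_cong_sets[OF sets_nu refl])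

lemma borel_measurable_nu: "f \<in> borel_measurable borel \<Longrightarrow> f \<in> borel_measurable \<nu>"
  by (simp add: measurable_cong_sets[OF sets_nu refl])

lemma trunc_ln_integrable:
  assumes "0 < \<delta>"
  shows "integrable \<nu> (\<lambda>w. trunc_ln \<delta> (z - w))"
proof (rule integrable_const_bound[of _ "\<bar>ln \<delta>\<bar> + \<bar>ln (max \<delta> (cmod z + r))\<bar>"])
  show "AE w in \<nu>. norm (trunc_ln \<delta> (z - w)) \<le> \<bar>ln \<delta>\<bar> + \<bar>ln (max \<delta> (cmod z + r))\<bar>"
    using AE_bounded
  proof eventually_elim
    case (elim w)
    then have "cmod (z - w) \<le> cmod z + r" using norm_triangle_ineq4[of z w] by linarith
    from trunc_ln_abs[OF assms this] show ?case by simp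
  qed
qed (measurable)

lemma trunc_pot_lipschitz:
  assumes "0 < \<delta>"
  shows "\<bar>trunc_pot \<nu> \<delta> z - trunc_pot \<nu> \<delta> z'\<bar> \<le> dist z z' / \<delta>"
proof -
  have "trunc_pot \<nu> \<delta> z - trunc_pot \<nu> \<delta> z' = (\<integral>w. trunc_ln \<delta> (z - w) - trunc_ln \<delta> (z' - w) \<partial>\<nu>)"
    unfolding trunc_pot_def by (simp add: Bochner_Integration.integral_diff trunc_ln_integrable assms)
  also have "\<bar>\<dots>\<bar> \<le> (\<integral>w. \<bar>trunc_ln \<delta> (z - w) - trunc_ln \<delta> (z' - w)\<bar> \<partial>\<nu>)"
    by (rule integral_abs_bound)
  also have "\<dots> \<le> (\<integral>w. dist z z' / \<delta> \<partial>\<nu>)"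
  proof (intro integral_mono integrable_abs Bochner_Integration.integrable_diff trunc_ln_integrable assms integrable_const)
    show "\<bar>trunc_ln \<delta> (z - w) - trunc_ln \<delta> (z' - w)\<bar> \<le> dist z z' / \<delta>" for w
      using trunc_ln_lipschitz[OF assms, of "z - w" "z' - w"] by (simp add: dist_norm)
  qed
  finally show ?thesis by (simp add: prob_space)
qed

lemma continuous_trunc_pot:
  assumes "0 < \<delta>"
  shows "continuous_on A (trunc_pot \<nu> \<delta>)"
  unfolding continuous_on_iff
proof safe
  fix x and e :: real assume "0 < e"
  then show "\<exists>d>0. \<forall>x'\<in>A. dist x' x < d \<longrightarrow> dist (trunc_pot \<nu> \<delta> x') (trunc_pot \<nu> \<delta> x) < e"
  proof (intro exI[of _ "e * \<delta>"] conjI ballI impI)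
    fix x' assume "dist x' x < e * \<delta>"
    then have "dist x' x / \<delta> < e" using assms by (simp add: field_simps)
    then show "dist (trunc_pot \<nu> \<delta> x') (trunc_pot \<nu> \<delta> x) < e"
      using trunc_pot_lipschitz[OF assms, of x' x] by (simp add: dist_real_def)
  qed (use assms in auto)
qed

lemma trunc_pot_measurable [measurable]: "0 < \<delta> \<Longrightarrow> trunc_pot \<nu> \<delta> \<in> borel_measurable \<nu>"
  by (intro borel_measurable_nu borel_measurable_continuous_onI continuous_trunc_pot)

lemma trunc_pot_ge: "0 < \<delta> \<Longrightarrow> ln \<delta> \<le> trunc_pot \<nu> \<delta> z"
  unfolding trunc_pot_def by (intro integral_ge_const trunc_ln_integrable AE_I2 trunc_ln_ge)

lemma trunc_pot_le:
  assumes "0 < \<delta>"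
  shows "trunc_pot \<nu> \<delta> z \<le> ln (max \<delta> (cmod z + r))"
  unfolding trunc_pot_def
proof (rule integral_le_const[OF trunc_ln_integrable[OF assms]])
  show "AE w in \<nu>. trunc_ln \<delta> (z - w) \<le> ln (max \<delta> (cmod z + r))"
    using AE_bounded
  proof eventually_elim
    case (elim w)
    then have "cmod (z - w) \<le> cmod z + r" using norm_triangle_ineq4[of z w] by linarith
    from trunc_ln_le[OF assms this] show ?case .
  qed
qed

lemma trunc_pot_le_2r:
  assumes "0 < \<delta>" "cmod z \<le> r"
  shows "trunc_pot \<nu> \<delta> z \<le> ln (max \<delta> (2 * r))"
proof -
  have "ln (max \<delta> (cmod z + r)) \<le> ln (max \<delta> (2 * r))"
    using assms by (intro ln_mono) auto
  then show ?thesis using trunc_pot_le[OF assms(1), of z] by linarith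
qed

lemma trunc_pot_integrable:
  assumes "0 < \<delta>"
  shows "integrable \<nu> (trunc_pot \<nu> \<delta>)"
proof (rule integrable_const_bound[of _ "\<bar>ln \<delta>\<bar> + \<bar>ln (max \<delta> (2 * r))\<bar>"])
  show "AE z in \<nu>. norm (trunc_pot \<nu> \<delta> z) \<le> \<bar>ln \<delta>\<bar> + \<bar>ln (max \<delta> (2 * r))\<bar>"
    using AE_bounded
  proof eventually_elim
    case (elim z)
    then show ?case using trunc_pot_ge[OF assms, of z] trunc_pot_le_2r[OF assms, of z] by auto
  qed
qed (use assms in measurable)

lemma trunc_pot_mono: "0 < \<delta> \<Longrightarrow> \<delta> \<le> \<delta>' \<Longrightarrow> trunc_pot \<nu> \<delta> z \<le> trunc_pot \<nu> \<delta>' z"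
  unfolding trunc_pot_def by (intro integral_mono trunc_ln_integrable trunc_ln_mono) auto

lemma trunc_energy_mono: "0 < \<delta> \<Longrightarrow> \<delta> \<le> \<delta>' \<Longrightarrow> trunc_energy \<nu> \<delta> \<le> trunc_energy \<nu> \<delta>'"
  unfolding trunc_energy_def by (intro integral_mono trunc_pot_integrable trunc_pot_mono) auto

lemma AE_imp_nonempty:
  assumes "AE w in \<nu>. w \<in> S"
  shows "S \<noteq> {}"
proof
  assume "S = {}"
  then have "AE w in \<nu>. False" using assms by simp
  then show False by (simp add: AE_False)
qed

lemma log_kernel_neg_eq: "log_kernel_neg z w = trunc_ln 1 (z - w)"
proof (cases "z = w")
  case False
  then show ?thesis
    by (cases "cmod (z - w) \<le> 1") (auto simp: log_kernel_neg_def trunc_ln_def max_def ln_ge_zero_iff)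
qed (simp add: log_kernel_neg_def trunc_ln_def)

text \<open>Written as a supremum of an increasing sequence of continuous kernels, ready for
  monotone convergence. On the diagonal the n-th term is ln (n + 1), which produces the value
  infinity.\<close>

lemma log_kernel_pos_eq:
  "log_kernel_pos z w = (SUP n. ennreal (trunc_ln 1 (z - w) - trunc_ln (1 / real (Suc n)) (z - w)))"
proof -
  let ?f = "\<lambda>n. trunc_ln 1 (z - w) - trunc_ln (1 / real (Suc n)) (z - w)"
  have "incseq (\<lambda>n. ennreal (?f n))"
    by (intro incseq_SucI ennreal_leI diff_left_mono trunc_ln_mono) (auto simp: field_simps)
  then have 1: "(\<lambda>n. ennreal (?f n)) \<longlonglongrightarrow> (SUP n. ennreal (?f n))" by (rule LIMSEQ_SUP)
  have 2: "(\<lambda>n. ennreal (?f n)) \<longlonglongrightarrow> log_kernel_pos z w"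
  proof (cases "z = w")
    case True
    have "?f n = ln (real (Suc n))" for n using True by (simp add: trunc_ln_def ln_div)
    moreover have "filterlim (\<lambda>n. ln (real (Suc n))) at_top sequentially"
      by (intro filterlim_compose[OF ln_at_top] filterlim_compose[OF filterlim_real_sequentially filterlim_Suc])
    ultimately show ?thesis using True by (simp add: log_kernel_pos_def ennreal_tendsto_top_eq_at_top)
  next
    case False
    then have pos: "cmod (z - w) > 0" by simp
    then obtain N where N: "inverse (real (Suc N)) < cmod (z - w)" using reals_Archimedean by blast
    have "?f n = max 0 (- ln (cmod (z - w)))" if "n \<ge> N" for n
    proof -
      have "1 / real (Suc n) \<le> 1 / real (Suc N)" using that by (intro divide_left_mono) auto
      then have "trunc_ln (1 / real (Suc n)) (z - w) = ln (cmod (z - w))"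
        using N by (intro trunc_ln_eq) (simp add: inverse_eq_divide)
      moreover have "trunc_ln 1 (z - w) = max 0 (ln (cmod (z - w)))"
        using log_kernel_neg_eq[of z w] False by (simp add: log_kernel_neg_def)
      ultimately show ?thesis by auto
    qed
    then have "eventually (\<lambda>n. ennreal (max 0 (- ln (cmod (z - w)))) = ennreal (?f n)) sequentially"
      unfolding eventually_sequentially by metis
    from Lim_transform_eventually[OF tendsto_const this] show ?thesis
      using False by (simp add: log_kernel_pos_def)
  qed
  show ?thesis using LIMSEQ_unique[OF 2 1] .
qed

text \<open>Monotone convergence is applied twice, in the inner and in the outer variable.\<close>

lemma log_energy_eq:
  "log_energy \<nu> = enn2ereal (SUP n. ennreal (trunc_energy \<nu> 1 - trunc_energy \<nu> (1 / real (Suc n)))) - ereal (trunc_energy \<nu> 1)"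
proof -
  let ?d = "\<lambda>n. 1 / real (Suc n)"
  have d: "0 < ?d n" "?d n \<le> 1" "?d (Suc n) \<le> ?d n" for n by (auto simp: field_simps)
  have in1: "(\<integral>\<^sup>+w. log_kernel_pos z w \<partial>\<nu>) = (SUP n. ennreal (trunc_pot \<nu> 1 z - trunc_pot \<nu> (?d n) z))" for z
  proof -
    have "(\<integral>\<^sup>+w. log_kernel_pos z w \<partial>\<nu>) = (SUP n. \<integral>\<^sup>+w. ennreal (trunc_ln 1 (z - w) - trunc_ln (?d n) (z - w)) \<partial>\<nu>)"
      unfolding log_kernel_pos_eq
      by (intro nn_integral_monotone_convergence_SUP incseq_SucI le_funI ennreal_leI diff_left_mono trunc_ln_mono d) measurable
    also have "\<dots> = (SUP n. ennreal (trunc_pot \<nu> 1 z - trunc_pot \<nu> (?d n) z))"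
    proof (rule SUP_cong[OF refl])
      fix n
      show "(\<integral>\<^sup>+w. ennreal (trunc_ln 1 (z - w) - trunc_ln (?d n) (z - w)) \<partial>\<nu>) = ennreal (trunc_pot \<nu> 1 z - trunc_pot \<nu> (?d n) z)"
        unfolding trunc_pot_def using trunc_ln_mono[OF d(1,2), of n]
        by (subst nn_integral_eq_integral)
           (simp_all add: trunc_ln_integrable d(1)[simplified] Bochner_Integration.integral_diff)
    qed
    finally show ?thesis .
  qed
  have "(\<integral>\<^sup>+z. (\<integral>\<^sup>+w. log_kernel_pos z w \<partial>\<nu>) \<partial>\<nu>) =
      (SUP n. \<integral>\<^sup>+z. ennreal (trunc_pot \<nu> 1 z - trunc_pot \<nu> (?d n) z) \<partial>\<nu>)"
    unfolding in1
    by (intro nn_integral_monotone_convergence_SUP incseq_SucI le_funI ennreal_leI diff_left_mono trunc_pot_mono d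
         measurable_compose[OF _ measurable_ennreal] borel_measurable_diff trunc_pot_measurable zero_less_one)
  also have "\<dots> = (SUP n. ennreal (trunc_energy \<nu> 1 - trunc_energy \<nu> (?d n)))"
  proof (rule SUP_cong[OF refl])
    fix n
    show "(\<integral>\<^sup>+z. ennreal (trunc_pot \<nu> 1 z - trunc_pot \<nu> (?d n) z) \<partial>\<nu>) = ennreal (trunc_energy \<nu> 1 - trunc_energy \<nu> (?d n))"
      unfolding trunc_energy_def using trunc_pot_mono[OF d(1,2), of n]
      by (subst nn_integral_eq_integral)
         (simp_all add: trunc_pot_integrable d(1)[simplified] Bochner_Integration.integral_diff)
  qed
  finally show ?thesis
    unfolding log_energy_def log_kernel_neg_eq trunc_energy_def trunc_pot_def by simp
qed

text \<open>From here on energies are real numbers: the truncated energies decrease to minus the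
  logarithmic energy, so an upper bound for the latter is a common lower bound for the
  former.\<close>

lemma log_energy_le_iff:
  "log_energy \<nu> \<le> ereal (- a) \<longleftrightarrow> (\<forall>\<delta>>0. a \<le> trunc_energy \<nu> \<delta>)"
proof -
  let ?d = "\<lambda>n. 1 / real (Suc n)"
  have d: "0 < ?d n" "?d n \<le> 1" for n by (auto simp: field_simps)
  have nn: "trunc_energy \<nu> (?d n) \<le> trunc_energy \<nu> 1" for n by (intro trunc_energy_mono d)
  have "log_energy \<nu> \<le> ereal (- a) \<longleftrightarrow>
      enn2ereal (SUP n. ennreal (trunc_energy \<nu> 1 - trunc_energy \<nu> (?d n))) \<le> ereal (trunc_energy \<nu> 1 - a)"
    unfolding log_energy_eq by (simp add: ereal_minus_le_iff algebra_simps)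
  also have "\<dots> \<longleftrightarrow> (\<forall>n. a \<le> trunc_energy \<nu> (?d n))"
  proof
    assume L: "enn2ereal (SUP n. ennreal (trunc_energy \<nu> 1 - trunc_energy \<nu> (?d n))) \<le> ereal (trunc_energy \<nu> 1 - a)"
    show "\<forall>n. a \<le> trunc_energy \<nu> (?d n)"
    proof
      fix n
      have "ennreal (trunc_energy \<nu> 1 - trunc_energy \<nu> (?d n)) \<le> (SUP n. ennreal (trunc_energy \<nu> 1 - trunc_energy \<nu> (?d n)))"
        by (rule SUP_upper) simp
      then have 1: "enn2ereal (ennreal (trunc_energy \<nu> 1 - trunc_energy \<nu> (?d n))) \<le> enn2ereal (SUP n. ennreal (trunc_energy \<nu> 1 - trunc_energy \<nu> (?d n)))"
        by (simp only: less_eq_ennreal.rep_eq)      have 2: "enn2ereal (ennreal (trunc_energy \<nu> 1 - trunc_energy \<nu> (?d n))) = ereal (trunc_energy \<nu> 1 - trunc_energy \<nu> (?d n))"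
        using nn[of n] by (intro enn2ereal_ennreal) simp
      have "ereal (trunc_energy \<nu> 1 - trunc_energy \<nu> (?d n)) \<le> ereal (trunc_energy \<nu> 1 - a)"
        using order_trans[OF 1 L] unfolding 2 .
      then show "a \<le> trunc_energy \<nu> (?d n)" by simp
    qed
  next
    assume R: "\<forall>n. a \<le> trunc_energy \<nu> (?d n)"
    then have "a \<le> trunc_energy \<nu> 1" using nn[of 0] by (meson order_trans)
    moreover have "(SUP n. ennreal (trunc_energy \<nu> 1 - trunc_energy \<nu> (?d n))) \<le> ennreal (trunc_energy \<nu> 1 - a)"
      using R by (intro SUP_least ennreal_leI) auto
    ultimately show "enn2ereal (SUP n. ennreal (trunc_energy \<nu> 1 - trunc_energy \<nu> (?d n))) \<le> ereal (trunc_energy \<nu> 1 - a)"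
      unfolding less_eq_ennreal.rep_eq by (simp only: enn2ereal_ennreal diff_ge_0_iff_ge)
  qed
  also have "\<dots> \<longleftrightarrow> (\<forall>\<delta>>0. a \<le> trunc_energy \<nu> \<delta>)"
  proof
    assume R: "\<forall>n. a \<le> trunc_energy \<nu> (?d n)"
    show "\<forall>\<delta>>0. a \<le> trunc_energy \<nu> \<delta>"
    proof safe
      fix \<delta> :: real assume "0 < \<delta>"
      then obtain n where "?d n < \<delta>" using reals_Archimedean by (auto simp: inverse_eq_divide)
      then show "a \<le> trunc_energy \<nu> \<delta>" using R trunc_energy_mono[OF d(1)] by (meson less_imp_le order_trans)
    qed
  qed (use d in auto)
  finally show ?thesis .
qed

lemma log_energy_lower: "ereal (- trunc_energy \<nu> 1) \<le> log_energy \<nu>"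
proof -
  have "ereal 0 - ereal (trunc_energy \<nu> 1) \<le> log_energy \<nu>" unfolding log_energy_eq
    by (intro ereal_minus_mono order_refl) (simp only: zero_ereal_def[symmetric] enn2ereal_nonneg)
  then show ?thesis by simp
qed

end

lemma prob_on_bounded_prob:
  assumes "prob_on E \<nu>" "E \<in> sets borel" "E \<subseteq> cball 0 r"
  shows "bounded_prob \<nu> r" "AE w in \<nu>. w \<in> E"
proof -
  interpret prob_space \<nu> using assms by (simp add: prob_on_def)
  have s: "sets \<nu> = sets borel" using assms by (simp add: prob_on_def)
  show E: "AE w in \<nu>. w \<in> E"
    using assms by (intro AE_prob_1) (auto simp: prob_on_def measure_def)
  show "bounded_prob \<nu> r"
    by unfold_locales (use s E assms in \<open>auto elim!: eventually_mono\<close>)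
qed

subsection \<open>Frostman's theorem\<close>

text \<open>\<open>I\<close> is minus the Robin constant, that is, the logarithm of the capacity.
  Both energy conditions range over all truncation levels and so involve real numbers only; minimal
  energy becomes a maximality condition by the sign of the kernel.\<close>

locale equilibrium =
  fixes K :: "complex set" and \<mu> :: "complex measure" and r I :: real
  assumes K: "compact K" "K \<subseteq> cball 0 r" and mu: "prob_on K \<mu>"
    and trunc_energy_ge: "\<And>\<delta>. 0 < \<delta> \<Longrightarrow> I \<le> trunc_energy \<mu> \<delta>"
    and maximal: "\<And>\<nu> a. prob_on K \<nu> \<Longrightarrow> (\<And>\<delta>. 0 < \<delta> \<Longrightarrow> a \<le> trunc_energy \<nu> \<delta>) \<Longrightarrow> a \<le> I"
begin

lemma K_borel: "K \<in> sets borel"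
  using K by (simp add: borel_compact)

sublocale bounded_prob \<mu> r
  using prob_on_bounded_prob(1)[OF mu K_borel K(2)] .

lemma AE_K: "AE w in \<mu>. w \<in> K"
  using prob_on_bounded_prob(2)[OF mu K_borel K(2)] .

lemma finite_measure_mu: "finite_measure \<mu>"
  using finite_measure_axioms .

lemma r_nonneg: "0 \<le> r"
proof -
  have "K \<noteq> {}" using mu by (auto simp: prob_on_def)
  then obtain x where "x \<in> K" by auto
  then have "cmod x \<le> r" using K(2) by auto
  then show ?thesis using norm_ge_zero[of x] by linarith
qed

lemma sets_borel: "A \<in> sets borel \<Longrightarrow> A \<in> sets \<mu>"
  by (simp add: sets_nu)

lemma space_mu [simp]: "space \<mu> = UNIV"
  using sets_eq_imp_space_eq[OF sets_nu] by simp

lemma prob_UNIV [simp]: "prob UNIV = 1"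
  using prob_space by simp

lemma emeasure_UNIV [simp]: "emeasure \<mu> UNIV = 1"
  using emeasure_space_1 by simp

definition L :: real where "L = ln (max 1 (2 * r))"

lemma L_nonneg: "0 \<le> L" by (simp add: L_def)

lemma trunc_ln_le_L:
  assumes "0 < \<delta>" "\<delta> \<le> 1" "cmod z \<le> r" "cmod w \<le> r"
  shows "trunc_ln \<delta> (z - w) \<le> L"
proof -
  have "cmod (z - w) \<le> 2 * r" using norm_triangle_ineq4[of z w] assms by linarith
  then have "trunc_ln 1 (z - w) \<le> L" unfolding L_def by (intro trunc_ln_le) auto
  then show ?thesis using trunc_ln_mono[OF assms(1,2), of "z - w"] by linarith
qed

text \<open>Moving a little mass from the set where the potential is too small to its complement
  would increase the energy integral to first order.\<close>
lemma trunc_pot_ge_AE_aux: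
  assumes \<delta>0: "0 < \<delta>0" and \<eta>: "0 < \<eta>"
  shows "measure \<mu> {z. trunc_pot \<mu> \<delta>0 z < I - \<eta>} = 0"
proof (rule ccontr)
  define A where "A = {z. trunc_pot \<mu> \<delta>0 z < I - \<eta>}"
  define B where "B = - A"
  define a where "a = measure \<mu> A"
  define b where "b = measure \<mu> B"
  assume "measure \<mu> {z. trunc_pot \<mu> \<delta>0 z < I - \<eta>} \<noteq> 0"
  then have a: "a > 0" unfolding a_def A_def using zero_less_measure_iff by blast
  have oA: "open A" unfolding A_def
    using open_Collect_less[OF continuous_trunc_pot[OF \<delta>0] continuous_on_const] by blast
  then have Ab [measurable]: "A \<in> sets borel" by simp
  have Bb [measurable]: "B \<in> sets borel" unfolding B_def using oA by auto
  have [measurable]: "B \<in> sets \<mu>" "A \<in> sets \<mu>" using Ab Bb by (auto simp: sets_borel)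
  have bB: "b = 1 - a" unfolding b_def B_def a_def
    using prob_compl[of A] Ab by (simp add: sets_borel Compl_eq_Diff_UNIV)
  define q where "q \<delta> z = (\<integral>w. indicator B w * trunc_ln \<delta> (z - w) \<partial>\<mu>)" for \<delta> z
  have ikB: "integrable \<mu> (\<lambda>w. indicator B w * trunc_ln \<delta> (z - w))" if "0 < \<delta>" for \<delta> z
    using integrable_real_mult_indicator[OF _ trunc_ln_integrable[OF that], of B] Bb by (simp add: sets_borel mult.commute)
  have ipB: "integrable \<mu> (\<lambda>w. indicator B w * trunc_pot \<mu> \<delta> w)" if "0 < \<delta>" for \<delta>
    using integrable_real_mult_indicator[OF _ trunc_pot_integrable[OF that], of B] Bb by (simp add: sets_borel mult.commute)
  have ipA: "integrable \<mu> (\<lambda>w. indicator A w * trunc_pot \<mu> \<delta> w)" if "0 < \<delta>" for \<delta>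
    using integrable_real_mult_indicator[OF _ trunc_pot_integrable[OF that], of A] Ab by (simp add: sets_borel mult.commute)
  \<comment> \<open>On A the potential falls short of I by more than \<eta>, at the level \<delta>0
    and hence at every smaller one. The total energy is at least I, so B must make up for the
    deficit with a surplus of at least \<eta> a.\<close>
  have Bpot: "I * b + \<eta> * a \<le> (\<integral>w. indicator B w * trunc_pot \<mu> \<delta> w \<partial>\<mu>)" if d: "0 < \<delta>" "\<delta> \<le> \<delta>0" for \<delta>
  proof -
    have "trunc_energy \<mu> \<delta> = (\<integral>w. indicator A w * trunc_pot \<mu> \<delta> w + indicator B w * trunc_pot \<mu> \<delta> w \<partial>\<mu>)"
      unfolding trunc_energy_def B_def by (intro Bochner_Integration.integral_cong) (auto simp: indicator_def)
    also have "\<dots> = (\<integral>w. indicator A w * trunc_pot \<mu> \<delta> w \<partial>\<mu>) + (\<integral>w. indicator B w * trunc_pot \<mu> \<delta> w \<partial>\<mu>)"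
      by (intro Bochner_Integration.integral_add ipA ipB d)
    finally have 1: "trunc_energy \<mu> \<delta> = (\<integral>w. indicator A w * trunc_pot \<mu> \<delta> w \<partial>\<mu>) + (\<integral>w. indicator B w * trunc_pot \<mu> \<delta> w \<partial>\<mu>)" .
    have "(\<integral>w. indicator A w * trunc_pot \<mu> \<delta> w \<partial>\<mu>) \<le> (\<integral>w. indicator A w * (I - \<eta>) \<partial>\<mu>)"
    proof (intro integral_mono ipA d(1))
      show "integrable \<mu> (\<lambda>w. indicator A w * (I - \<eta>))"
        by (intro integrable_mult_left integrable_real_indicator) (auto simp: Ab sets_borel emeasure_finite less_top[symmetric])
      show "indicator A w * trunc_pot \<mu> \<delta> w \<le> indicator A w * (I - \<eta>)" for w
        using trunc_pot_mono[OF d, of w] by (auto simp: indicator_def A_def)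
    qed
    also have "\<dots> = a * (I - \<eta>)" unfolding a_def using Ab by (simp add: sets_borel)
    finally have "I - a * (I - \<eta>) \<le> (\<integral>w. indicator B w * trunc_pot \<mu> \<delta> w \<partial>\<mu>)"
      using 1 trunc_energy_ge[OF d(1)] by linarith
    then show ?thesis unfolding bB by (simp add: algebra_simps)
  qed
  have b: "b > 0"
  proof (rule ccontr)
    assume "\<not> b > 0"
    then have b0: "b = 0" unfolding b_def using measure_nonneg[of \<mu> B] by linarith
    then have "AE w in \<mu>. w \<notin> B" unfolding b_def
      using Bb by (intro AE_not_in) (simp add: null_sets_def emeasure_eq_measure sets_borel)
    then have "(\<integral>w. indicator B w * trunc_pot \<mu> \<delta>0 w \<partial>\<mu>) = (\<integral>w. 0 \<partial>\<mu>)"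
      using ipB[OF \<delta>0] by (intro integral_cong_AE) (auto elim!: eventually_mono intro: borel_measurable_integrable)
    then have "I * b + \<eta> * a \<le> 0" using Bpot[OF \<delta>0 order_refl] by simp
    then show False using b0 a \<eta> by (simp add: mult_le_0_iff)
  qed
  have fub: "(\<integral>z. q \<delta> z \<partial>\<mu>) = (\<integral>w. indicator B w * trunc_pot \<mu> \<delta> w \<partial>\<mu>)" and qi: "integrable \<mu> (q \<delta>)"
    and qq: "(\<integral>z. indicator B z * q \<delta> z \<partial>\<mu>) \<ge> I - L" and qqi: "integrable \<mu> (\<lambda>z. indicator B z * q \<delta> z)"
    if d: "0 < \<delta>" "\<delta> \<le> 1" for \<delta>
  proof -
    interpret P: pair_sigma_finite \<mu> \<mu> ..
    interpret Q: prob_space "\<mu> \<Otimes>\<^sub>M \<mu>" by (intro prob_space_pair prob_space_axioms)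
    have m: "(\<lambda>(z, w). trunc_ln \<delta> (z - w)) \<in> borel_measurable (\<mu> \<Otimes>\<^sub>M \<mu>)" by measurable
    have AE2: "AE y in \<mu> \<Otimes>\<^sub>M \<mu>. cmod (fst y) \<le> r \<and> cmod (snd y) \<le> r"
    proof (rule P.AE_pair_measure)
      show "{y \<in> space (\<mu> \<Otimes>\<^sub>M \<mu>). cmod (fst y) \<le> r \<and> cmod (snd y) \<le> r} \<in> sets (\<mu> \<Otimes>\<^sub>M \<mu>)" by measurable
      show "AE x in \<mu>. AE y in \<mu>. cmod (fst (x, y)) \<le> r \<and> cmod (snd (x, y)) \<le> r"
        using AE_bounded
      proof eventually_elim
        case (elim x)
        then show ?case using AE_bounded by simp
      qed
    qed
    have int2: "integrable (\<mu> \<Otimes>\<^sub>M \<mu>) (\<lambda>(z, w). trunc_ln \<delta> (z - w))"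
    proof (rule Q.integrable_const_bound[OF _ m, of "\<bar>ln \<delta>\<bar> + \<bar>ln (max \<delta> (r + r))\<bar>"])
      show "AE y in \<mu> \<Otimes>\<^sub>M \<mu>. norm (case y of (z, w) \<Rightarrow> trunc_ln \<delta> (z - w)) \<le> \<bar>ln \<delta>\<bar> + \<bar>ln (max \<delta> (r + r))\<bar>"
        using AE2
      proof eventually_elim
        case (elim y)
        then have "cmod (fst y - snd y) \<le> r + r" using norm_triangle_ineq4[of "fst y" "snd y"] by linarith
        from trunc_ln_abs[OF d(1) this] show ?case by (cases y) auto
      qed
    qed
    have mB: "(\<lambda>(z, w). indicator B w :: real) \<in> borel_measurable (\<mu> \<Otimes>\<^sub>M \<mu>)"
      "(\<lambda>(z, w). indicator B z :: real) \<in> borel_measurable (\<mu> \<Otimes>\<^sub>M \<mu>)" by measurable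
    have int3: "integrable (\<mu> \<Otimes>\<^sub>M \<mu>) (\<lambda>(z, w). indicator B w * trunc_ln \<delta> (z - w))"
      by (rule Bochner_Integration.integrable_bound[OF int2]) (use m mB in \<open>auto simp: indicator_def case_prod_unfold\<close>)
    have int4: "integrable (\<mu> \<Otimes>\<^sub>M \<mu>) (\<lambda>(z, w). indicator B z * (indicator B w * trunc_ln \<delta> (z - w)))"
      by (rule Bochner_Integration.integrable_bound[OF int2]) (use m mB in \<open>auto simp: indicator_def case_prod_unfold\<close>)
    have "(\<integral>z. (\<integral>w. indicator B w * trunc_ln \<delta> (z - w) \<partial>\<mu>) \<partial>\<mu>) = (\<integral>w. (\<integral>z. indicator B w * trunc_ln \<delta> (z - w) \<partial>\<mu>) \<partial>\<mu>)"
      using P.Fubini_integral[OF int3] by simp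
    also have "\<dots> = (\<integral>w. indicator B w * trunc_pot \<mu> \<delta> w \<partial>\<mu>)"
      by (simp add: trunc_pot_def trunc_ln_minus_commute[of _ _ "_ :: complex"] integral_mult_right_zero)
    finally show "(\<integral>z. q \<delta> z \<partial>\<mu>) = (\<integral>w. indicator B w * trunc_pot \<mu> \<delta> w \<partial>\<mu>)" by (simp add: q_def)
    show "integrable \<mu> (q \<delta>)" using P.integrable_fst[OF int3] by (simp add: q_def[abs_def])

    show qqi: "integrable \<mu> (\<lambda>z. indicator B z * q \<delta> z)" using P.integrable_fst[OF int4] by (simp add: q_def)
    \<comment> \<open>Almost everywhere the kernel is at most L, and L \<ge> 0. Hence kernel minus L
      lies below the kernel cut down to B, first in w and then, as the potential is at most L too,
      in z; L is paid only once.\<close>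
    have "I - L \<le> trunc_energy \<mu> \<delta> - L" using trunc_energy_ge[OF d(1)] by simp
    also have "\<dots> = (\<integral>z. trunc_pot \<mu> \<delta> z - L \<partial>\<mu>)"
      unfolding trunc_energy_def by (simp add: Bochner_Integration.integral_diff trunc_pot_integrable d prob_space)
    also have "\<dots> \<le> (\<integral>z. indicator B z * q \<delta> z \<partial>\<mu>)"
    proof (intro integral_mono_AE Bochner_Integration.integrable_diff trunc_pot_integrable d(1) integrable_const qqi)
      show "AE z in \<mu>. trunc_pot \<mu> \<delta> z - L \<le> indicator B z * q \<delta> z"
        using AE_bounded
      proof eventually_elim
        case (elim z)
        have "trunc_pot \<mu> \<delta> z - L = (\<integral>w. trunc_ln \<delta> (z - w) - L \<partial>\<mu>)"
          unfolding trunc_pot_def by (simp add: Bochner_Integration.integral_diff trunc_ln_integrable d prob_space)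
        also have "\<dots> \<le> (\<integral>w. indicator B w * trunc_ln \<delta> (z - w) \<partial>\<mu>)"
        proof (intro integral_mono_AE Bochner_Integration.integrable_diff trunc_ln_integrable d(1) integrable_const ikB)
          show "AE w in \<mu>. trunc_ln \<delta> (z - w) - L \<le> indicator B w * trunc_ln \<delta> (z - w)"
            using AE_bounded
          proof eventually_elim
            case (elim w)
            then show ?case using trunc_ln_le_L[OF d, of z w] \<open>cmod z \<le> r\<close> L_nonneg by (auto simp: indicator_def)
          qed
        qed
        also have "\<dots> = q \<delta> z" by (simp add: q_def)
        finally have 1: "trunc_pot \<mu> \<delta> z - L \<le> q \<delta> z" .
        have "trunc_pot \<mu> \<delta> z - L \<le> 0"
          using trunc_pot_le_2r[of 1 z] trunc_pot_mono[of \<delta> 1 z] d elim by (simp add: L_def)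
        then show ?case using 1 by (auto simp: indicator_def)
      qed
    qed
    finally show "(\<integral>z. indicator B z * q \<delta> z \<partial>\<mu>) \<ge> I - L" .
  qed
  \<comment> \<open>The competitor is (1 - t) \<mu> plus t / b times the restriction of \<mu> to B.
    Its energy is at least I + t (2 (1 - t) \<kappa> - t C): \<kappa> is the first-order gain, C
    collects the second-order terms, and t is chosen so small that t |C| < \<kappa> while 2 (1 - t)
    \<ge> 1.\<close>
  define \<kappa> where "\<kappa> = \<eta> * a / b"
  define C where "C = I - (I - L) / b\<^sup>2"
  have \<kappa>: "\<kappa> > 0" using a b \<eta> by (simp add: \<kappa>_def)
  define t where "t = min (1/2) (\<kappa> / (2 * (\<bar>C\<bar> + 1)))"
  have t: "0 < t" "t \<le> 1/2" "t * \<bar>C\<bar> < \<kappa>"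
  proof -
    show "0 < t" using \<kappa> by (auto simp: t_def)
    show "t \<le> 1/2" unfolding t_def by (rule min.cobounded1)
    have "t * \<bar>C\<bar> \<le> \<kappa> / (2 * (\<bar>C\<bar> + 1)) * \<bar>C\<bar>" by (intro mult_right_mono) (auto simp: t_def)
    also have "\<dots> = \<kappa> * (\<bar>C\<bar> / (2 * (\<bar>C\<bar> + 1)))" by simp
    also have "\<dots> < \<kappa> * 1" using \<kappa> by (intro mult_strict_left_mono) (auto simp: field_simps)
    finally show "t * \<bar>C\<bar> < \<kappa>" by simp
  qed
  define h where "h z = (1 - t) + t / b * indicator B z" for z
  have hnn: "h z \<ge> 0" for z using t b by (auto simp: h_def indicator_def)
  have hm [measurable]: "h \<in> borel_measurable borel" unfolding h_def[abs_def]
    by (intro borel_measurable_add borel_measurable_const borel_measurable_times borel_measurable_indicator Bb)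
  have hm' [measurable]: "h \<in> borel_measurable \<mu>" by (rule borel_measurable_nu[OF hm])
  define \<nu> where "\<nu> = density \<mu> (\<lambda>z. ennreal (h z))"
  have iB: "integrable \<mu> (indicator B :: _ \<Rightarrow> real)"
    by (intro integrable_real_indicator) (auto simp: Bb sets_borel emeasure_finite less_top[symmetric])
  have ih: "integrable \<mu> h" unfolding h_def[abs_def] by (intro Bochner_Integration.integrable_add integrable_const integrable_mult_right iB)
  have "(\<integral>z. h z \<partial>\<mu>) = (1 - t) + t / b * b"
    unfolding h_def using iB Bb by (subst Bochner_Integration.integral_add) (simp_all add: b_def prob_space sets_borel)
  also have "\<dots> = 1" using b by simp
  finally have h1: "(\<integral>z. h z \<partial>\<mu>) = 1" .
  have "(\<integral>\<^sup>+z. ennreal (h z) \<partial>\<mu>) = 1" using nn_integral_eq_integral[OF ih] hnn h1 by simp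
  then have pn: "prob_space \<nu>" unfolding \<nu>_def by (intro prob_spaceI) (simp add: emeasure_density sets_nu)
  have AEn: "AE w in \<nu>. w \<in> K" unfolding \<nu>_def using AE_K by (subst AE_density) (auto elim: eventually_mono)
  have pon: "prob_on K \<nu>" unfolding prob_on_def
  proof (intro conjI pn)
    show sn: "sets \<nu> = sets borel" by (simp add: \<nu>_def sets_nu)
    interpret n: prob_space \<nu> by (rule pn)
    have "K \<in> n.events" using sn K_borel by simp
    from n.prob_eq_1[OF this] AEn show "emeasure \<nu> K = 1" by (simp add: n.emeasure_eq_measure)
  qed
  have trunc_energy\<nu>: "I + t * (\<kappa> - t * \<bar>C\<bar>) \<le> trunc_energy \<nu> \<delta>" if d: "0 < \<delta>" "\<delta> \<le> 1" "\<delta> \<le> \<delta>0" for \<delta>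
  proof -
    have tp: "trunc_pot \<nu> \<delta> z = (1 - t) * trunc_pot \<mu> \<delta> z + t / b * q \<delta> z" for z
    proof -
      have "trunc_pot \<nu> \<delta> z = (\<integral>w. h w *\<^sub>R trunc_ln \<delta> (z - w) \<partial>\<mu>)"
        unfolding trunc_pot_def \<nu>_def by (rule integral_density) (auto simp: hnn intro!: borel_measurable_nu)
      also have "\<dots> = (\<integral>w. (1 - t) * trunc_ln \<delta> (z - w) + t / b * (indicator B w * trunc_ln \<delta> (z - w)) \<partial>\<mu>)"
        by (intro Bochner_Integration.integral_cong) (auto simp: h_def algebra_simps)
      also have "\<dots> = (1 - t) * trunc_pot \<mu> \<delta> z + t / b * q \<delta> z"
        unfolding trunc_pot_def q_def using trunc_ln_integrable[OF d(1)] ikB[OF d(1)]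
        by (subst Bochner_Integration.integral_add) auto
      finally show ?thesis .
    qed
    have tm: "trunc_pot \<mu> \<delta> \<in> borel_measurable \<mu>" "q \<delta> \<in> borel_measurable \<mu>"
      using d qi[OF d(1,2)] by (auto intro: borel_measurable_integrable)
    have "trunc_energy \<nu> \<delta> = (\<integral>z. h z *\<^sub>R ((1 - t) * trunc_pot \<mu> \<delta> z + t / b * q \<delta> z) \<partial>\<mu>)"
      unfolding trunc_energy_def tp unfolding \<nu>_def by (rule integral_density) (use tm in \<open>auto simp: hnn\<close>)
    also have "\<dots> = (\<integral>z. (1 - t)\<^sup>2 * trunc_pot \<mu> \<delta> z + (1 - t) * (t / b) * (indicator B z * trunc_pot \<mu> \<delta> z)
         + (1 - t) * (t / b) * q \<delta> z + (t / b)\<^sup>2 * (indicator B z * q \<delta> z) \<partial>\<mu>)"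
    proof (rule Bochner_Integration.integral_cong[OF refl])
      have "((1 - t) + c * i) * ((1 - t) * p + c * q) =
          (1 - t)\<^sup>2 * p + (1 - t) * c * (i * p) + (1 - t) * c * q + c\<^sup>2 * (i * q)" for c i p q :: real
        by (simp add: algebra_simps power2_eq_square)
      from this[of "t / b"] show "h z *\<^sub>R ((1 - t) * trunc_pot \<mu> \<delta> z + t / b * q \<delta> z) =
          (1 - t)\<^sup>2 * trunc_pot \<mu> \<delta> z + (1 - t) * (t / b) * (indicator B z * trunc_pot \<mu> \<delta> z)
         + (1 - t) * (t / b) * q \<delta> z + (t / b)\<^sup>2 * (indicator B z * q \<delta> z)" for z
        unfolding h_def real_scaleR_def .
    qed
    also have "\<dots> = (1 - t)\<^sup>2 * trunc_energy \<mu> \<delta> + (1 - t) * (t / b) * (\<integral>z. indicator B z * trunc_pot \<mu> \<delta> z \<partial>\<mu>)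
         + (1 - t) * (t / b) * (\<integral>z. q \<delta> z \<partial>\<mu>) + (t / b)\<^sup>2 * (\<integral>z. indicator B z * q \<delta> z \<partial>\<mu>)"
      unfolding trunc_energy_def using trunc_pot_integrable[OF d(1)] ipB[OF d(1)] qi[OF d(1,2)] qqi[OF d(1,2)]
      by (simp add: Bochner_Integration.integral_add)
    also have "\<dots> \<ge> (1 - t)\<^sup>2 * I + (1 - t) * (t / b) * (I * b + \<eta> * a)
         + (1 - t) * (t / b) * (I * b + \<eta> * a) + (t / b)\<^sup>2 * (I - L)"
      unfolding fub[OF d(1,2)] using t b
      by (intro add_mono mult_left_mono trunc_energy_ge d Bpot qq) auto
    finally have 1: "(1 - t)\<^sup>2 * I + 2 * ((1 - t) * (t / b) * (I * b + \<eta> * a)) + (t / b)\<^sup>2 * (I - L) \<le> trunc_energy \<nu> \<delta>"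
      by (simp add: algebra_simps)
    have "(1 - t)\<^sup>2 * I + 2 * ((1 - t) * (t / b) * (I * b + \<eta> * a)) + (t / b)\<^sup>2 * (I - L)
        = I + t * (2 * (1 - t) * \<kappa> - t * C)"
      using b by (simp add: \<kappa>_def C_def field_simps power2_eq_square)
    moreover have "t * (2 * (1 - t) * \<kappa> - t * C) \<ge> t * (\<kappa> - t * \<bar>C\<bar>)"
    proof (intro mult_left_mono diff_mono)
      have "1 * \<kappa> \<le> (2 * (1 - t)) * \<kappa>" using t \<kappa> by (intro mult_right_mono) auto
      then show "\<kappa> \<le> 2 * (1 - t) * \<kappa>" by simp
    qed (use t in auto)
    ultimately show ?thesis using 1 by linarith
  qed
  have "I + t * (\<kappa> - t * \<bar>C\<bar>) \<le> I"
  proof (rule maximal[OF pon])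
    fix \<delta> :: real assume d: "0 < \<delta>"
    interpret n: bounded_prob \<nu> r by (rule prob_on_bounded_prob(1)[OF pon K_borel K(2)])
    let ?e = "min \<delta> (min 1 \<delta>0)"
    have "I + t * (\<kappa> - t * \<bar>C\<bar>) \<le> trunc_energy \<nu> ?e" using d \<delta>0 by (intro trunc_energy\<nu>) auto
    also have "\<dots> \<le> trunc_energy \<nu> \<delta>" using d \<delta>0 by (intro n.trunc_energy_mono) auto
    finally show "I + t * (\<kappa> - t * \<bar>C\<bar>) \<le> trunc_energy \<nu> \<delta>" .
  qed
  then show False using t by (simp add: mult_le_0_iff)
qed


lemma trunc_pot_ge_AE: "AE z in \<mu>. \<forall>\<delta>>0. I \<le> trunc_pot \<mu> \<delta> z"
proof -
  have "AE z in \<mu>. \<not> trunc_pot \<mu> (1 / real (Suc n)) z < I - 1 / real (Suc m)" for n m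
  proof (rule AE_I')
    have c: "continuous_on UNIV (trunc_pot \<mu> (1 / real (Suc n)))" by (rule continuous_trunc_pot) simp
    have "open {z. trunc_pot \<mu> (1 / real (Suc n)) z < I - 1 / real (Suc m)}"
      using open_Collect_less[OF c continuous_on_const] by blast
    then have "{z. trunc_pot \<mu> (1 / real (Suc n)) z < I - 1 / real (Suc m)} \<in> sets \<mu>"
      by (intro sets_borel) simp
    then show "{z. trunc_pot \<mu> (1 / real (Suc n)) z < I - 1 / real (Suc m)} \<in> null_sets \<mu>"
      using trunc_pot_ge_AE_aux[of "1 / real (Suc n)" "1 / real (Suc m)"]
      by (simp add: null_sets_def emeasure_eq_measure)
  qed auto
  then have "AE z in \<mu>. \<forall>n m. \<not> trunc_pot \<mu> (1 / real (Suc n)) z < I - 1 / real (Suc m)"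
    by (simp add: AE_all_countable)
  then show ?thesis
  proof eventually_elim
    case (elim z)
    have 1: "I \<le> trunc_pot \<mu> (1 / real (Suc n)) z" for n
    proof (rule ccontr)
      assume "\<not> I \<le> trunc_pot \<mu> (1 / real (Suc n)) z"
      then have "0 < I - trunc_pot \<mu> (1 / real (Suc n)) z" by simp
      then obtain m where "inverse (real (Suc m)) < I - trunc_pot \<mu> (1 / real (Suc n)) z"
        using reals_Archimedean by blast
      then show False using elim[rule_format, of n m] by (simp add: inverse_eq_divide)
    qed
    show ?case
    proof safe
      fix \<delta> :: real assume d: "0 < \<delta>"
      then obtain n where n: "inverse (real (Suc n)) < \<delta>" using reals_Archimedean by blast
      have "trunc_pot \<mu> (1 / real (Suc n)) z \<le> trunc_pot \<mu> \<delta> z"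
        using n by (intro trunc_pot_mono) (auto simp: inverse_eq_divide)
      then show "I \<le> trunc_pot \<mu> \<delta> z" using 1[of n] by linarith
    qed
  qed
qed

text \<open>A compact set of full measure on which the desired inequality is already known. The
  bound is carried from it to the rest of the plane by a maximum principle.\<close>

definition frostman_set :: "complex set" where
  "frostman_set = {z \<in> K. \<forall>\<delta>>0. I \<le> trunc_pot \<mu> \<delta> z}"

lemma frostman_set_subset: "frostman_set \<subseteq> K" by (auto simp: frostman_set_def)

lemma AE_frostman_set: "AE z in \<mu>. z \<in> frostman_set"
  using AE_K trunc_pot_ge_AE by eventually_elim (auto simp: frostman_set_def)

lemma closed_trunc_pot_ge: "0 < \<delta> \<Longrightarrow> closed {z. c \<le> trunc_pot \<mu> \<delta> z}"
  using closed_Collect_le[OF continuous_on_const continuous_trunc_pot] by blast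

lemma compact_frostman_set: "compact frostman_set"
proof -
  have "frostman_set = K \<inter> (\<Inter>\<delta>\<in>{0<..}. {z. I \<le> trunc_pot \<mu> \<delta> z})" by (auto simp: frostman_set_def)
  moreover have "closed (\<Inter>\<delta>\<in>{0<..}. {z. I \<le> trunc_pot \<mu> \<delta> z})"
    by (intro closed_INT ballI closed_trunc_pot_ge) auto
  ultimately show ?thesis using K(1) by (simp add: compact_Int_closed)
qed

text \<open>Compare with the potential at the point of \<open>A\<close> nearest to \<open>z\<close>: since distances to points
  of \<open>A\<close> grow at most by a factor 2, the truncation error at \<open>z\<close> is controlled by the one there.\<close>
lemma logpot_near:
  assumes A: "compact A" "A \<noteq> {}" "A \<subseteq> frostman_set" and d: "0 < d" "d \<le> 1" and "0 \<le> \<eta>"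
    and unif: "\<And>y s. y \<in> A \<Longrightarrow> 0 < s \<Longrightarrow> s \<le> d \<Longrightarrow> trunc_pot \<mu> d y - trunc_pot \<mu> s y \<le> \<eta>"
    and \<epsilon>: "1 - \<epsilon> \<le> measure \<mu> A" and z: "z \<notin> A"
  shows "I - \<eta> - \<epsilon> * L - 2 / d * infdist z A \<le> logpot \<mu> A z"
proof -
  have cA: "closed A" using A by (simp add: compact_imp_closed)
  have Ab [measurable]: "A \<in> sets borel" using cA by simp
  obtain y where y: "y \<in> A" "infdist z A = dist z y" using infdist_attains_inf[OF cA A(2)] by metis
  define s where "s = dist z y"
  have s: "0 < s" using y z by (auto simp: s_def)
  have sd: "s \<le> cmod (z - w)" if "w \<in> A" for w
    using infdist_le[OF that, of z] y by (simp add: s_def dist_norm)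
  \<comment> \<open>Being at most d makes \<open>unif\<close> applicable; being at most s keeps the
    truncation at \<sigma> below |z - w| for all w in A.\<close>
  define \<sigma> where "\<sigma> = min s d"
  have \<sigma>: "0 < \<sigma>" "\<sigma> \<le> s" "\<sigma> \<le> d" using s d by (auto simp: \<sigma>_def)
  have "y \<in> frostman_set" "y \<in> cball 0 r" using y(1) A(3) frostman_set_subset K(2) by blast+
  then have yK: "y \<in> frostman_set" "cmod y \<le> r" by auto
  \<comment> \<open>For |z - w| \<ge> d / 2 the truncation at d / 2 is inactive. Otherwise |y - w|
    \<le> 2 |z - w| < d, and the difference of the truncations at d and \<sigma> is at least ln d -
    ln (2 |z - w|), so that the factor 2 cancels against the level d / 2.\<close>
  have pw: "trunc_ln (d / 2) (z - w) - (trunc_ln d (y - w) - trunc_ln \<sigma> (y - w)) \<le> ln (cmod (z - w))" if w: "w \<in> A" for w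
  proof -
    have zw: "s \<le> cmod (z - w)" using sd[OF w] .
    have "cmod (y - w) \<le> cmod (y - z) + cmod (z - w)" using norm_triangle_ineq[of "y - z" "z - w"] by simp
    then have yw: "cmod (y - w) \<le> 2 * cmod (z - w)" using zw by (simp add: s_def dist_norm norm_minus_commute)
    have p: "0 < cmod (z - w)" using zw s by linarith
    show ?thesis
    proof (cases "d / 2 \<le> cmod (z - w)")
      case True
      then have "trunc_ln (d / 2) (z - w) = ln (cmod (z - w))" by (rule trunc_ln_eq)
      then show ?thesis using trunc_ln_mono[OF \<sigma>(1,3), of "y - w"] by simp
    next
      case False
      then have "trunc_ln (d / 2) (z - w) = ln (d / 2)" by (simp add: trunc_ln_def max_def)
      moreover have "trunc_ln d (y - w) = ln d" using False yw by (simp add: trunc_ln_def max_def)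
      moreover have "trunc_ln \<sigma> (y - w) \<le> ln (2 * cmod (z - w))"
        unfolding trunc_ln_def using \<sigma> zw yw p by (intro ln_mono) auto
      ultimately show ?thesis using p d by (simp add: ln_mult ln_div)
    qed
  qed
  have iA: "integrable \<mu> (\<lambda>w. indicator A w * trunc_ln e (x - w))" if "0 < e" for e x
    using integrable_real_mult_indicator[OF _ trunc_ln_integrable[OF that], of A] Ab by (simp add: sets_borel mult.commute)
  have iC: "integrable \<mu> (\<lambda>w. indicator (- A) w * trunc_ln e (x - w))" if "0 < e" for e x
    using integrable_real_mult_indicator[OF _ trunc_ln_integrable[OF that], of "- A"] Ab by (simp add: sets_borel mult.commute)
  have iI: "integrable \<mu> (\<lambda>w. indicator (- A) w * c)" for c :: real
    using Ab by (intro integrable_mult_left integrable_real_indicator) (auto simp: sets_borel emeasure_finite less_top[symmetric])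
  have "(\<integral>w. indicator A w * trunc_ln d (y - w) - indicator A w * trunc_ln \<sigma> (y - w) \<partial>\<mu>) \<le> (\<integral>w. trunc_ln d (y - w) - trunc_ln \<sigma> (y - w) \<partial>\<mu>)"
    using trunc_ln_mono[OF \<sigma>(1,3)] d \<sigma>
    by (intro integral_mono Bochner_Integration.integrable_diff iA trunc_ln_integrable) (auto simp: indicator_def)
  also have "\<dots> = trunc_pot \<mu> d y - trunc_pot \<mu> \<sigma> y"
    unfolding trunc_pot_def using d \<sigma> by (intro Bochner_Integration.integral_diff trunc_ln_integrable)
  also have "\<dots> \<le> \<eta>" using unif[OF y(1) \<sigma>(1,3)] .
  finally have 1: "(\<integral>w. indicator A w * trunc_ln d (y - w) - indicator A w * trunc_ln \<sigma> (y - w) \<partial>\<mu>) \<le> \<eta>" .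
  have "I \<le> trunc_pot \<mu> (d/2) y" using yK d by (auto simp: frostman_set_def)
  also have "\<dots> = (\<integral>w. indicator A w * trunc_ln (d/2) (y - w) + indicator (- A) w * trunc_ln (d/2) (y - w) \<partial>\<mu>)"
    unfolding trunc_pot_def by (intro Bochner_Integration.integral_cong) (auto simp: indicator_def)
  also have "\<dots> = (\<integral>w. indicator A w * trunc_ln (d/2) (y - w) \<partial>\<mu>) + (\<integral>w. indicator (- A) w * trunc_ln (d/2) (y - w) \<partial>\<mu>)"
    using d by (intro Bochner_Integration.integral_add iA iC) auto
  also have "(\<integral>w. indicator (- A) w * trunc_ln (d/2) (y - w) \<partial>\<mu>) \<le> (\<integral>w. indicator (- A) w * L \<partial>\<mu>)"
  proof (intro integral_mono_AE iC iI)
    show "AE w in \<mu>. indicator (- A) w * trunc_ln (d/2) (y - w) \<le> indicator (- A) w * L"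
      using AE_bounded
    proof eventually_elim
      case (elim w)
      then have "trunc_ln (d/2) (y - w) \<le> L" using d yK by (intro trunc_ln_le_L) auto
      then show ?case by (auto simp: indicator_def)
    qed
  qed (use d in auto)
  also have "(\<integral>w. indicator (- A) w * L \<partial>\<mu>) = (1 - measure \<mu> A) * L"
    using Ab prob_compl[of A] by (simp add: sets_borel Compl_eq_Diff_UNIV)
  also have "\<dots> \<le> \<epsilon> * L" using \<epsilon> L_nonneg by (intro mult_right_mono) auto
  finally have 2: "I - \<epsilon> * L \<le> (\<integral>w. indicator A w * trunc_ln (d/2) (y - w) \<partial>\<mu>)" by simp
  have "(\<integral>w. indicator A w * trunc_ln (d/2) (y - w) \<partial>\<mu>) - 2 / d * s
      = (\<integral>w. indicator A w * trunc_ln (d/2) (y - w) - 2 / d * s \<partial>\<mu>)"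
    using d by (simp add: Bochner_Integration.integral_diff iA)
  also have "\<dots> \<le> (\<integral>w. indicator A w * trunc_ln (d/2) (z - w) \<partial>\<mu>)"
  proof (intro integral_mono Bochner_Integration.integrable_diff iA integrable_const)
    fix w
    have "\<bar>trunc_ln (d/2) (y - w) - trunc_ln (d/2) (z - w)\<bar> \<le> dist (y - w) (z - w) / (d/2)"
      using d by (intro trunc_ln_lipschitz) auto
    also have "\<dots> = 2 / d * s" by (simp add: s_def dist_norm norm_minus_commute)
    finally show "indicator A w * trunc_ln (d/2) (y - w) - 2 / d * s \<le> indicator A w * trunc_ln (d/2) (z - w)"
      using s d by (auto simp: indicator_def)
  qed (use d in auto)
  finally have 3: "I - \<epsilon> * L - 2 / d * s \<le> (\<integral>w. indicator A w * trunc_ln (d/2) (z - w) \<partial>\<mu>)" using 2 by linarith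
  have "(\<integral>w. indicator A w * trunc_ln (d/2) (z - w) \<partial>\<mu>) - \<eta> \<le>
      (\<integral>w. indicator A w * trunc_ln (d/2) (z - w) \<partial>\<mu>) - (\<integral>w. indicator A w * trunc_ln d (y - w) - indicator A w * trunc_ln \<sigma> (y - w) \<partial>\<mu>)"
    using 1 by simp
  also have "\<dots> = (\<integral>w. indicator A w * trunc_ln (d/2) (z - w) - (indicator A w * trunc_ln d (y - w) - indicator A w * trunc_ln \<sigma> (y - w)) \<partial>\<mu>)"
    using d \<sigma> by (intro Bochner_Integration.integral_diff[symmetric] Bochner_Integration.integrable_diff iA) auto
  also have "\<dots> \<le> logpot \<mu> A z" unfolding logpot_def
    using d \<sigma> pw
    by (intro integral_mono Bochner_Integration.integrable_diff iA logpot_integrable finite_measure_mu sets_nu A z)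
       (auto simp: indicator_def)
  finally show ?thesis using 3 y by (simp add: s_def)
qed

text \<open>The potential is harmonic off A. The minimum principle on the points of a large disc at
  distance at least s from A gives the bound B - c s, and s is sent to 0.\<close>

lemma logpot_lower_of_near:
  assumes A: "compact A" "A \<noteq> {}" "A \<subseteq> K" and m: "1 / 2 \<le> measure \<mu> A" and c: "0 \<le> c"
    and near: "\<And>x. x \<notin> A \<Longrightarrow> B - c * infdist x A \<le> logpot \<mu> A x" and z: "z \<notin> A"
  shows "B \<le> logpot \<mu> A z"
proof -
  have cA: "closed A" using A by (simp add: compact_imp_closed)
  have z0: "0 < infdist z A" using z A cA by (simp add: infdist_pos_not_in_closed)
  have main: "B - c * s \<le> logpot \<mu> A z" if s: "0 < s" "s \<le> infdist z A" for s
  proof -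
    \<comment> \<open>On the outer circle all distances to A are at least exp (2 |B|); since A
      carries at least half of the mass, the potential is at least |B| there.\<close>
    define \<rho> where "\<rho> = r + exp (2 * \<bar>B\<bar>) + cmod z"
    define D where "D = {x. s \<le> infdist x A} \<inter> cball 0 \<rho>"
    have cl: "closed {x. s \<le> infdist x A}"
      by (intro closed_Collect_le continuous_intros)
    then have D: "compact D" unfolding D_def by (simp add: compact_Int_closed[OF compact_cball] inf_commute)
    have DA: "D \<subseteq> - A" using s by (auto simp: D_def)
    note lc = logpot_continuous[OF finite_measure_mu sets_nu A(1)]
    have "- logpot \<mu> A z \<le> - (B - c * s)"
    proof (rule compact_max_principle[OF D])
      show "continuous_on D (\<lambda>x. - logpot \<mu> A x)"
        by (intro continuous_intros continuous_on_subset[OF lc DA])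
      show "z \<in> D" using s r_nonneg by (auto simp: D_def \<rho>_def intro!: add_increasing)
    next
      fix x assume xf: "x \<in> frontier D"
      then have x: "x \<in> D" using compact_imp_closed[OF D] by (auto simp: frontier_def)
      have "infdist x A = s \<or> cmod x = \<rho>"
        by (rule frontier_superlevel_cball[OF _ xf[unfolded D_def]]) (intro continuous_intros)
      then show "- logpot \<mu> A x \<le> - (B - c * s)"
      proof
        assume "infdist x A = s"
        then show ?thesis using near[of x] x DA by auto
      next
        assume x\<rho>: "cmod x = \<rho>"
        have "0 \<le> c * s" using s c by simp
        then have "B - c * s \<le> \<bar>B\<bar>" by linarith
        also have "\<dots> \<le> measure \<mu> A * (2 * \<bar>B\<bar>)"
          using mult_right_mono[OF m, of "2 * \<bar>B\<bar>"] by simp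
        also have "\<dots> = measure \<mu> A * ln (exp (2 * \<bar>B\<bar>))" by simp
        also have "\<dots> \<le> logpot \<mu> A x"
        proof (rule logpot_lower[OF finite_measure_mu sets_nu A(1)])
          fix w assume "w \<in> A"
          then have "cmod w \<le> r" using A(3) K(2) by auto
          moreover have "cmod x \<le> cmod (x - w) + cmod w" using norm_triangle_ineq[of "x - w" w] by simp
          ultimately show "exp (2 * \<bar>B\<bar>) \<le> cmod (x - w)" using x\<rho> unfolding \<rho>_def using norm_ge_zero[of z] by linarith
        qed simp
        finally show ?thesis by simp
      qed
    next
      fix x assume x: "x \<in> interior D" and mx: "\<And>y. y \<in> D \<Longrightarrow> - logpot \<mu> A y \<le> - logpot \<mu> A x"
      obtain e where e: "0 < e" "ball x e \<subseteq> D" using x mem_interior by blast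
      show "\<exists>e>0. \<forall>y\<in>ball x e. - logpot \<mu> A y = - logpot \<mu> A x"
      proof (intro exI[of _ e] conjI ballI e(1))
        fix y assume y: "y \<in> ball x e"
        show "- logpot \<mu> A y = - logpot \<mu> A x"
        proof (rule local_const_of_mean[where v = "\<lambda>x. - logpot \<mu> A x", OF _ _ _ y])
          show "continuous_on (ball x e) (\<lambda>x. - logpot \<mu> A x)"
            using e(2) DA by (intro continuous_intros continuous_on_subset[OF lc]) auto
          show "- logpot \<mu> A w \<le> - logpot \<mu> A x" if "w \<in> ball x e" for w using mx that e(2) by auto
          fix t assume t: "0 < t" "t < e"
          then have "cball x t \<subseteq> ball x e" by auto
          then have "cball x t \<inter> A = {}" using e(2) DA by blast
          from logpot_mean_eq[OF finite_measure_mu sets_nu A(1) this t(1)]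
          show "- logpot \<mu> A x \<le> circle_mean (\<lambda>x. - logpot \<mu> A x) x (of_real t)"
            using circle_mean_scale[of "-1" "logpot \<mu> A"] by simp
        qed
      qed
    qed
    then show ?thesis by simp
  qed
  have "((\<lambda>s. B - c * s) \<longlongrightarrow> B - c * 0) (at_right 0)" by (intro tendsto_intros)
  moreover have "eventually (\<lambda>s. B - c * s \<le> logpot \<mu> A z) (at_right 0)"
    unfolding eventually_at_right_field using main z0 by (intro exI[of _ "infdist z A"]) auto
  ultimately show ?thesis by (intro tendsto_upperbound[of "\<lambda>s. B - c * s" B "at_right 0"]) auto
qed

text \<open>Egorov's argument: on the Frostman set the truncated potentials decrease and stay above
  I, so they converge. The sets \<open>A k\<close> of points where the remaining decrease below
  level \<open>d k\<close> is at most \<eta> are compact, since truncated potentials are continuous,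
  and they increase to the Frostman set.\<close>

lemma exists_uniform_set:
  assumes "0 < \<eta>" "0 < \<epsilon>"
  obtains A d where "compact A" "A \<subseteq> frostman_set" "0 < d" "d \<le> 1" "1 - \<epsilon> \<le> measure \<mu> A"
    "\<And>y s. y \<in> A \<Longrightarrow> 0 < s \<Longrightarrow> s \<le> d \<Longrightarrow> trunc_pot \<mu> d y - trunc_pot \<mu> s y \<le> \<eta>"
proof -
  define d where "d n = 1 / real (Suc n)" for n
  have d: "0 < d n" "d n \<le> 1" for n by (auto simp: d_def field_simps)
  have dmono: "d n \<le> d m" if "m \<le> n" for m n using that by (auto simp: d_def intro!: divide_left_mono)
  define A where "A k = {y \<in> frostman_set. \<forall>s\<in>{0<..d k}. trunc_pot \<mu> (d k) y - trunc_pot \<mu> s y \<le> \<eta>}" for k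
  have "A k = frostman_set \<inter> (\<Inter>s\<in>{0<..d k}. {y. trunc_pot \<mu> (d k) y - trunc_pot \<mu> s y \<le> \<eta>})" for k by (auto simp: A_def)
  moreover have "closed (\<Inter>s\<in>{0<..d k}. {y. trunc_pot \<mu> (d k) y - trunc_pot \<mu> s y \<le> \<eta>})" for k
    using d by (intro closed_INT ballI closed_Collect_le continuous_intros continuous_trunc_pot) auto
  ultimately have cA: "compact (A k)" for k using compact_frostman_set by (simp add: compact_Int_closed)
  have inc: "incseq A"
  proof (rule incseq_SucI, rule subsetI)
    fix k y assume y: "y \<in> A k"
    have 1: "trunc_pot \<mu> (d (Suc k)) y \<le> trunc_pot \<mu> (d k) y" by (intro trunc_pot_mono d dmono) simp
    have 2: "trunc_pot \<mu> (d (Suc k)) y - trunc_pot \<mu> s y \<le> \<eta>" if "s \<in> {0<..d (Suc k)}" for s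
    proof -
      have "s \<in> {0<..d k}" using that dmono[of k "Suc k"] by auto
      then have "trunc_pot \<mu> (d k) y - trunc_pot \<mu> s y \<le> \<eta>" using y by (simp add: A_def)
      then show ?thesis using 1 by linarith
    qed
    have "y \<in> frostman_set" using y by (simp add: A_def)
    then show "y \<in> A (Suc k)" unfolding A_def mem_Collect_eq using 2 by blast
  qed
  have "frostman_set \<subseteq> (\<Union>k. A k)"
  proof
    fix y assume y: "y \<in> frostman_set"
    let ?f = "\<lambda>n. trunc_pot \<mu> (d n) y"
    have "decseq ?f" by (intro decseq_SucI trunc_pot_mono d dmono) simp
    moreover have "I \<le> ?f n" for n using y d by (auto simp: frostman_set_def)
    ultimately obtain l where l: "?f \<longlonglongrightarrow> l" "\<And>n. l \<le> ?f n" using decseq_convergent[of ?f I] by metis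
    then obtain k where k: "?f k < l + \<eta>"
      using order_tendstoD(2)[OF l(1), of "l + \<eta>"] assms by (auto simp: eventually_sequentially)
    have "trunc_pot \<mu> (d k) y - trunc_pot \<mu> s y \<le> \<eta>" if s: "0 < s" for s
    proof -
      obtain n where "inverse (real (Suc n)) < s" using s reals_Archimedean by blast
      then have "?f n \<le> trunc_pot \<mu> s y" by (intro trunc_pot_mono d) (simp add: d_def inverse_eq_divide)
      then show ?thesis using l(2)[of n] k by linarith
    qed
    then have "y \<in> A k" using y by (auto simp: A_def)
    then show "y \<in> (\<Union>k. A k)" by blast
  qed
  then have US: "(\<Union>k. A k) = frostman_set" by (auto simp: A_def)
  have As: "range A \<subseteq> events" using cA by (auto intro!: sets_borel borel_compact)
  have "(\<lambda>k. measure \<mu> (A k)) \<longlonglongrightarrow> measure \<mu> (\<Union>k. A k)"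
    by (rule finite_Lim_measure_incseq[OF As inc])
  moreover have "measure \<mu> frostman_set = 1"
    using AE_frostman_set compact_frostman_set by (subst prob_eq_1) (auto intro!: sets_borel borel_compact)
  ultimately have "(\<lambda>k. measure \<mu> (A k)) \<longlonglongrightarrow> 1" unfolding US by simp
  then obtain k where "1 - \<epsilon> < measure \<mu> (A k)"
    using order_tendstoD(1)[of _ 1 sequentially "1 - \<epsilon>"] assms by (auto simp: eventually_sequentially)
  then have k: "1 - \<epsilon> \<le> measure \<mu> (A k)" by simp
  show ?thesis
  proof (rule that[OF cA _ d k])
    show "A k \<subseteq> frostman_set" by (auto simp: A_def)
    show "trunc_pot \<mu> (d k) y - trunc_pot \<mu> s y \<le> \<eta>" if "y \<in> A k" "0 < s" "s \<le> d k" for y s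
      using that by (auto simp: A_def)
  qed
qed

lemma logpot_frostman_set_ge:
  assumes z: "z \<notin> frostman_set"
  shows "I \<le> logpot \<mu> frostman_set z"
proof -
  \<comment> \<open>At z the kernel is at least -M on the Frostman set. The mass of at most \<eta>
    that is lost in passing to A therefore costs at most \<eta> M.\<close>
  define M where "M = \<bar>ln (infdist z frostman_set)\<bar>"
  have "frostman_set \<noteq> {}" by (rule AE_imp_nonempty[OF AE_frostman_set])
  then have z0: "0 < infdist z frostman_set" using z compact_frostman_set by (simp add: infdist_pos_not_in_closed compact_imp_closed)
  have main: "I - \<eta> * (1 + L + M) \<le> logpot \<mu> frostman_set z" if \<eta>: "0 < \<eta>" "\<eta> \<le> 1/2" for \<eta>
  proof -
    obtain A d where A: "compact A" "A \<subseteq> frostman_set" "0 < d" "d \<le> 1" "1 - \<eta> \<le> measure \<mu> A"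
      "\<And>y s. y \<in> A \<Longrightarrow> 0 < s \<Longrightarrow> s \<le> d \<Longrightarrow> trunc_pot \<mu> d y - trunc_pot \<mu> s y \<le> \<eta>"
      using exists_uniform_set[OF \<eta>(1) \<eta>(1)] by blast
    have ne: "A \<noteq> {}" using A(5) \<eta> by auto
    have zA: "z \<notin> A" using z A by auto
    have "I - \<eta> - \<eta> * L \<le> logpot \<mu> A z"
    proof (rule logpot_lower_of_near[OF A(1) ne])
      show "A \<subseteq> K" using A(2) frostman_set_subset by auto
      show "1/2 \<le> measure \<mu> A" using A(5) \<eta> by simp
      show "0 \<le> 2 / d" using A by simp
      show "I - \<eta> - \<eta> * L - 2 / d * infdist x A \<le> logpot \<mu> A x" if "x \<notin> A" for x
        using A \<eta> by (intro logpot_near ne that) auto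
    qed (rule zA)
    moreover have "- (\<eta> * M) \<le> logpot \<mu> frostman_set z - logpot \<mu> A z"
    proof -
      have Sb: "frostman_set - A \<in> events" using compact_frostman_set A(1) by (intro sets_borel sets.Diff borel_compact)
      have i1: "integrable \<mu> (\<lambda>w. indicator (frostman_set - A) w * (- M))"
        using Sb by (intro integrable_mult_left integrable_real_indicator) (auto simp: emeasure_finite less_top[symmetric])
      note i2 = logpot_integrable[OF finite_measure_mu sets_nu compact_frostman_set z]
      note i3 = logpot_integrable[OF finite_measure_mu sets_nu A(1) zA]
      have mS: "measure \<mu> (frostman_set - A) \<le> \<eta>"
      proof -
        have "measure \<mu> (frostman_set - A) = measure \<mu> frostman_set - measure \<mu> A"
          using A compact_frostman_set by (intro finite_measure_Diff) (auto intro!: sets_borel borel_compact)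
        then show ?thesis using A(5) prob_le_1[of frostman_set] by linarith
      qed
      have "- (\<eta> * M) \<le> - (measure \<mu> (frostman_set - A) * M)" using mS by (simp add: M_def mult_right_mono)
      also have "\<dots> = (\<integral>w. indicator (frostman_set - A) w * (- M) \<partial>\<mu>)" using Sb by simp
      also have "\<dots> \<le> (\<integral>w. indicator frostman_set w * ln (cmod (z - w)) - indicator A w * ln (cmod (z - w)) \<partial>\<mu>)"
      proof (intro integral_mono i1 Bochner_Integration.integrable_diff i2 i3)
        fix w
        have "- M \<le> ln (cmod (z - w))" if "w \<in> frostman_set"
        proof -
          have "infdist z frostman_set \<le> cmod (z - w)" using infdist_le[OF that, of z] by (simp add: dist_norm)
          then have "ln (infdist z frostman_set) \<le> ln (cmod (z - w))" using z0 by (intro ln_mono) auto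
          then show ?thesis unfolding M_def by linarith
        qed
        then show "indicator (frostman_set - A) w * (- M) \<le> indicator frostman_set w * ln (cmod (z - w)) - indicator A w * ln (cmod (z - w))"
          using A(2) by (auto simp: indicator_def)
      qed
      also have "\<dots> = logpot \<mu> frostman_set z - logpot \<mu> A z"
        unfolding logpot_def by (intro Bochner_Integration.integral_diff i2 i3)
      finally show ?thesis .
    qed
    ultimately show ?thesis by (simp add: algebra_simps)
  qed
  have "((\<lambda>\<eta>. I - \<eta> * (1 + L + M)) \<longlongrightarrow> I - 0 * (1 + L + M)) (at_right 0)" by (intro tendsto_intros)
  moreover have "eventually (\<lambda>\<eta>. I - \<eta> * (1 + L + M) \<le> logpot \<mu> frostman_set z) (at_right 0)"
    unfolding eventually_at_right_field using main by (intro exI[of _ "1/2"]) auto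
  ultimately show ?thesis by (intro tendsto_upperbound[of "\<lambda>\<eta>. I - \<eta> * (1 + L + M)" I "at_right 0"]) auto
qed

text \<open>The bound must hold at every point of the plane, not only almost everywhere, because it
  will be applied at the zeros of arbitrary monic polynomials.\<close>

lemma frostman: "0 < \<delta> \<Longrightarrow> I \<le> trunc_pot \<mu> \<delta> z"
proof (cases "z \<in> frostman_set")
  case False
  assume d: "0 < \<delta>"
  have "logpot \<mu> frostman_set z \<le> trunc_pot \<mu> \<delta> z" unfolding logpot_def trunc_pot_def
  proof (intro integral_mono_AE logpot_integrable finite_measure_mu sets_nu compact_frostman_set False trunc_ln_integrable d)
    show "AE w in \<mu>. indicator frostman_set w * ln (cmod (z - w)) \<le> trunc_ln \<delta> (z - w)"
      using AE_frostman_set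
    proof eventually_elim
      case (elim w)
      then have "z - w \<noteq> 0" using False by auto
      from trunc_ln_ge_ln[OF d this] show ?case using elim by simp
    qed
  qed
  then show ?thesis using logpot_frostman_set_ge[OF False] by linarith
qed (auto simp: frostman_set_def)

text \<open>Truncating at the distance from z to S changes nothing on S. The set S is any compact
  set of full measure; later it is K itself or the part of K on which a polynomial has modulus
  1.\<close>

lemma logpot_ge:
  assumes S: "compact S" "AE w in \<mu>. w \<in> S" and z: "z \<notin> S"
  shows "I \<le> logpot \<mu> S z"
proof -
  have ne: "S \<noteq> {}" by (rule AE_imp_nonempty[OF S(2)])
  have z0: "0 < infdist z S" using z S ne by (simp add: infdist_pos_not_in_closed compact_imp_closed)
  have "trunc_pot \<mu> (infdist z S) z = logpot \<mu> S z"
    unfolding trunc_pot_def logpot_def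
  proof (rule integral_cong_AE)
    show "(\<lambda>w. indicator S w * ln (cmod (z - w))) \<in> borel_measurable \<mu>"
      using logpot_integrable[OF finite_measure_mu sets_nu S(1) z] by simp
    show "AE w in \<mu>. trunc_ln (infdist z S) (z - w) = indicator S w * ln (cmod (z - w))"
      using S(2)
    proof eventually_elim
      case (elim w)
      then show ?case using infdist_le[OF elim, of z] by (simp add: trunc_ln_eq dist_norm)
    qed
  qed measurable
  then show ?thesis using frostman[OF z0, of z] by simp
qed

end

subsection \<open>A space-filling curve and weak compactness\<close>

text \<open>Schoenberg's curve, with a cosine in place of his piecewise linear function.\<close>

definition schoenberg :: "real \<Rightarrow> real" where
  "schoenberg t = max 0 (min 1 (1/2 - cos (pi * t)))"

definition schoenberg_coord :: "nat \<Rightarrow> real \<Rightarrow> real" where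
  "schoenberg_coord i t = (\<Sum>k. schoenberg (3 ^ (2 * k + i) * t) / 2 ^ Suc k)"

lemma continuous_schoenberg: "continuous_on A schoenberg"
  unfolding schoenberg_def by (intro continuous_intros)

lemma continuous_schoenberg_coord: "continuous_on UNIV (schoenberg_coord i)"
proof -
  have "uniform_limit UNIV (\<lambda>n t. \<Sum>k<n. schoenberg (3 ^ (2 * k + i) * t) / 2 ^ Suc k)
      (\<lambda>t. \<Sum>k. schoenberg (3 ^ (2 * k + i) * t) / 2 ^ Suc k) sequentially"
  proof (rule Weierstrass_m_test)
    show "norm (schoenberg (3 ^ (2 * n + i) * x) / 2 ^ Suc n) \<le> (1/2) ^ Suc n" for n x
      by (simp add: schoenberg_def power_one_over divide_right_mono)
    show "summable (\<lambda>n. (1/2::real) ^ Suc n)" by (intro summable_Suc_iff[THEN iffD2] summable_geometric) simp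
  qed
  then have "continuous_on UNIV (\<lambda>t. \<Sum>k. schoenberg (3 ^ (2 * k + i) * t) / 2 ^ Suc k)"
    by (rule uniform_limit_theorem[rotated])
       (auto intro!: always_eventually continuous_intros continuous_on_compose2[OF continuous_schoenberg[of UNIV]])
  then show ?thesis unfolding schoenberg_coord_def[abs_def] .
qed

text \<open>The cosine is at least 1/2 within \<pi>/3 of an even multiple of \<pi>, and clipping
  yields a plateau; near odd multiples there is a plateau of value 1 in the same way. The plateaus
  have room for the tail of a ternary expansion.\<close>

lemma schoenberg_low:
  assumes "0 \<le> t" "t \<le> 1/3"
  shows "schoenberg (2 * real n + t) = 0"
proof -
  have "cos (pi * (1/3)) \<le> cos (pi * t)" using assms
    by (intro cos_monotone_0_pi_le mult_left_mono) (auto simp: field_simps)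
  then have "1/2 \<le> cos (pi * t)" by (simp add: cos_60)
  moreover have "cos (pi * (2 * real n + t)) = cos (pi * t)"
  proof -
    have "pi * (2 * real n + t) = pi * t + 2 * real n * pi" by (simp add: algebra_simps)
    then show ?thesis by (simp add: cos_add)
  qed
  ultimately show ?thesis by (simp add: schoenberg_def)
qed

lemma schoenberg_high:
  assumes "0 \<le> t" "t \<le> 1/3"
  shows "schoenberg (2 * real n + 2/3 + t) = 1"
proof -
  have "cos (pi * (1/3)) \<le> cos (pi * (1/3 - t))" using assms
    by (intro cos_monotone_0_pi_le mult_left_mono) (auto simp: field_simps)
  then have 1: "1/2 \<le> cos (pi * (1/3 - t))" by (simp add: cos_60)
  have "pi * (2 * real n + 2/3 + t) = (pi - pi * (1/3 - t)) + 2 * real n * pi" by (simp add: algebra_simps)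
  then have "cos (pi * (2 * real n + 2/3 + t)) = cos (pi - pi * (1/3 - t))"
    by (simp only: cos_add[of _ "2 * real n * pi"] cos_2npi sin_2npi mult_1_right mult_zero_right diff_zero)
  also have "\<dots> = - cos (pi * (1/3 - t))" by (rule cos_pi_minus)
  finally show ?thesis using 1 by (simp add: schoenberg_def)
qed

lemma binary_expansion:
  assumes "0 \<le> x" "x < (1::real)"
  obtains a :: "nat \<Rightarrow> nat" where "\<And>k. a k \<le> 1" "(\<lambda>k. real (a k) / 2 ^ Suc k) sums x"
proof -
  define f where "f n = \<lfloor>2 ^ n * x\<rfloor>" for n
  define a where "a k = nat (f (Suc k) - 2 * f k)" for k
  have fk: "0 \<le> f (Suc k) - 2 * f k" "f (Suc k) - 2 * f k \<le> 1" for k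
    unfolding f_def power_Suc mult.assoc by linarith+
  have part: "(\<Sum>k<n. real (a k) / 2 ^ Suc k) = f n / 2 ^ n" for n
  proof (induction n)
    case 0
    show ?case using assms by (simp add: f_def floor_eq_iff)
  next
    case (Suc n)
    have "real (a n) = real_of_int (f (Suc n)) - 2 * real_of_int (f n)"
      using fk(1)[of n] by (simp add: a_def)
    then show ?case unfolding sum.lessThan_Suc Suc.IH by (simp add: field_simps)
  qed
  have "(\<lambda>n. f n / 2 ^ n) \<longlonglongrightarrow> x"
  proof (rule LIMSEQ_I)
    fix e :: real assume "0 < e"
    then obtain N where N: "(1/2)^N < e" using real_arch_pow_inv[of e "1/2"] by auto
    have "norm (f n / 2 ^ n - x) < e" if "n \<ge> N" for n
    proof -
      have "\<bar>real_of_int (f n) - 2 ^ n * x\<bar> \<le> 1" unfolding f_def by linarith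
      then have "\<bar>(real_of_int (f n) - 2 ^ n * x) / 2 ^ n\<bar> \<le> 1 / 2 ^ n"
        by (simp add: abs_divide divide_right_mono)
      moreover have "(real_of_int (f n) - 2 ^ n * x) / 2 ^ n = f n / 2 ^ n - x" by (simp add: field_simps)
      moreover have "(1/2)^n \<le> (1/2::real)^N" using that by (intro power_decreasing) auto
      ultimately show ?thesis using N by (simp add: power_one_over)
    qed
    then show "\<exists>no. \<forall>n\<ge>no. norm (f n / 2 ^ n - x) < e" by blast
  qed
  then have "(\<lambda>k. real (a k) / 2 ^ Suc k) sums x" unfolding sums_def part .
  moreover have "a k \<le> 1" for k using fk[of k] by (simp add: a_def)
  ultimately show ?thesis using that by blast
qed

text \<open>Only the digits 0 and 2 occur. In 3 ^ m t the digits before position m form an even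
  integer, a period of \<open>schoenberg\<close>; digit m adds 0 or 2/3, and the tail is at most
  1/3. The argument thus falls into the plateau belonging to \<open>b m\<close>.\<close>

lemma ternary_digit:
  fixes b :: "nat \<Rightarrow> nat"
  assumes b: "\<And>k. b k \<le> 1"
  defines "t \<equiv> (\<Sum>k. 2 * real (b k) / 3 ^ Suc k)"
  shows "t \<in> {0..1}" "schoenberg (3 ^ m * t) = real (b m)"
proof -
  have bb: "0 \<le> 2 * real (b k) / 3 ^ Suc k" "2 * real (b k) / 3 ^ Suc k \<le> 2 / 3 * (1/3) ^ k" for k
    using b[of k] by (auto simp: power_one_over divide_right_mono)
  have geo: "(\<lambda>k. 2 / 3 * (1/3::real) ^ k) sums 1"
    using sums_mult[OF geometric_sums[of "1/3::real"], of "2/3"] by simp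
  have sm: "summable (\<lambda>k. 2 * real (b k) / 3 ^ Suc k)"
    by (rule summable_comparison_test'[OF sums_summable[OF geo]]) (use bb in auto)
  show "t \<in> {0..1}"
    unfolding t_def using suminf_nonneg[OF sm bb(1)] suminf_le[OF bb(2) sm sums_summable[OF geo]] sums_unique[OF geo] by simp
  define h where "h = (\<Sum>k<m. b k * 3 ^ (m - Suc k))"
  define tl where "tl = (\<Sum>k. 2 * real (b (k + Suc m)) / 3 ^ Suc k) / 3"
  have sm2: "summable (\<lambda>k. 2 * real (b (k + Suc m)) / 3 ^ Suc k)"
  proof (rule summable_comparison_test'[OF sums_summable[OF geo]])
    show "norm (2 * real (b (n + Suc m)) / 3 ^ Suc n) \<le> 2 / 3 * (1/3) ^ n" for n
      using b[of "n + Suc m"] by (auto simp: power_one_over divide_right_mono)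
  qed
  have tl: "0 \<le> tl" "tl \<le> 1/3"
  proof -
    have 1: "2 * real (b (n + Suc m)) / 3 ^ Suc n \<le> 2 / 3 * (1/3) ^ n" for n
      using b[of "n + Suc m"] by (auto simp: power_one_over divide_right_mono)
    show "0 \<le> tl" unfolding tl_def using suminf_nonneg[OF sm2] by simp
    show "tl \<le> 1/3" unfolding tl_def using suminf_le[OF 1 sm2 sums_summable[OF geo]] sums_unique[OF geo] by simp
  qed
  have "t = (\<Sum>k. 2 * real (b (k + Suc m)) / 3 ^ Suc (k + Suc m)) + (\<Sum>k<Suc m. 2 * real (b k) / 3 ^ Suc k)"
    unfolding t_def by (rule suminf_split_initial_segment[OF sm])
  also have "(\<Sum>k. 2 * real (b (k + Suc m)) / 3 ^ Suc (k + Suc m)) = (\<Sum>k. (1 / 3 ^ Suc m) * (2 * real (b (k + Suc m)) / 3 ^ Suc k))"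
    by (intro suminf_cong) (simp add: power_add field_simps)
  also have "\<dots> = (1 / 3 ^ Suc m) * (\<Sum>k. 2 * real (b (k + Suc m)) / 3 ^ Suc k)"
    by (rule suminf_mult[OF sm2])
  finally have "3 ^ m * t = tl + (\<Sum>k<Suc m. 3 ^ m * (2 * real (b k) / 3 ^ Suc k))"
    by (simp add: tl_def distrib_left sum_distrib_left)
  also have "(\<Sum>k<Suc m. 3 ^ m * (2 * real (b k) / 3 ^ Suc k)) = 2 * real h + 2 / 3 * real (b m)"
  proof -
    have "3 ^ m * (2 * real (b k) / 3 ^ Suc k) = 2 * (real (b k) * 3 ^ (m - Suc k))" if "k < m" for k
    proof -
      have "(3::real) ^ m = 3 ^ ((m - Suc k) + Suc k)" using that by simp
      then have "(3::real) ^ m = 3 ^ (m - Suc k) * 3 ^ Suc k" unfolding power_add .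
      then show ?thesis by simp
    qed
    then show ?thesis by (simp add: h_def sum_distrib_left)
  qed
  finally have eq: "3 ^ m * t = 2 * real h + 2 / 3 * real (b m) + tl" by simp
  show "schoenberg (3 ^ m * t) = real (b m)"
  proof (cases "b m = 0")
    case True then show ?thesis using eq schoenberg_low[OF tl, of h] by simp
  next
    case False
    then have "b m = 1" using b[of m] by linarith
    then show ?thesis using eq schoenberg_high[OF tl, of h] by simp
  qed
qed

text \<open>Lets points of the plane be lifted to parameters in an interval, so that weak
  compactness of measures on the real line yields it for the plane.\<close>

lemma space_filling_curve:
  fixes R :: real
  shows "\<exists>g :: real \<Rightarrow> complex. continuous_on UNIV g \<and> (\<forall>z. cmod z < R \<longrightarrow> (\<exists>t\<in>{0..1}. g t = z))"
proof -
  let ?g = "\<lambda>t. Complex (2 * R * schoenberg_coord 0 t - R) (2 * R * schoenberg_coord 1 t - R)"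
  have cont: "continuous_on UNIV ?g" unfolding Complex_eq
    by (intro continuous_intros continuous_schoenberg_coord)
  show ?thesis
  proof (intro exI[of _ ?g] conjI allI impI cont)
    fix z :: complex assume z: "cmod z < R"
    then have R: "R > 0" using norm_ge_zero[of z] by linarith
    have "\<bar>Re z\<bar> < R" "\<bar>Im z\<bar> < R" using z abs_Re_le_cmod[of z] abs_Im_le_cmod[of z] by linarith+
    then have q: "0 \<le> (Re z + R) / (2 * R)" "(Re z + R) / (2 * R) < 1"
      "0 \<le> (Im z + R) / (2 * R)" "(Im z + R) / (2 * R) < 1" using R by (auto simp: field_simps)
    obtain a :: "nat \<Rightarrow> nat" where a: "\<And>k. a k \<le> 1" "(\<lambda>k. real (a k) / 2 ^ Suc k) sums ((Re z + R) / (2 * R))"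
      by (rule binary_expansion[OF q(1,2)]) (rule that)
    obtain b :: "nat \<Rightarrow> nat" where b: "\<And>k. b k \<le> 1" "(\<lambda>k. real (b k) / 2 ^ Suc k) sums ((Im z + R) / (2 * R))"
      by (rule binary_expansion[OF q(3,4)]) (rule that)
    \<comment> \<open>The binary digits of the two coordinates are interleaved; the frequencies 3 ^
      (2 k) and 3 ^ (2 k + 1) separate them again.\<close>
    define c where "c k = (if even k then a (k div 2) else b (k div 2))" for k
    have c: "c k \<le> 1" for k using a(1) b(1) by (simp add: c_def)
    let ?t = "\<Sum>k. 2 * real (c k) / 3 ^ Suc k"
    have "schoenberg (3 ^ (2 * k + 0) * ?t) = real (a k)" "schoenberg (3 ^ (2 * k + 1) * ?t) = real (b k)" for k
      using ternary_digit(2)[OF c, of "2 * k + 0"] ternary_digit(2)[OF c, of "2 * k + 1"] by (simp_all add: c_def)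
    then have "schoenberg_coord 0 ?t = (Re z + R) / (2 * R)" "schoenberg_coord 1 ?t = (Im z + R) / (2 * R)"
      unfolding schoenberg_coord_def using sums_unique[OF a(2)] sums_unique[OF b(2)] by simp_all
    then have "?g ?t = z" using R by (simp add: complex_eq_iff)
    then show "\<exists>t\<in>{0..1}. ?g t = z" using ternary_digit(1)[of c, OF c] by (rule bexI)
  qed
qed

text \<open>Integration against the empirical measure of the first m + 1 points.\<close>

definition avg :: "(nat \<Rightarrow> 'a) \<Rightarrow> nat \<Rightarrow> ('a \<Rightarrow> real) \<Rightarrow> real" where
  "avg w m f = (\<Sum>i\<le>m. f (w i)) / real (Suc m)"

lemma avg_mono: "(\<And>i. f (w i) \<le> g (w i)) \<Longrightarrow> avg w m f \<le> avg w m g"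
  unfolding avg_def by (intro divide_right_mono sum_mono) auto

lemma avg_const [simp]: "avg w m (\<lambda>_. c) = c"
  by (simp add: avg_def)

lemma avg_diff: "avg w m (\<lambda>z. f z - g z) = avg w m f - avg w m g"
  by (simp add: avg_def sum_subtractf diff_divide_distrib)

lemma avg_abs_bound:
  assumes "\<And>i. \<bar>f (w i)\<bar> \<le> c"
  shows "\<bar>avg w m f\<bar> \<le> c"
proof -
  have "f (w i) \<le> c" "- c \<le> f (w i)" for i using assms[of i] by linarith+
  then have "avg w m f \<le> avg w m (\<lambda>_. c)" "avg w m (\<lambda>_. - c) \<le> avg w m f"
    by (intro avg_mono; simp)+
  then show ?thesis by simp
qed

text \<open>The averages are integrals against uniform distributions carried by [0, 1]. The
  half-open interval from -1 to 1 contains all of their mass, which gives tightness.\<close>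

lemma weak_limit_real:
  assumes t: "\<And>i. t i \<in> {0..1::real}"
  shows "\<exists>s N. strict_mono (s :: nat \<Rightarrow> nat) \<and> real_distribution N \<and>
    (\<forall>f B. continuous_on UNIV f \<longrightarrow> (\<forall>x. \<bar>f x\<bar> \<le> B) \<longrightarrow> (\<lambda>m. avg t (s m) f) \<longlonglongrightarrow> (\<integral>x. f x \<partial>N))"
proof -
  define M where "M m = distr (measure_pmf (pmf_of_set {..m})) borel t" for m :: nat
  have rd: "real_distribution (M m)" for m
    unfolding M_def by (intro prob_space.real_distribution_distr prob_space_measure_pmf) simp
  have int: "(\<integral>x. f x \<partial>M m) = avg t m f" if "f \<in> borel_measurable borel" for f and m
    unfolding M_def avg_def using that by (subst integral_distr) (auto simp: integral_pmf_of_set)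
  have "tight M" unfolding tight_def
  proof (intro conjI allI impI rd)
    fix e :: real assume e: "0 < e"
    show "\<exists>a b. a < b \<and> (\<forall>n. 1 - e < measure (M n) {a<..b})"
    proof (rule exI[of _ "-1"], rule exI[of _ 1], intro conjI allI)
      fix n
      have "measure (M n) {-1<..1} = measure (measure_pmf (pmf_of_set {..n})) (t -` {-1<..1})"
        unfolding M_def by (subst measure_distr) auto
      moreover have "t -` {-1<..1} = UNIV" using t by (force intro: order.strict_trans2[of "-1" 0])
      ultimately have "measure (M n) {-1<..1} = 1" by simp
      then show "1 - e < measure (M n) {-1<..1}" using e by simp
    qed simp
  qed
  from tight_imp_convergent_subsubsequence[OF this strict_mono_id]
  obtain s N where s: "strict_mono s" "real_distribution N" "weak_conv_m (M \<circ> s) N" by auto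
  show ?thesis
  proof (rule exI[of _ s], rule exI[of _ N], intro conjI allI impI s(1,2))
    fix f :: "real \<Rightarrow> real" and B
    assume f: "continuous_on UNIV f" "\<forall>x. \<bar>f x\<bar> \<le> B"
    have "(\<lambda>n. integral\<^sup>L ((M \<circ> s) n) f) \<longlonglongrightarrow> integral\<^sup>L N f"
      by (rule weak_conv_imp_integral_bdd_continuous_conv[OF _ s(2,3), of f B])
         (use f rd in \<open>auto simp: continuous_on_eq_continuous_at\<close>)
    then show "(\<lambda>m. avg t (s m) f) \<longlonglongrightarrow> (\<integral>x. f x \<partial>N)"
      using int[OF borel_measurable_continuous_onI[OF f(1)]] by simp
  qed
qed

text \<open>The points are lifted along the space-filling curve, the limit is taken on the line, and
  the limit measure is pushed forward to the plane.\<close>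

lemma weak_limit:
  assumes K: "compact K" and w: "\<And>i. w i \<in> K"
  shows "\<exists>s \<sigma>. strict_mono (s :: nat \<Rightarrow> nat) \<and> prob_on K \<sigma> \<and>
    (\<forall>f. continuous_on UNIV f \<longrightarrow> (\<lambda>m. avg w (s m) f) \<longlonglongrightarrow> (\<integral>z. f z \<partial>\<sigma>))"
proof -
  obtain R where "\<forall>x\<in>K. cmod x \<le> R" using compact_imp_bounded[OF K] by (auto simp: bounded_iff)
  then have wR: "cmod (w i) < R + 1" for i using w[of i] by force
  obtain g :: "real \<Rightarrow> complex" where
    g: "continuous_on UNIV g" "\<forall>z. cmod z < R + 1 \<longrightarrow> (\<exists>t\<in>{0..1}. g t = z)"
    using space_filling_curve[of "R + 1"] by (elim exE conjE)
  have "\<forall>i. \<exists>t. t \<in> {0..1} \<and> g t = w i" using g(2)[rule_format, OF wR] by (simp add: Bex_def)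
  from choice[OF this] obtain t where t: "\<And>i. t i \<in> {0..1}" "\<And>i. g (t i) = w i" by auto
  obtain s N where s: "strict_mono s" "real_distribution N"
    "\<forall>f B. continuous_on UNIV f \<longrightarrow> (\<forall>x. \<bar>f x\<bar> \<le> B) \<longrightarrow> (\<lambda>m. avg t (s m) f) \<longlonglongrightarrow> (\<integral>x. f x \<partial>N)"
    using weak_limit_real[of t, OF t(1)] by (elim exE conjE)
  interpret N: real_distribution N by (rule s(2))
  define \<sigma> where "\<sigma> = distr N borel g"
  have gm: "g \<in> N \<rightarrow>\<^sub>M borel"
    using borel_measurable_continuous_onI[OF g(1)] by (simp add: measurable_cong_sets[OF N.events_eq_borel refl])
  interpret S: prob_space \<sigma> unfolding \<sigma>_def by (rule N.prob_space_distr[OF gm])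
  have ss: "sets \<sigma> = sets borel" by (simp add: \<sigma>_def)
  have conv_bdd: "(\<lambda>m. avg w (s m) f) \<longlonglongrightarrow> (\<integral>z. f z \<partial>\<sigma>)"
    if f: "continuous_on UNIV f" "\<And>x. \<bar>f x\<bar> \<le> B" for f B
  proof -
    have "continuous_on UNIV (\<lambda>x. f (g x))" by (rule continuous_on_compose2[OF f(1) g(1)]) auto
    from s(3)[rule_format, OF this f(2)] have "(\<lambda>m. avg t (s m) (\<lambda>x. f (g x))) \<longlonglongrightarrow> (\<integral>x. f (g x) \<partial>N)" .
    moreover have "avg t m (\<lambda>x. f (g x)) = avg w m f" for m by (simp add: avg_def t)
    moreover have "(\<integral>x. f (g x) \<partial>N) = (\<integral>z. f z \<partial>\<sigma>)"
      unfolding \<sigma>_def using gm borel_measurable_continuous_onI[OF f(1)] by (simp add: integral_distr)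
    ultimately show ?thesis by simp
  qed
  have ne: "K \<noteq> {}" using w by auto
  have cK: "closed K" using K by (rule compact_imp_closed)
  \<comment> \<open>A bounded continuous test function that vanishes exactly on K: all its averages
    are 0, so its integral is 0 and the limit measure is carried by K.\<close>
  define d where "d z = min 1 (infdist z K)" for z :: complex
  have cd: "continuous_on UNIV d" unfolding d_def by (intro continuous_intros)
  have db: "\<bar>d z\<bar> \<le> 1" for z unfolding d_def using infdist_nonneg[of z K] by auto
  have dn: "0 \<le> d z" for z unfolding d_def using infdist_nonneg[of z K] by auto
  have dmeas: "d \<in> borel_measurable \<sigma>"
    using borel_measurable_continuous_onI[OF cd] by (simp add: measurable_cong_sets[OF ss refl])
  have "avg w m d = 0" for m using w by (simp add: avg_def d_def)
  then have "(\<lambda>m. 0) \<longlonglongrightarrow> (\<integral>z. d z \<partial>\<sigma>)" using conv_bdd[OF cd db] by simp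
  then have "(\<integral>z. d z \<partial>\<sigma>) = 0" by (simp add: LIMSEQ_const_iff)
  moreover have "integrable \<sigma> d" by (rule S.integrable_const_bound[of _ 1]) (use db dmeas in auto)
  ultimately have "AE z in \<sigma>. d z = 0"
    using integral_nonneg_eq_0_iff_AE[of \<sigma> d] dn by simp
  then have AEK: "AE z in \<sigma>. z \<in> K"
  proof eventually_elim
    case (elim z)
    then have "infdist z K = 0" by (auto simp: d_def min_def split: if_splits)
    then show ?case using in_closed_iff_infdist_zero[OF cK ne] by blast
  qed
  have pK: "prob_on K \<sigma>" unfolding prob_on_def
  proof (intro conjI ss S.prob_space_axioms)
    have "K \<in> S.events" using ss cK by simp
    from S.prob_eq_1[OF this] AEK show "emeasure \<sigma> K = 1" by (simp add: S.emeasure_eq_measure)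
  qed
  show ?thesis
  proof (rule exI[of _ s], rule exI[of _ \<sigma>], intro conjI allI impI s(1) pK)
    fix f :: "complex \<Rightarrow> real" assume f: "continuous_on UNIV f"
    have "bounded (f ` K)" by (intro compact_imp_bounded compact_continuous_image K continuous_on_subset[OF f]) auto
    then obtain B where B: "\<And>x. x \<in> K \<Longrightarrow> \<bar>f x\<bar> \<le> B" by (auto simp: bounded_iff)
    have B0: "0 \<le> B" using B[OF w[of 0]] by linarith
    \<comment> \<open>Convergence is available for bounded functions only; clipping at the bound B
      on K alters f only where neither the points nor \<sigma> have mass.\<close>
    define F where "F x = max (- B) (min B (f x))" for x
    have cF: "continuous_on UNIV F" unfolding F_def by (intro continuous_intros f)
    have FB: "\<bar>F x\<bar> \<le> B" for x unfolding F_def using B0 by auto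
    have FK: "F x = f x" if "x \<in> K" for x unfolding F_def using B[OF that] by auto
    have "avg w m F = avg w m f" for m by (simp add: avg_def FK w)
    moreover have "(\<integral>z. F z \<partial>\<sigma>) = (\<integral>z. f z \<partial>\<sigma>)"
    proof (rule integral_cong_AE)
      show "AE x in \<sigma>. F x = f x" using AEK by eventually_elim (rule FK)
    qed (use borel_measurable_continuous_onI[OF cF] borel_measurable_continuous_onI[OF f] in
         \<open>auto simp: measurable_cong_sets[OF ss refl]\<close>)
    ultimately show "(\<lambda>m. avg w (s m) f) \<longlonglongrightarrow> (\<integral>z. f z \<partial>\<sigma>)" using conv_bdd[OF cF FB] by simp
  qed
qed

subsection \<open>Leja points\<close>

text \<open>The kernel depends on both averaged variables, so one weak limit does not suffice. The
  inner averages converge pointwise to the truncated potential and share the Lipschitz constant 1 /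
  \<delta>; a finite net of K makes the convergence uniform on K, and the outer average can then be
  taken.\<close>

lemma double_avg_limit:
  assumes K: "compact K" and w: "\<And>i. w i \<in> K" and \<sigma>: "prob_on K \<sigma>"
    and lim: "\<forall>f. continuous_on UNIV f \<longrightarrow> (\<lambda>m. avg w (s m) f) \<longlonglongrightarrow> (\<integral>z. f z \<partial>\<sigma>)"
    and d: "0 < \<delta>"
  shows "(\<lambda>m. avg w (s m) (\<lambda>z. avg w (s m) (\<lambda>u. trunc_ln \<delta> (z - u)))) \<longlonglongrightarrow> trunc_energy \<sigma> \<delta>"
proof -
  obtain R where R: "\<forall>x\<in>K. cmod x \<le> R" using compact_imp_bounded[OF K] by (auto simp: bounded_iff)
  then have KR: "K \<subseteq> cball 0 R" by auto
  interpret bounded_prob \<sigma> R using prob_on_bounded_prob(1)[OF \<sigma> _ KR] K by (simp add: borel_compact)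
  define f where "f m z = avg w (s m) (\<lambda>u. trunc_ln \<delta> (z - u))" for m z
  have fl: "\<bar>f m z - f m z'\<bar> \<le> dist z z' / \<delta>" for m z z'
  proof -
    have "f m z - f m z' = avg w (s m) (\<lambda>u. trunc_ln \<delta> (z - u) - trunc_ln \<delta> (z' - u))" by (simp add: f_def avg_diff)
    also have "\<bar>\<dots>\<bar> \<le> dist z z' / \<delta>"
    proof (rule avg_abs_bound)
      show "\<bar>trunc_ln \<delta> (z - w i) - trunc_ln \<delta> (z' - w i)\<bar> \<le> dist z z' / \<delta>" for i
        using trunc_ln_lipschitz[OF d, of "z - w i" "z' - w i"] by (simp add: dist_norm)
    qed
    finally show ?thesis .
  qed
  have ptw: "(\<lambda>m. f m z) \<longlonglongrightarrow> trunc_pot \<sigma> \<delta> z" for z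
    unfolding f_def trunc_pot_def by (rule lim[rule_format]) (intro continuous_intros d)
  have unif: "eventually (\<lambda>m. \<forall>z\<in>K. \<bar>f m z - trunc_pot \<sigma> \<delta> z\<bar> \<le> e) sequentially" if e: "0 < e" for e
  proof -
    have e3: "0 < e / 3 * \<delta>" using e d by simp
    then obtain C where C: "finite C" "K \<subseteq> (\<Union>x\<in>C. ball x (e / 3 * \<delta>))"
      using K unfolding compact_eq_totally_bounded by meson
    have "eventually (\<lambda>m. \<forall>c\<in>C. dist (f m c) (trunc_pot \<sigma> \<delta> c) < e / 3) sequentially"
      using C(1) by (intro eventually_ball_finite ballI tendstoD[OF ptw]) (use e in auto)
    then show ?thesis
    proof eventually_elim
      case (elim m)
      show ?case
      proof
        fix z assume "z \<in> K"
        then obtain c where c: "c \<in> C" "dist c z < e / 3 * \<delta>" using C(2) by auto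
        then have dz: "dist z c / \<delta> \<le> e / 3" using d by (simp add: dist_commute field_simps)
        have "\<bar>f m c - trunc_pot \<sigma> \<delta> c\<bar> < e / 3" using elim c(1) by (simp add: dist_real_def)
        then show "\<bar>f m z - trunc_pot \<sigma> \<delta> z\<bar> \<le> e"
          using fl[of m z c] trunc_pot_lipschitz[OF d, of z c] dz by linarith
      qed
    qed
  qed
  have 1: "(\<lambda>m. avg w (s m) (f m) - avg w (s m) (trunc_pot \<sigma> \<delta>)) \<longlonglongrightarrow> 0"
  proof (rule tendstoI)
    fix e :: real assume e: "0 < e"
    show "eventually (\<lambda>m. dist (avg w (s m) (f m) - avg w (s m) (trunc_pot \<sigma> \<delta>)) 0 < e) sequentially"
      using unif[of "e/2"] e
    proof (auto elim!: eventually_mono)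
      fix m assume m: "\<forall>z\<in>K. \<bar>f m z - trunc_pot \<sigma> \<delta> z\<bar> * 2 \<le> e"
      have "\<bar>avg w (s m) (\<lambda>z. f m z - trunc_pot \<sigma> \<delta> z)\<bar> \<le> e / 2"
        by (rule avg_abs_bound) (use m w in auto)
      then show "\<bar>avg w (s m) (f m) - avg w (s m) (trunc_pot \<sigma> \<delta>)\<bar> < e" using e by (simp add: avg_diff)
    qed
  qed
  have 2: "(\<lambda>m. avg w (s m) (trunc_pot \<sigma> \<delta>)) \<longlonglongrightarrow> trunc_energy \<sigma> \<delta>"
    unfolding trunc_energy_def by (rule lim[rule_format]) (rule continuous_trunc_pot[OF d])
  from tendsto_add[OF 1 2] show ?thesis by (simp add: f_def[abs_def])
qed

lemma leja_points:
  assumes "compact K" "K \<noteq> {}"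
  shows "\<exists>w :: nat \<Rightarrow> complex. \<forall>n. w n \<in> K \<and> (\<forall>z\<in>K. (\<Prod>i<n. cmod (z - w i)) \<le> (\<Prod>i<n. cmod (w n - w i)))"
proof -
  let ?P = "\<lambda>(w::nat \<Rightarrow> complex) n x. x \<in> K \<and> (\<forall>z\<in>K. (\<Prod>i<n. cmod (z - w i)) \<le> (\<Prod>i<n. cmod (x - w i)))"
  show ?thesis
  proof (rule dependent_wellorder_choice)
    fix r and f g :: "nat \<Rightarrow> complex" and n :: nat assume "\<And>i. i < n \<Longrightarrow> f i = g i"
    then have "(\<Prod>i<n. cmod (z - f i)) = (\<Prod>i<n. cmod (z - g i))" for z by (intro prod.cong) auto
    then show "?P f n r = ?P g n r" by simp
  next
    fix n and f :: "nat \<Rightarrow> complex"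
    have "\<exists>x\<in>K. \<forall>z\<in>K. (\<Prod>i<n. cmod (z - f i)) \<le> (\<Prod>i<n. cmod (x - f i))"
      by (intro continuous_attains_sup assms continuous_intros)
    then show "\<exists>r. ?P f n r" by blast
  qed
qed

lemma sum_symmetric:
  fixes a :: "nat \<Rightarrow> nat \<Rightarrow> real"
  assumes "\<And>i j. a i j = a j i"
  shows "(\<Sum>i\<le>m. \<Sum>j\<le>m. a i j) = (\<Sum>i\<le>m. a i i) + 2 * (\<Sum>n\<le>m. \<Sum>i<n. a n i)"
proof (induction m)
  case (Suc m)
  have "(\<Sum>i\<le>Suc m. \<Sum>j\<le>Suc m. a i j) = (\<Sum>i\<le>m. (\<Sum>j\<le>m. a i j) + a i (Suc m)) + (\<Sum>j\<le>m. a (Suc m) j) + a (Suc m) (Suc m)"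
    by simp
  also have "\<dots> = (\<Sum>i\<le>m. \<Sum>j\<le>m. a i j) + 2 * (\<Sum>j\<le>m. a (Suc m) j) + a (Suc m) (Suc m)"
  proof -
    have "(\<Sum>i\<le>m. a i (Suc m)) = (\<Sum>j\<le>m. a (Suc m) j)" by (intro sum.cong refl assms)
    then show ?thesis by (simp add: sum.distrib)
  qed
  finally show ?case using Suc by (simp add: lessThan_Suc_atMost)
qed simp

text \<open>The sum of the logarithms of the maximal products counts the kernel once for every
  unordered pair of points. Their growth therefore bounds the double average of the truncated kernel
  from below, and the diagonal is of lower order.\<close>

lemma leja_energy:
  assumes K: "compact K" and w: "\<And>i. w i \<in> K"
    and leja: "\<And>n z. z \<in> K \<Longrightarrow> (\<Prod>i<n. cmod (z - w i)) \<le> (\<Prod>i<n. cmod (w n - w i))"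
    and c: "0 < c" and big: "\<And>n. n \<ge> N \<Longrightarrow> c ^ n \<le> (\<Prod>i<n. cmod (w n - w i))"
  shows "\<exists>\<sigma>. prob_on K \<sigma> \<and> (\<forall>\<delta>>0. ln c \<le> trunc_energy \<sigma> \<delta>)"
proof -
  define M where "M n = (\<Prod>i<n. cmod (w n - w i))" for n
  have M0: "M n \<ge> 0" for n unfolding M_def by (intro prod_nonneg) auto
  \<comment> \<open>As w n is a maximizer, M n = 0 would make the product over i < n vanish on all
    of K. Every later point would then repeat an earlier one, contrary to
    \<open>big\<close>.\<close>
  have Mpos: "M n > 0" for n
  proof (rule ccontr)
    assume "\<not> M n > 0"
    then have z: "M n = 0" using M0[of n] by linarith
    define m where "m = max n N"
    have "(\<Prod>i<n. cmod (w m - w i)) \<le> 0" using leja[OF w[of m], of n] z unfolding M_def by linarith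
    moreover have "(\<Prod>i<n. cmod (w m - w i)) \<ge> 0" by (intro prod_nonneg) auto
    ultimately have "(\<Prod>i<n. cmod (w m - w i)) = 0" by linarith
    then obtain i where "i < n" "cmod (w m - w i) = 0" by auto
    then have "M m = 0" unfolding M_def by (intro prod_zero) (auto simp: m_def intro!: bexI[of _ i])
    moreover have "c ^ m \<le> M m" unfolding M_def by (rule big) (simp add: m_def)
    moreover have "0 < c ^ m" using c by simp
    ultimately show False by linarith
  qed
  have ne: "w n \<noteq> w i" if "i < n" for n i
  proof
    assume "w n = w i"
    then have "M n = 0" unfolding M_def using that by (intro prod_zero) auto
    then show False using Mpos[of n] by simp
  qed
  \<comment> \<open>Absorbs the finitely many indices below N, for which \<open>big\<close> says
    nothing; the total B disappears in the limit.\<close>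
  define b where "b n = (if n < N then \<bar>ln (M n)\<bar> + \<bar>n * ln c\<bar> else 0)" for n
  define B where "B = (\<Sum>n<N. b n)"
  have b0: "b n \<ge> 0" for n by (simp add: b_def)
  have lnM: "n * ln c - b n \<le> ln (M n)" for n
  proof (cases "n < N")
    case False
    then have "ln (c ^ n) \<le> ln (M n)" using big[of n] c Mpos[of n] by (intro ln_mono) (auto simp: M_def)
    then show ?thesis using c False by (simp add: ln_realpow b_def)
  qed (auto simp: b_def)
  have sb: "(\<Sum>n\<le>m. b n) \<le> B" for m
  proof -
    have "(\<Sum>n\<le>m. b n) = (\<Sum>n\<in>{..m} \<inter> {..<N}. b n)"
      by (intro sum.mono_neutral_right) (auto simp: b_def)
    also have "\<dots> \<le> B" unfolding B_def by (intro sum_mono2) (auto simp: b0)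
    finally show ?thesis .
  qed
  obtain s \<sigma> where s: "strict_mono s" "prob_on K \<sigma>"
    "\<forall>f. continuous_on UNIV f \<longrightarrow> (\<lambda>m. avg w (s m) f) \<longlonglongrightarrow> (\<integral>z. f z \<partial>\<sigma>)"
    using weak_limit[OF K, of w, OF w] by (elim exE conjE)
  have "ln c \<le> trunc_energy \<sigma> \<delta>" if d: "0 < \<delta>" for \<delta>
  proof -
    let ?E = "\<lambda>m. avg w m (\<lambda>z. avg w m (\<lambda>u. trunc_ln \<delta> (z - u)))"
    \<comment> \<open>The m + 1 diagonal terms are ln \<delta> each, and the other pairs give at
      least twice the sum of n ln c - b n. After division by (m + 1) squared only ln c survives in
      the limit.\<close>
    let ?l = "\<lambda>m. ln \<delta> / (real m + 1) + ln c * (real m / (real m + 1)) - 2 * B / (real m + 1)\<^sup>2"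
    have E: "?l m \<le> ?E m" for m
    proof -
      have "?E m = (\<Sum>i\<le>m. \<Sum>j\<le>m. trunc_ln \<delta> (w i - w j)) / (real m + 1)\<^sup>2"
        by (simp add: avg_def power2_eq_square sum_divide_distrib[symmetric] add.commute)
      also have "(\<Sum>i\<le>m. \<Sum>j\<le>m. trunc_ln \<delta> (w i - w j)) =
          (\<Sum>i\<le>m. trunc_ln \<delta> (w i - w i)) + 2 * (\<Sum>n\<le>m. \<Sum>i<n. trunc_ln \<delta> (w n - w i))"
        by (rule sum_symmetric) (rule trunc_ln_minus_commute)
      also have "(\<Sum>i\<le>m. trunc_ln \<delta> (w i - w i)) = (real m + 1) * ln \<delta>"
        using d by (simp add: trunc_ln_def add.commute)
      finally have 1: "?E m = ((real m + 1) * ln \<delta> + 2 * (\<Sum>n\<le>m. \<Sum>i<n. trunc_ln \<delta> (w n - w i))) / (real m + 1)\<^sup>2" .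
      have "(\<Sum>n\<le>m. real n * ln c - b n) \<le> (\<Sum>n\<le>m. \<Sum>i<n. trunc_ln \<delta> (w n - w i))"
      proof (rule sum_mono)
        fix n
        have "ln (M n) = (\<Sum>i<n. ln (cmod (w n - w i)))" unfolding M_def
          by (intro ln_prod) (use ne in auto)
        also have "\<dots> \<le> (\<Sum>i<n. trunc_ln \<delta> (w n - w i))"
          by (intro sum_mono trunc_ln_ge_ln d) (use ne in auto)
        finally show "real n * ln c - b n \<le> (\<Sum>i<n. trunc_ln \<delta> (w n - w i))" using lnM[of n] by linarith
      qed
      moreover have "(\<Sum>n\<le>m. real n * ln c - b n) = ln c * (real m * (real m + 1) / 2) - (\<Sum>n\<le>m. b n)"
      proof -
        have "(\<Sum>n\<le>m. real n) = real m * (real m + 1) / 2"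
          by (induction m) (auto simp: field_simps)
        then show ?thesis by (simp add: sum_subtractf sum_distrib_right[symmetric] mult.commute)
      qed
      ultimately have "ln c * (real m * (real m + 1) / 2) - B \<le> (\<Sum>n\<le>m. \<Sum>i<n. trunc_ln \<delta> (w n - w i))"
        using sb[of m] by linarith
      then have "((real m + 1) * ln \<delta> + 2 * (ln c * (real m * (real m + 1) / 2) - B)) / (real m + 1)\<^sup>2 \<le> ?E m"
        unfolding 1 by (intro divide_right_mono) auto
      moreover have "((real m + 1) * ln \<delta> + 2 * (ln c * (real m * (real m + 1) / 2) - B)) / (real m + 1)\<^sup>2 = ?l m"
      proof -
        have "(q * x + 2 * (y * (k * q / 2) - B)) / q\<^sup>2 = x / q + y * (k / q) - 2 * B / q\<^sup>2"
          if "q \<noteq> 0" for q x y k :: real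
        proof -
          have "q * x + 2 * (y * (k * q / 2) - B) = q * x + y * k * q - 2 * B" by (simp add: algebra_simps)
          then show ?thesis using that by (simp add: add_divide_distrib diff_divide_distrib power2_eq_square)
        qed
        from this[of "real m + 1" "ln \<delta>" "ln c" "real m"] show ?thesis by simp
      qed
      ultimately show ?thesis by simp
    qed
    have "?l \<longlonglongrightarrow> ln c" by real_asymp
    then have "(\<lambda>m. ?l (s m)) \<longlonglongrightarrow> ln c" using LIMSEQ_subseq_LIMSEQ[OF _ s(1), of ?l "ln c"] by (simp add: o_def)
    moreover have "(\<lambda>m. ?E (s m)) \<longlonglongrightarrow> trunc_energy \<sigma> \<delta>"
      by (rule double_avg_limit[where s = s, OF K w s(2,3) d])
    ultimately show ?thesis using E by (intro LIMSEQ_le[of "\<lambda>m. ?l (s m)" _ "\<lambda>m. ?E (s m)"]) auto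
  qed
  then show ?thesis using s(2) by blast
qed

text \<open>The last clause is what the Leja construction is used for, in two ways: with some c > 0
  it provides a measure of finite energy, and with c above the capacity its conclusion contradicts
  maximality, so that the polynomials must be small on K for infinitely many degrees.\<close>

definition leja_polys :: "complex set \<Rightarrow> (nat \<Rightarrow> complex poly) \<Rightarrow> bool" where
  "leja_polys K F \<longleftrightarrow> (\<forall>n. lead_coeff (F n) = 1 \<and> degree (F n) = n \<and> (\<forall>x. poly (F n) x = 0 \<longrightarrow> x \<in> K)) \<and>
    (\<forall>c>0. (\<exists>N. \<forall>n\<ge>N. \<exists>z\<in>K. c ^ n \<le> cmod (poly (F n) z)) \<longrightarrow>
       (\<exists>\<sigma>. prob_on K \<sigma> \<and> (\<forall>\<delta>>0. ln c \<le> trunc_energy \<sigma> \<delta>)))"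

lemma leja_polys_exists:
  assumes K: "compact K" "K \<noteq> {}"
  shows "\<exists>F. leja_polys K F"
proof -
  obtain w :: "nat \<Rightarrow> complex" where w': "\<forall>n. w n \<in> K \<and> (\<forall>z\<in>K. (\<Prod>i<n. cmod (z - w i)) \<le> (\<Prod>i<n. cmod (w n - w i)))"
    using leja_points[OF K] by (elim exE)
  have w: "w n \<in> K" "z \<in> K \<Longrightarrow> (\<Prod>i<n. cmod (z - w i)) \<le> (\<Prod>i<n. cmod (w n - w i))" for n z
    using w' by auto
  define F where "F n = (\<Prod>i<n. [:- w i, 1:])" for n
  have pF: "poly (F n) z = (\<Prod>i<n. z - w i)" for n z by (simp add: F_def poly_prod)
  have "lead_coeff (F n) = 1" for n by (simp only: F_def lead_coeff_prod) simp
  moreover have "degree (F n) = n" for n unfolding F_def by (subst degree_prod_eq_sum_degree) auto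
  moreover have "x \<in> K" if "poly (F n) x = 0" for n x using that w(1) by (auto simp: pF)
  moreover have "\<exists>\<sigma>. prob_on K \<sigma> \<and> (\<forall>\<delta>>0. ln c \<le> trunc_energy \<sigma> \<delta>)"
    if c: "0 < c" and N: "\<forall>n\<ge>N. \<exists>z\<in>K. c ^ n \<le> cmod (poly (F n) z)" for c N
  proof (rule leja_energy[OF K(1) w(1) w(2) c])
    fix n assume "N \<le> n"
    then obtain z where z: "z \<in> K" "c ^ n \<le> (\<Prod>i<n. cmod (z - w i))" using N by (auto simp: pF prod_norm)
    then show "c ^ n \<le> (\<Prod>i<n. cmod (w n - w i))" using w(2)[OF z(1), of n] by linarith
  qed auto
  ultimately show ?thesis by (intro exI[of _ F]) (auto simp: leja_polys_def)
qed

subsection \<open>Regular compact sets\<close>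

lemma unbounded_component_eq_outside:
  assumes "bounded K"
  shows "unbounded_component K = outside K"
proof -
  have "{C. C \<in> components (- K) \<and> \<not> bounded C} = {outside K}"
    using bounded_unique_outside[OF assms] by auto
  then show ?thesis unfolding unbounded_component_def by simp
qed

lemma poly_norm_bound:
  fixes P :: "complex poly"
  obtains C where "1 \<le> C" "\<And>x. 1 \<le> cmod x \<Longrightarrow> cmod (poly P x) \<le> C * cmod x ^ degree P"
proof -
  define C where "C = 1 + (\<Sum>i\<le>degree P. cmod (coeff P i))"
  have C: "1 \<le> C" unfolding C_def by (simp add: sum_nonneg)
  show ?thesis
  proof (rule that[OF C])
    fix x :: complex assume x: "1 \<le> cmod x"
    have "cmod (poly P x) \<le> (\<Sum>i\<le>degree P. cmod (coeff P i * x ^ i))"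
      unfolding poly_altdef by (rule norm_sum)
    also have "\<dots> \<le> (\<Sum>i\<le>degree P. cmod (coeff P i) * cmod x ^ degree P)"
      by (intro sum_mono) (auto simp: norm_mult norm_power intro!: mult_left_mono power_increasing x)
    also have "\<dots> = (C - 1) * cmod x ^ degree P" by (simp add: C_def sum_distrib_right)
    also have "\<dots> \<le> C * cmod x ^ degree P" by (intro mult_right_mono) auto
    finally show "cmod (poly P x) \<le> C * cmod x ^ degree P" .
  qed
qed

section \<open>The Bernstein-Walsh inequality\<close>

context equilibrium
begin

lemma norm_le_r: "w \<in> K \<Longrightarrow> cmod w \<le> r"
  using K(2) by auto

lemma logpot_growth:
  assumes S: "compact S" "S \<subseteq> K" "AE w in \<mu>. w \<in> S" and z: "r < cmod z"
  shows "ln (cmod z - r) \<le> logpot \<mu> S z"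
proof -
  have "measure \<mu> S = 1" using S by (subst prob_eq_1) (auto intro!: sets_borel borel_compact)
  moreover have "measure \<mu> S * ln (cmod z - r) \<le> logpot \<mu> S z"
  proof (rule logpot_lower[OF finite_measure_mu sets_nu S(1)])
    fix w assume "w \<in> S"
    then have "cmod w \<le> r" using S(2) norm_le_r by blast
    moreover have "cmod z \<le> cmod (z - w) + cmod w" using norm_triangle_ineq[of "z - w" w] by simp
    ultimately show "cmod z - r \<le> cmod (z - w)" by linarith
  qed (use z in simp)
  ultimately show ?thesis by simp
qed

text \<open>The factor \<open>1 + \<epsilon>\<close> makes the comparison function vanish at infinity.\<close>
lemma domination_aux:
  fixes P :: "complex poly"
  assumes S: "compact S" "S \<subseteq> K" "AE w in \<mu>. w \<in> S" and d: "0 < degree P"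
    and P: "\<And>w. w \<in> S \<Longrightarrow> cmod (poly P w) \<le> 1" and z: "z \<notin> S" and \<epsilon>: "0 < \<epsilon>" and \<eta>: "0 < \<eta>"
  shows "cmod (poly P z) * exp (- (real (degree P) * (1 + \<epsilon>) * (logpot \<mu> S z - I))) \<le> 1 + \<eta>"
proof -
  define d where "d = real (degree P)"
  have d0: "0 < d" using d by (simp add: d_def)
  define p where "p x = logpot \<mu> S x - I" for x
  have pnn: "0 \<le> p x" if "x \<notin> S" for x using logpot_ge[OF S(1,3) that] by (simp add: p_def)
  have pc: "continuous_on A p" if "A \<subseteq> - S" for A
    unfolding p_def
    by (intro continuous_intros continuous_on_subset[OF logpot_continuous[OF finite_measure_mu sets_nu S(1)] that])
  define \<psi> where "\<psi> x = cmod (poly P x) * exp (- (d * (1 + \<epsilon>) * p x))" for x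
  have ne: "S \<noteq> {}" by (rule AE_imp_nonempty[OF S(3)])
  have cS: "closed S" using S by (simp add: compact_imp_closed)
  have z0: "0 < infdist z S" using z cS ne by (simp add: infdist_pos_not_in_closed)
  have "closed {x. 1 + \<eta> \<le> cmod (poly P x)}" by (intro closed_Collect_le continuous_intros)
  moreover have "S \<inter> {x. 1 + \<eta> \<le> cmod (poly P x)} = {}" using P \<eta> by force
  ultimately obtain s0 where s0: "0 < s0" "\<forall>x\<in>S. \<forall>y\<in>{x. 1 + \<eta> \<le> cmod (poly P x)}. s0 \<le> dist x y"
    using separate_compact_closed[OF S(1)] by blast
  have near: "cmod (poly P x) \<le> 1 + \<eta>" if "infdist x S < s0" for x
  proof (rule ccontr)
    assume "\<not> ?thesis"
    then have x: "x \<in> {x. 1 + \<eta> \<le> cmod (poly P x)}" by simp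
    obtain y where y: "y \<in> S" "infdist x S = dist x y" using infdist_attains_inf[OF cS ne] by metis
    have "s0 \<le> dist y x" using s0(2) x y(1) by blast
    then show False using y(2) that by (simp add: dist_commute)
  qed
  obtain C where C: "1 \<le> C" "\<And>x. 1 \<le> cmod x \<Longrightarrow> cmod (poly P x) \<le> C * cmod x ^ degree P"
    using poly_norm_bound[of P] by metis
  define C' where "C' = C * 2 ^ degree P * exp (d * (1 + \<epsilon>) * I)"
  have C'0: "0 < C'" using C(1) by (simp add: C'_def)
  \<comment> \<open>On the circle of radius r + exp X the potential is at least X, while |P| is at
    most C (2 exp X) ^ degree P. The quotient \<psi> is then at most C' exp (-d \<epsilon> X), and X
    is taken large enough to make this at most 1.\<close>
  define X where "X = cmod z + r + 1 + max 0 (ln C' / (d * \<epsilon>))"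
  have X: "cmod z \<le> X" "r \<le> X" "1 \<le> X" "ln C' / (d * \<epsilon>) \<le> X"
    using r_nonneg norm_ge_zero[of z] unfolding X_def by linarith+
  define \<rho> where "\<rho> = r + exp X"
  have eX: "X \<le> exp X" using exp_ge_add_one_self[of X] by linarith
  have \<rho>: "cmod z \<le> \<rho>" "1 \<le> \<rho>" "r < \<rho>" "\<rho> \<le> 2 * exp X"
    using X eX r_nonneg exp_gt_zero[of X] unfolding \<rho>_def by linarith+
  \<comment> \<open>Less than s0, so that |P| \<le> 1 + \<eta> on the inner part of the frontier,
    and at most the distance of z, so that z lies in the domain.\<close>
  define s where "s = min (s0 / 2) (infdist z S)"
  have s: "0 < s" "s < s0" "s \<le> infdist z S" using s0(1) z0 by (auto simp: s_def)
  define D where "D = {x. s \<le> infdist x S} \<inter> cball 0 \<rho>"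
  have cl: "closed {x. s \<le> infdist x S}" by (intro closed_Collect_le continuous_intros)
  then have D: "compact D" unfolding D_def by (simp add: compact_Int_closed[OF compact_cball] inf_commute)
  have DS: "D \<subseteq> - S" using s by (auto simp: D_def)
  have "\<psi> z \<le> 1 + \<eta>"
  proof (rule compact_max_principle[OF D])
    show "continuous_on D \<psi>" unfolding \<psi>_def by (intro continuous_intros pc DS)
    show "z \<in> D" using s \<rho> by (simp add: D_def)
  next
    fix x assume xf: "x \<in> frontier D"
    then have "x \<in> D" using compact_imp_closed[OF D] by (auto simp: frontier_def)
    then have xS: "x \<notin> S" using DS by blast
    have "infdist x S = s \<or> cmod x = \<rho>"
      by (rule frontier_superlevel_cball[OF _ xf[unfolded D_def]]) (intro continuous_intros)
    then show "\<psi> x \<le> 1 + \<eta>"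
    proof
      assume "infdist x S = s"
      then have "cmod (poly P x) \<le> 1 + \<eta>" using near s by simp
      moreover have "exp (- (d * (1 + \<epsilon>) * p x)) \<le> 1" using pnn[OF xS] d0 \<epsilon> by simp
      ultimately have "\<psi> x \<le> (1 + \<eta>) * 1" unfolding \<psi>_def using \<eta> by (intro mult_mono) auto
      then show ?thesis by simp
    next
      assume x\<rho>: "cmod x = \<rho>"
      have "cmod (poly P x) \<le> C * \<rho> ^ degree P" using C(2)[of x] x\<rho> \<rho> by simp
      also have "\<dots> \<le> C * (2 * exp X) ^ degree P" using C(1) \<rho> by (intro mult_left_mono power_mono) auto
      also have "\<dots> = C * 2 ^ degree P * exp (d * X)"
        by (simp add: power_mult_distrib exp_of_nat_mult d_def)
      finally have 1: "cmod (poly P x) \<le> C * 2 ^ degree P * exp (d * X)" .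
      have "X = ln (cmod x - r)" by (simp add: x\<rho> \<rho>_def)
      also have "\<dots> \<le> logpot \<mu> S x" by (rule logpot_growth[OF S]) (use x\<rho> \<rho> in simp)
      finally have "X - I \<le> p x" by (simp add: p_def)
      then have "exp (- (d * (1 + \<epsilon>) * p x)) \<le> exp (- (d * (1 + \<epsilon>) * (X - I)))" using d0 \<epsilon> by simp
      then have "\<psi> x \<le> C * 2 ^ degree P * exp (d * X) * exp (- (d * (1 + \<epsilon>) * (X - I)))"
        unfolding \<psi>_def using 1 C(1) by (intro mult_mono) auto
      also have "\<dots> = C' * exp (- (d * \<epsilon> * X))"
        by (simp add: C'_def exp_add[symmetric] algebra_simps)
      also have "\<dots> \<le> 1"
      proof -
        have "ln C' \<le> d * \<epsilon> * X" using X(4) d0 \<epsilon> by (simp add: field_simps)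
        then have "C' \<le> exp (d * \<epsilon> * X)" using C'0 by (metis exp_le_cancel_iff exp_ln)
        then show ?thesis by (simp add: exp_minus field_simps)
      qed
      finally show ?thesis using \<eta> by simp
    qed
  next
    fix x assume x: "x \<in> interior D" and big: "1 + \<eta> < \<psi> x" and mx: "\<And>y. y \<in> D \<Longrightarrow> \<psi> y \<le> \<psi> x"
    have Px: "poly P x \<noteq> 0" using big \<eta> by (auto simp: \<psi>_def)
    have "open (interior D \<inter> {y. poly P y \<noteq> 0})"
      by (intro open_Int open_interior open_Collect_neq continuous_intros)
    then obtain e where e: "0 < e" "ball x e \<subseteq> interior D \<inter> {y. poly P y \<noteq> 0}"
      using x Px open_contains_ball by blast
    have eD: "ball x e \<subseteq> D" "ball x e \<subseteq> - S" using e(2) interior_subset[of D] DS by blast+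
    have eP: "poly P y \<noteq> 0" if "y \<in> ball x e" for y using e(2) that by blast
    \<comment> \<open>Where \<psi> exceeds 1 + \<eta>, P does not vanish, and on a small ball free
      of zeros ln \<psi> is a combination of functions with the mean value property.\<close>
    define v where "v y = ln (cmod (poly P y)) - d * (1 + \<epsilon>) * p y" for y
    have ev: "\<psi> y = exp (v y)" if "y \<in> ball x e" for y
      using eP[OF that] by (simp add: \<psi>_def v_def exp_diff exp_minus divide_inverse)
    have xe: "x \<in> ball x e" using e(1) by simp
    have vc: "continuous_on (ball x e) v" unfolding v_def
      by (intro continuous_intros pc eD(2)) (use eP in auto)
    show "\<exists>e>0. \<forall>y\<in>ball x e. \<psi> y = \<psi> x"
    proof (intro exI[of _ e] conjI ballI e(1))
      fix y assume y: "y \<in> ball x e"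
      have "v y = v x"
      proof (rule local_const_of_mean[OF vc _ _ y])
        show "v u \<le> v x" if "u \<in> ball x e" for u
        proof -
          have "u \<in> D" using that eD(1) by blast
          then have "exp (v u) \<le> exp (v x)" using mx[of u] unfolding ev[OF that] ev[OF xe] by simp
          then show ?thesis by simp
        qed
        fix t assume t: "0 < t" "t < e"
        then have tb: "cball x t \<subseteq> ball x e" by auto
        have tS: "cball x t \<inter> S = {}" using tb eD(2) by blast
        have sph: "sphere x (cmod (of_real t)) \<subseteq> ball x e" using t by auto
        have c1: "continuous_on (sphere x (cmod (of_real t))) (\<lambda>y. ln (cmod (poly P y)))"
          by (intro continuous_intros) (use eP sph in auto)
        have c2: "continuous_on (sphere x (cmod (of_real t))) p" using pc sph eD(2) by blast
        have c3: "continuous_on (sphere x (cmod (of_real t))) (logpot \<mu> S)"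
          using continuous_on_add[OF c2 continuous_on_const[of _ I]] by (simp add: p_def)
        have "circle_mean (\<lambda>y. ln (cmod (poly P y))) x (of_real t) = ln (cmod (poly P x))"
        proof (rule circle_mean_ln_poly_eq)
          fix y assume "y \<in> cball x (cmod (of_real t))"
          then have "y \<in> ball x e" using tb t by auto
          then show "poly P y \<noteq> 0" by (rule eP)
        qed
        moreover have "circle_mean p x (of_real t) = p x"
          unfolding p_def using c3 logpot_mean_eq[OF finite_measure_mu sets_nu S(1) tS t(1)]
          by (subst circle_mean_diff) auto
        ultimately show "v x \<le> circle_mean v x (of_real t)"
          unfolding v_def using c1 c2 by (subst circle_mean_diff) (auto simp: circle_mean_scale intro!: continuous_intros)
      qed
      then show "\<psi> y = \<psi> x" using ev[OF y] ev[OF xe] by simp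
    qed
  qed
  then show ?thesis by (simp add: \<psi>_def p_def d_def)
qed

text \<open>Both tolerances of \<open>domination_aux\<close> are sent to 0 together. The bound on P
  is asked for on a compact set carrying \<mu> rather than on K, since an extremal polynomial is at
  first controlled only there.\<close>

lemma domination:
  fixes P :: "complex poly"
  assumes S: "compact S" "S \<subseteq> K" "AE w in \<mu>. w \<in> S" and d: "0 < degree P"
    and P: "\<And>w. w \<in> S \<Longrightarrow> cmod (poly P w) \<le> 1" and z: "z \<notin> S" "poly P z \<noteq> 0"
  shows "ln (cmod (poly P z)) / real (degree P) \<le> logpot \<mu> S z - I"
proof -
  let ?d = "real (degree P)" and ?p = "logpot \<mu> S z - I"
  have "((\<lambda>\<epsilon>. cmod (poly P z) * exp (- (?d * (1 + \<epsilon>) * ?p)) - \<epsilon>) \<longlongrightarrow> cmod (poly P z) * exp (- (?d * (1 + 0) * ?p)) - 0) (at_right 0)"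
    by (intro tendsto_intros)
  moreover have "eventually (\<lambda>\<epsilon>. cmod (poly P z) * exp (- (?d * (1 + \<epsilon>) * ?p)) - \<epsilon> \<le> 1) (at_right 0)"
    unfolding eventually_at_right_field
  proof (intro exI[of _ 1] conjI allI impI)
    fix \<epsilon> :: real assume "0 < \<epsilon>"
    then show "cmod (poly P z) * exp (- (?d * (1 + \<epsilon>) * ?p)) - \<epsilon> \<le> 1"
      using domination_aux[OF S d P z(1), of \<epsilon> \<epsilon>] by simp
  qed simp
  ultimately have "cmod (poly P z) * exp (- (?d * (1 + 0) * ?p)) - 0 \<le> 1"
    by (rule tendsto_upperbound) simp
  then have 1: "cmod (poly P z) * exp (- (?d * ?p)) \<le> 1" by simp
  have aux: "a \<le> exp b" if "a * exp (- b) \<le> 1" for a b :: real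
    using that by (simp add: exp_minus field_simps)
  have "ln (cmod (poly P z)) \<le> ln (exp (?d * ?p))" using z(2) aux[OF 1] by (intro ln_mono) auto
  then have "ln (cmod (poly P z)) \<le> ?d * ?p" by simp
  then show ?thesis using d by (simp add: field_simps)
qed

end

section \<open>The Green function of a regular compact set\<close>

locale regular_equilibrium = equilibrium +
  fixes F :: "nat \<Rightarrow> complex poly"
  assumes reg: "regular_compact K" and F: "leja_polys K F"
begin

definition \<Omega> :: "complex set" where "\<Omega> = unbounded_component K"

text \<open>Regularity makes the supremum finite, so passing to real numbers loses nothing.\<close>

definition g :: "complex \<Rightarrow> real" where "g z = real_of_ereal (green_infty K z)"

text \<open>The classical Green function, normalized by the Robin constant. It is evaluated only off
  K, where the kernel is bounded.\<close>

definition p :: "complex \<Rightarrow> real" where "p z = logpot \<mu> K z - I"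

lemma bounded_K: "bounded K" using K(1) by (rule compact_imp_bounded)

lemma \<Omega>_eq: "\<Omega> = outside K"
  unfolding \<Omega>_def by (rule unbounded_component_eq_outside[OF bounded_K])

lemma open_\<Omega>: "open \<Omega>"
  unfolding \<Omega>_eq by (intro open_outside compact_imp_closed K)

lemma connected_\<Omega>: "connected \<Omega>"
  unfolding \<Omega>_eq by (intro connected_outside bounded_K) simp

lemma \<Omega>_disjoint: "\<Omega> \<inter> K = {}"
  unfolding \<Omega>_eq outside_def by auto

lemma frontier_\<Omega>: "frontier \<Omega> \<subseteq> K"
  unfolding \<Omega>_eq by (intro frontier_outside_subset compact_imp_closed K)

lemma bounded_compl_\<Omega>: "bounded (- \<Omega>)"
  unfolding \<Omega>_eq by (intro cobounded_outside bounded_K)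

lemma green_le:
  fixes P :: "complex poly"
  assumes "0 < degree P" "\<And>w. w \<in> K \<Longrightarrow> cmod (poly P w) \<le> 1" "poly P z \<noteq> 0"
  shows "ln (cmod (poly P z)) / real (degree P) \<le> g z"
proof -
  have "ereal (ln (cmod (poly P z)) / real (degree P)) \<le> green_infty K z"
    unfolding green_infty_def using assms by (intro Sup_upper) (auto intro!: exI[of _ P])
  moreover have "green_infty K z < \<infinity>" using reg by (simp add: regular_compact_def)
  ultimately show ?thesis unfolding g_def by (cases "green_infty K z") auto
qed

lemma green_nonneg: "0 \<le> g z"
proof -
  have "0 \<le> green_infty K z" unfolding green_infty_def by (rule Sup_upper) simp
  then show ?thesis unfolding g_def by (rule real_of_ereal_pos)
qed

lemma green_least:
  assumes "0 \<le> B" "\<And>P :: complex poly. 0 < degree P \<Longrightarrow> (\<And>w. w \<in> K \<Longrightarrow> cmod (poly P w) \<le> 1) \<Longrightarrow>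
    poly P z \<noteq> 0 \<Longrightarrow> ln (cmod (poly P z)) / real (degree P) \<le> B"
  shows "g z \<le> B"
proof -
  have "green_infty K z \<le> ereal B"
    unfolding green_infty_def using assms by (intro Sup_least) auto
  moreover have "0 \<le> green_infty K z" unfolding green_infty_def by (rule Sup_upper) simp
  ultimately show ?thesis unfolding g_def by (cases "green_infty K z") auto
qed

lemma green_K:
  assumes "z \<in> K"
  shows "g z = 0"
proof -
  have "g z \<le> 0"
  proof (rule green_least)
    fix P :: "complex poly"
    assume P: "0 < degree P" "\<And>w. w \<in> K \<Longrightarrow> cmod (poly P w) \<le> 1" "poly P z \<noteq> 0"
    then have "ln (cmod (poly P z)) \<le> ln 1" using assms by (intro ln_mono) auto
    then show "ln (cmod (poly P z)) / real (degree P) \<le> 0" by (simp add: divide_nonpos_nonneg)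
  qed simp
  then show ?thesis using green_nonneg[of z] by linarith
qed

lemma continuous_g: "continuous_on A g"
  using reg continuous_on_subset[of UNIV g A] by (simp add: regular_compact_def g_def[abs_def])

lemma p_nonneg: "z \<notin> K \<Longrightarrow> 0 \<le> p z"
  using logpot_ge[OF K(1) AE_K] by (simp add: p_def)

lemma continuous_p: "A \<subseteq> - K \<Longrightarrow> continuous_on A p"
  unfolding p_def
  by (intro continuous_intros continuous_on_subset[OF logpot_continuous[OF finite_measure_mu sets_nu K(1)]])

lemma continuous_logpot_K: "A \<subseteq> - K \<Longrightarrow> continuous_on A (logpot \<mu> K)"
  by (rule continuous_on_subset[OF logpot_continuous[OF finite_measure_mu sets_nu K(1)]])

lemma p_mean:
  assumes "cball z t \<inter> K = {}" "0 < t"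
  shows "circle_mean p z (of_real t) = p z"
proof -
  have "sphere z (cmod (of_real t)) \<subseteq> - K" using assms by auto
  then show ?thesis
    unfolding p_def using logpot_mean_eq[OF finite_measure_mu sets_nu K(1) assms] continuous_logpot_K
    by (subst circle_mean_diff) auto
qed

lemma p_mean_large:
  assumes "r < \<rho>"
  shows "circle_mean p 0 (of_real \<rho>) = ln \<rho> - I"
proof -
  have Kb: "K \<subseteq> ball 0 \<rho>" using K(2) assms by auto
  have "measure \<mu> K = 1" using AE_K by (subst prob_eq_1) (auto intro!: sets_borel K_borel)
  then have "circle_mean (logpot \<mu> K) 0 (of_real \<rho>) = ln \<rho>"
    using logpot_mean_large[OF finite_measure_mu sets_nu K(1) Kb] assms r_nonneg by simp
  moreover have "sphere 0 (cmod (of_real \<rho>)) \<subseteq> - K" using Kb assms r_nonneg by auto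
  ultimately show ?thesis unfolding p_def using continuous_logpot_K by (subst circle_mean_diff) auto
qed

lemma large_in_\<Omega>:
  obtains R where "r < R" "0 < R" "\<And>z. R \<le> cmod z \<Longrightarrow> z \<in> \<Omega>"
proof -
  obtain R where R: "\<forall>x\<in>- \<Omega>. cmod x \<le> R" using bounded_compl_\<Omega> by (auto simp: bounded_iff)
  show ?thesis
  proof (rule that[of "\<bar>R\<bar> + r + 1"])
    fix z assume "\<bar>R\<bar> + r + 1 \<le> cmod z"
    then have "R < cmod z" using r_nonneg by linarith
    then show "z \<in> \<Omega>" using R by force
  qed (use r_nonneg in auto)
qed

text \<open>The mean of p over a large circle is exactly ln \<rho> - I, so p - f is nonnegative with
  mean at most 0 and vanishes there. Off K p has the mean value property, so p - f satisfies the
  reversed mean inequality and its zeros spread over the connected \<Omega>. It is applied to the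
  Green function and to ln (max 1 |R|) / d.\<close>

lemma eq_p_on_\<Omega>:
  assumes f: "continuous_on UNIV f" and le: "\<And>z. z \<in> \<Omega> \<Longrightarrow> f z \<le> p z"
    and sm: "\<And>z t. f z \<le> circle_mean f z (of_real t)"
    and large: "\<exists>R0. \<forall>\<rho>\<ge>R0. ln \<rho> - I \<le> circle_mean f 0 (of_real \<rho>)" and z: "z \<in> \<Omega>"
  shows "f z = p z"
proof -
  obtain R0 where R0: "\<And>\<rho>. \<rho> \<ge> R0 \<Longrightarrow> ln \<rho> - I \<le> circle_mean f 0 (of_real \<rho>)" using large by blast
  obtain R where R: "r < R" "0 < R" "\<And>z. R \<le> cmod z \<Longrightarrow> z \<in> \<Omega>" using large_in_\<Omega> by metis
  define \<rho> where "\<rho> = max R R0"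
  have \<rho>: "r < \<rho>" "0 < \<rho>" "R \<le> \<rho>" "R0 \<le> \<rho>" using R by (auto simp: \<rho>_def)
  have cf: "continuous_on A f" for A using continuous_on_subset[OF f] by blast
  have \<Omega>K: "A \<subseteq> - K" if "A \<subseteq> \<Omega>" for A using that \<Omega>_disjoint by blast
  have cp: "continuous_on A p" if "A \<subseteq> \<Omega>" for A using continuous_p[OF \<Omega>K[OF that]] .
  have sph: "sphere 0 (cmod (of_real \<rho>)) \<subseteq> \<Omega>" using R(3) \<rho> by auto
  define x0 :: complex where "x0 = of_real \<rho>"
  have x0: "x0 \<in> sphere 0 (cmod (of_real \<rho>))" by (simp add: x0_def)
  have px0: "p x0 - f x0 = 0"
  proof (rule circle_mean_nonpos_imp_zero[of 0 "of_real \<rho>" "\<lambda>x. p x - f x", OF _ _ _ x0])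
    show "continuous_on (sphere 0 (cmod (of_real \<rho>))) (\<lambda>x. p x - f x)"
      by (intro continuous_intros cp cf sph)
    show "0 \<le> p x - f x" if "x \<in> sphere 0 (cmod (of_real \<rho>))" for x using le[of x] sph that by auto
    have "circle_mean (\<lambda>x. p x - f x) 0 (of_real \<rho>) = circle_mean p 0 (of_real \<rho>) - circle_mean f 0 (of_real \<rho>)"
      by (intro circle_mean_diff cp cf sph)
    then show "circle_mean (\<lambda>x. p x - f x) 0 (of_real \<rho>) \<le> 0" using p_mean_large[OF \<rho>(1)] R0[OF \<rho>(4)] by simp
  qed
  have x0\<Omega>: "x0 \<in> \<Omega>" using x0 sph by blast
  have "p z - f z = 0"
  proof (rule supermean_zero_propagates[where v = "\<lambda>x. p x - f x", OF open_\<Omega> connected_\<Omega> _ _ _ x0\<Omega> px0 z])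
    show "continuous_on \<Omega> (\<lambda>x. p x - f x)" by (intro continuous_intros cp cf order_refl)
    show "0 \<le> p x - f x" if "x \<in> \<Omega>" for x using le[OF that] by simp
    fix x t assume x: "x \<in> \<Omega>" and t: "0 < t" "cball x t \<subseteq> \<Omega>" and 0: "p x - f x = 0"
    have s2: "sphere x (cmod (of_real t)) \<subseteq> \<Omega>" using t by auto
    have "cball x t \<inter> K = {}" using t(2) \<Omega>_disjoint by blast
    then have "circle_mean (\<lambda>x. p x - f x) x (of_real t) = p x - circle_mean f x (of_real t)"
      using p_mean[of x t] t(1) circle_mean_diff[OF cp[OF s2] cf] by simp
    then show "circle_mean (\<lambda>x. p x - f x) x (of_real t) \<le> 0" using sm[of x t] 0 by simp
  qed
  then show ?thesis by simp
qed

text \<open>If all large \<open>F n\<close> exceeded this bound somewhere on \<open>K\<close>, the limiting measure of the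
  Leja points would have larger energy integral than \<open>\<mu>\<close>.\<close>
lemma F_small:
  assumes "0 < \<epsilon>"
  shows "\<exists>n\<ge>N. \<forall>z\<in>K. cmod (poly (F n) z) \<le> exp ((I + \<epsilon>) * real n)"
proof (rule ccontr)
  assume neg: "\<not> ?thesis"
  have "\<exists>z\<in>K. exp (I + \<epsilon>) ^ n \<le> cmod (poly (F n) z)" if "N \<le> n" for n
  proof -
    have "\<exists>z\<in>K. \<not> cmod (poly (F n) z) \<le> exp ((I + \<epsilon>) * real n)" using neg that by blast
    then obtain z where "z \<in> K" "exp ((I + \<epsilon>) * real n) \<le> cmod (poly (F n) z)" by force
    moreover have "exp ((I + \<epsilon>) * real n) = exp (I + \<epsilon>) ^ n" by (simp add: exp_of_nat2_mult)
    ultimately show ?thesis by auto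
  qed
  then have "\<exists>N. \<forall>n\<ge>N. \<exists>z\<in>K. exp (I + \<epsilon>) ^ n \<le> cmod (poly (F n) z)" by blast
  then obtain \<sigma> where "prob_on K \<sigma>" "\<forall>\<delta>>0. ln (exp (I + \<epsilon>)) \<le> trunc_energy \<sigma> \<delta>"
    using F unfolding leja_polys_def by (meson exp_gt_zero)
  then have "I + \<epsilon> \<le> I" by (intro maximal) auto
  then show False using assms by simp
qed

lemma F_props: "lead_coeff (F n) = 1" "degree (F n) = n" "poly (F n) x = 0 \<Longrightarrow> x \<in> K"
  using F unfolding leja_polys_def by blast+

text \<open>Each competitor ln (max 1 |P|) / degree P satisfies the mean inequality and lies below g
  on the circle; the supremum over P is taken at the centre only.\<close>

lemma g_submean: "g z \<le> circle_mean g z (of_real t)"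
proof (rule green_least)
  have "circle_mean (\<lambda>_. 0) z (of_real t) \<le> circle_mean g z (of_real t)"
    by (intro circle_mean_mono continuous_g continuous_on_const green_nonneg)
  then show "0 \<le> circle_mean g z (of_real t)" by simp
  fix P :: "complex poly"
  assume P: "0 < degree P" "\<And>w. w \<in> K \<Longrightarrow> cmod (poly P w) \<le> 1" "poly P z \<noteq> 0"
  have le: "ln (max 1 (cmod (poly P x))) \<le> real (degree P) * g x" for x
  proof (cases "cmod (poly P x) \<le> 1")
    case True
    then show ?thesis using green_nonneg[of x] by (simp add: max_def)
  next
    case False
    then have "poly P x \<noteq> 0" by auto
    from green_le[OF P(1,2) this] show ?thesis using False P(1) by (simp add: max_def field_simps)
  qed
  have cu: "continuous_on A (\<lambda>x. ln (max 1 (cmod (poly P x))))" for A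
    by (intro continuous_intros continuous_on_max) (auto simp: less_max_iff_disj max_def)
  have "ln (cmod (poly P z)) \<le> ln (max 1 (cmod (poly P z)))" using P(3) by (intro ln_mono) auto
  also have "\<dots> \<le> circle_mean (\<lambda>x. ln (max 1 (cmod (poly P x)))) z (of_real t)" by (rule ln_max_poly_submean)
  also have "\<dots> \<le> circle_mean (\<lambda>x. real (degree P) * g x) z (of_real t)"
    by (intro circle_mean_mono cu le continuous_intros continuous_g)
  finally show "ln (cmod (poly P z)) / real (degree P) \<le> circle_mean g z (of_real t)"
    using P(1) by (simp add: circle_mean_scale field_simps)
qed

text \<open>A Leja polynomial scaled by exp (-(I + \<epsilon>) n) competes in the definition of g.
  Its zeros lie in K, inside the circle, so by Jensen's formula its normalized logarithm has mean ln
  \<rho> - I - \<epsilon>.\<close>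

lemma g_mean_large:
  assumes "r < \<rho>"
  shows "ln \<rho> - I \<le> circle_mean g 0 (of_real \<rho>)"
proof (rule field_le_epsilon)
  fix \<epsilon> :: real assume \<epsilon>: "0 < \<epsilon>"
  obtain n where n: "n \<ge> 1" "\<forall>z\<in>K. cmod (poly (F n) z) \<le> exp ((I + \<epsilon>) * real n)"
    using F_small[OF \<epsilon>] by blast
  define P where "P = smult (of_real (exp (- ((I + \<epsilon>) * real n)))) (F n)"
  have dP: "degree P = n" by (simp add: P_def F_props)
  have Pz: "poly P x = 0 \<longleftrightarrow> poly (F n) x = 0" for x by (simp add: P_def)
  have rho0: "0 < \<rho>" using assms r_nonneg by linarith
  have nz: "poly P x \<noteq> 0" if "x \<in> sphere 0 (cmod (of_real \<rho>))" for x :: complex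
  proof
    assume "poly P x = 0"
    then have "cmod x \<le> r" using F_props(3)[of n x] norm_le_r by (simp add: Pz)
    then show False using that assms rho0 by simp
  qed
  have PK: "cmod (poly P w) \<le> 1" if "w \<in> K" for w
  proof -
    let ?E = "(I + \<epsilon>) * real n"
    have "cmod (poly P w) = exp (- ?E) * cmod (poly (F n) w)" by (simp add: P_def norm_mult)
    also have "\<dots> \<le> exp (- ?E) * exp ?E" using n(2) that by (intro mult_left_mono) auto
    also have "\<dots> = 1" by (simp only: exp_minus_inverse mult.commute)
    finally show ?thesis .
  qed
  have "circle_mean (\<lambda>x. ln (cmod (poly P x))) 0 (of_real \<rho>) = ln (cmod (lead_coeff P)) + degree P * ln (cmod (of_real \<rho>))"
  proof (rule circle_mean_ln_poly_large)
    show "P \<noteq> 0" using dP n(1) by auto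
    fix x assume "poly P x = 0"
    then have "cmod x \<le> r" using F_props(3)[of n x] norm_le_r by (simp add: Pz)
    then show "cmod (0 - x) < cmod (of_real \<rho>)" using assms rho0 by simp
  qed
  also have "lead_coeff P = of_real (exp (- ((I + \<epsilon>) * real n)))"
    using F_props(1)[of n] by (simp add: P_def)
  finally have 1: "circle_mean (\<lambda>x. ln (cmod (poly P x))) 0 (of_real \<rho>) = real n * (ln \<rho> - I - \<epsilon>)"
    using rho0 by (simp add: dP algebra_simps)
  have "circle_mean (\<lambda>x. ln (cmod (poly P x))) 0 (of_real \<rho>) \<le> circle_mean (\<lambda>x. real n * g x) 0 (of_real \<rho>)"
  proof (rule circle_mean_mono)
    show "continuous_on (sphere 0 (cmod (of_real \<rho>))) (\<lambda>x. ln (cmod (poly P x)))"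
      by (intro continuous_intros) (use nz in auto)
    show "continuous_on (sphere 0 (cmod (of_real \<rho>))) (\<lambda>x. real n * g x)"
      by (intro continuous_intros continuous_g)
    fix x :: complex assume "x \<in> sphere 0 (cmod (of_real \<rho>))"
    from green_le[OF _ PK nz[OF this]] show "ln (cmod (poly P x)) \<le> real n * g x"
      using n(1) by (simp add: dP field_simps)
  qed
  then have "real n * (ln \<rho> - I - \<epsilon>) \<le> real n * circle_mean g 0 (of_real \<rho>)" by (simp add: 1 circle_mean_scale)
  then show "ln \<rho> - I \<le> circle_mean g 0 (of_real \<rho>) + \<epsilon>" using n(1) by simp
qed

lemma g_eq_p:
  assumes "z \<in> \<Omega>"
  shows "g z = p z"
proof (rule eq_p_on_\<Omega>[OF continuous_g _ g_submean _ assms])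
  show "\<exists>R0. \<forall>\<rho>\<ge>R0. ln \<rho> - I \<le> circle_mean g 0 (of_real \<rho>)"
    using g_mean_large by (intro exI[of _ "r + 1"]) auto
  fix z assume "z \<in> \<Omega>"
  then have z: "z \<notin> K" using \<Omega>_disjoint by blast
  show "g z \<le> p z"
    by (rule green_least[OF p_nonneg[OF z]]) (unfold p_def, rule domination[OF K(1) order_refl AE_K _ _ z])
qed

lemma p_large: "r < cmod z \<Longrightarrow> ln (cmod z - r) - I \<le> p z"
  using logpot_growth[OF K(1) order_refl AE_K] by (simp add: p_def)

text \<open>A zero of p would spread over \<Omega>, but p grows like ln |z| at infinity.\<close>

lemma p_pos:
  assumes z: "z \<in> \<Omega>"
  shows "0 < p z"
proof (rule ccontr)
  assume neg: "\<not> 0 < p z"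
  have nn: "0 \<le> p x" if "x \<in> \<Omega>" for x using that \<Omega>_disjoint p_nonneg by blast
  have pz: "p z = 0" using neg nn[OF z] by simp
  obtain R where R: "r < R" "0 < R" "\<And>z. R \<le> cmod z \<Longrightarrow> z \<in> \<Omega>" using large_in_\<Omega> by metis
  \<comment> \<open>Far enough out that |x| - r \<ge> exp (I + 1), which forces p x \<ge> 1; the
    summand R keeps x in \<Omega>.\<close>
  define x :: complex where "x = of_real (R + exp (I + 1))"
  have cx: "cmod x = R + exp (I + 1)" unfolding x_def using R(2) by (simp only: norm_of_real) (simp add: add_pos_pos)
  have e0: "0 < exp (I + 1)" by simp
  have x: "x \<in> \<Omega>" by (rule R(3)) (use cx e0 in linarith)
  have x': "exp (I + 1) \<le> cmod x - r" "r < cmod x" using cx e0 R(1) by linarith+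
  have "p x = 0"
  proof (rule supermean_zero_propagates[where v = p, OF open_\<Omega> connected_\<Omega> _ nn _ z pz x])
    show "continuous_on \<Omega> p" by (rule continuous_p) (use \<Omega>_disjoint in blast)
    fix y t assume "0 < t" "cball y t \<subseteq> \<Omega>" "p y = 0"
    moreover from this have "cball y t \<inter> K = {}" using \<Omega>_disjoint by blast
    ultimately show "circle_mean p y (of_real t) \<le> 0" using p_mean by simp
  qed
  moreover have "ln (exp (I + 1)) \<le> ln (cmod x - r)" using x' by (intro ln_mono) auto
  ultimately show False using p_large[OF x'(2)] by simp
qed

lemma norm_le_off_\<Omega>:
  fixes R :: "complex poly"
  assumes fr: "\<And>z. z \<in> frontier \<Omega> \<Longrightarrow> cmod (poly R z) \<le> 1" and z: "z \<notin> \<Omega>"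
  shows "cmod (poly R z) \<le> 1"
proof (rule maximum_modulus_frontier[of "poly R" "- \<Omega>" 1 z])
  show "poly R holomorphic_on interior (- \<Omega>)" by (intro holomorphic_intros)
  show "continuous_on (closure (- \<Omega>)) (poly R)" by (intro continuous_intros)
  show "cmod (poly R w) \<le> 1" if "w \<in> frontier (- \<Omega>)" for w using fr that by (simp add: frontier_complement)
qed (use z bounded_compl_\<Omega> in auto)

text \<open>The aim is ln (max 1 |R|) / d = p on \<Omega>: the upper bound is the Bernstein-Walsh
  inequality, the leading coefficient supplies the mean over large circles. Positivity of p then
  gives |R| > 1 on \<Omega>, and vanishing of the Green function on K gives |R| \<le> 1 on the
  frontier.\<close>

lemma frontier_eq_lemniscate:
  fixes R :: "complex poly"
  assumes d: "0 < degree R" and lc: "cmod (lead_coeff R) = exp (- (real (degree R) * I))"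
    and AE: "AE w in \<mu>. cmod (poly R w) = 1"
  shows "frontier \<Omega> = {z. cmod (poly R z) = 1}"
proof -
  define d where "d = real (degree R)"
  have d0: "0 < d" using d by (simp add: d_def)
  \<comment> \<open>The modulus is known only almost everywhere, so R is compared with the potential
    on this compact set of full measure instead of on K.\<close>
  define S where "S = K \<inter> {z. cmod (poly R z) = 1}"
  have "closed {z. cmod (poly R z) = 1}" by (intro closed_Collect_eq continuous_intros)
  then have S: "compact S" "S \<subseteq> K" "AE w in \<mu>. w \<in> S"
    using K(1) AE_K AE unfolding S_def by (auto intro: compact_Int_closed elim: eventually_elim2)
  define f where "f z = ln (max 1 (cmod (poly R z))) / d" for z
  have cu: "continuous_on A (\<lambda>x. ln (max 1 (cmod (poly R x))))" for A
    by (intro continuous_intros continuous_on_max) (auto simp: less_max_iff_disj max_def)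
  have cf: "continuous_on A f" for A unfolding f_def using d0 by (intro continuous_intros cu) auto
  have fscale: "circle_mean f z t = circle_mean (\<lambda>x. ln (max 1 (cmod (poly R x)))) z t / d" for z t
    using circle_mean_scale[of "1 / d" "\<lambda>x. ln (max 1 (cmod (poly R x)))"] by (simp add: f_def[abs_def])
  have fp: "f z = p z" if "z \<in> \<Omega>" for z
  proof (rule eq_p_on_\<Omega>[OF cf _ _ _ that])
    show "f z \<le> circle_mean f z (of_real t)" for z t
      unfolding fscale f_def using d0 by (intro divide_right_mono ln_max_poly_submean) auto
    fix z assume "z \<in> \<Omega>"
    then have zK: "z \<notin> K" using \<Omega>_disjoint by blast
    then have zS: "z \<notin> S" using S(2) by blast
    show "f z \<le> p z"
    proof (cases "cmod (poly R z) \<le> 1")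
      case True
      then have "f z = 0" by (simp add: f_def max_def)
      then show ?thesis using p_nonneg[OF zK] by simp
    next
      case False
      then have "poly R z \<noteq> 0" by auto
      have "ln (cmod (poly R z)) / real (degree R) \<le> logpot \<mu> S z - I"
        by (rule domination[OF S d _ zS \<open>poly R z \<noteq> 0\<close>]) (simp add: S_def)
      also have "logpot \<mu> S z = logpot \<mu> K z" unfolding logpot_def
      proof (rule integral_cong_AE)
        show "AE x in \<mu>. indicator S x * ln (cmod (z - x)) = indicator K x * ln (cmod (z - x))"
          using S(3) AE_K by eventually_elim (auto simp: indicator_def)
      qed (use logpot_integrable[OF finite_measure_mu sets_nu] S(1) K(1) zS zK in auto)
      finally show ?thesis using False by (simp add: f_def p_def d_def max_def)
    qed
  next
    show "\<exists>R0. \<forall>\<rho>\<ge>R0. ln \<rho> - I \<le> circle_mean f 0 (of_real \<rho>)"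
    proof -
      have R0: "R \<noteq> 0" using d by auto
      have "bounded {x. poly R x = 0}" using poly_roots_finite[OF R0] by (rule finite_imp_bounded)
      then obtain B where B: "\<forall>x\<in>{x. poly R x = 0}. cmod x \<le> B" by (auto simp: bounded_iff)
      show ?thesis
      proof (intro exI[of _ "\<bar>B\<bar> + 1"] allI impI)
        fix \<rho> assume rho: "\<bar>B\<bar> + 1 \<le> \<rho>"
        have rts: "cmod x < \<rho>" if "poly R x = 0" for x
        proof -
          have "cmod x \<le> B" using B that by blast
          then show ?thesis using rho by linarith
        qed
        have "circle_mean (\<lambda>x. ln (cmod (poly R x))) 0 (of_real \<rho>) = ln (cmod (lead_coeff R)) + degree R * ln (cmod (of_real \<rho>))"
          using rts rho by (intro circle_mean_ln_poly_large R0) auto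
        then have 1: "circle_mean (\<lambda>x. ln (cmod (poly R x))) 0 (of_real \<rho>) = d * (ln \<rho> - I)"
          using rho by (simp add: lc d_def algebra_simps)
        have nz: "poly R x \<noteq> 0" if "x \<in> sphere 0 (cmod (of_real \<rho>))" for x :: complex
          using rts[of x] that rho by auto
        have "circle_mean (\<lambda>x. ln (cmod (poly R x))) 0 (of_real \<rho>) \<le> circle_mean (\<lambda>x. ln (max 1 (cmod (poly R x)))) 0 (of_real \<rho>)"
        proof (rule circle_mean_mono[OF _ cu])
          show "continuous_on (sphere 0 (cmod (of_real \<rho>))) (\<lambda>x. ln (cmod (poly R x)))"
            by (intro continuous_intros) (use nz in auto)
          show "ln (cmod (poly R x)) \<le> ln (max 1 (cmod (poly R x)))" if "x \<in> sphere 0 (cmod (of_real \<rho>))" for x :: complex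
            using nz[OF that] by (intro ln_mono) auto
        qed
        then show "ln \<rho> - I \<le> circle_mean f 0 (of_real \<rho>)"
          unfolding fscale using 1 d0 by (simp add: field_simps)
      qed
    qed
  qed
  \<comment> \<open>Regularity enters here: f and g are continuous on the whole plane, so their
    equality on \<Omega> extends to the frontier, where g = 0.\<close>
  have fg: "f z = g z" if "z \<in> closure \<Omega>" for z
  proof -
    have "f z - g z = 0"
    proof (rule continuous_constant_on_closure[of \<Omega> "\<lambda>z. f z - g z" 0 z])
      show "continuous_on (closure \<Omega>) (\<lambda>z. f z - g z)" by (intro continuous_intros cf continuous_g)
      show "f x - g x = 0" if "x \<in> \<Omega>" for x using fp[OF that] g_eq_p[OF that] by simp
    qed (rule that)
    then show ?thesis by simp
  qed
  have big: "1 < cmod (poly R z)" if "z \<in> \<Omega>" for z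
  proof (rule ccontr)
    assume "\<not> ?thesis"
    then have "f z = 0" by (simp add: f_def max_def)
    then show False using fp[OF that] p_pos[OF that] by simp
  qed
  have le: "cmod (poly R z) \<le> 1" if "z \<in> frontier \<Omega>" for z
  proof (rule ccontr)
    assume neg: "\<not> ?thesis"
    have "z \<in> closure \<Omega>" using that by (simp add: frontier_def)
    moreover have "g z = 0" using that frontier_\<Omega> by (intro green_K) blast
    ultimately have "ln (cmod (poly R z)) = 0" using fg[of z] neg d0 by (simp add: f_def max_def)
    moreover have "0 < ln (cmod (poly R z))" using neg by (intro ln_gt_zero) simp
    ultimately show False by simp
  qed
  have ge: "1 \<le> cmod (poly R z)" if "z \<in> closure \<Omega>" for z
  proof (rule continuous_ge_on_closure[of \<Omega> "\<lambda>z. cmod (poly R z)" z 1])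
    show "continuous_on (closure \<Omega>) (\<lambda>z. cmod (poly R z))" by (intro continuous_intros)
    show "1 \<le> cmod (poly R x)" if "x \<in> \<Omega>" for x using big[OF that] by simp
  qed (rule that)
  show ?thesis
  proof (intro equalityI subsetI)
    fix z assume z: "z \<in> frontier \<Omega>"
    then have "z \<in> closure \<Omega>" by (simp add: frontier_def)
    then show "z \<in> {z. cmod (poly R z) = 1}" using le[OF z] ge by force
  next
    fix z assume "z \<in> {z. cmod (poly R z) = 1}"
    then have z: "cmod (poly R z) = 1" by simp
    show "z \<in> frontier \<Omega>"
    proof (rule ccontr)
      assume nf: "z \<notin> frontier \<Omega>"
      have "z \<notin> \<Omega>" using big[of z] z by auto
      then have zi: "z \<in> interior (- \<Omega>)"
        using nf frontier_complement[of \<Omega>] closure_subset[of "- \<Omega>"] unfolding frontier_def by blast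
      \<comment> \<open>Off \<Omega> the modulus of R is at most 1; attaining 1 at an interior point
        of the complement forces R to be constant.\<close>
      have "poly R constant_on UNIV"
      proof (rule maximum_modulus_principle[of "poly R" UNIV "interior (- \<Omega>)" z])
        fix w assume "w \<in> interior (- \<Omega>)"
        then have "w \<notin> \<Omega>" using interior_subset by blast
        then show "cmod (poly R w) \<le> cmod (poly R z)" using norm_le_off_\<Omega>[OF le] z by simp
      qed (use zi in \<open>auto intro!: holomorphic_intros\<close>)
      then obtain c where "\<And>x. poly R x = c" unfolding constant_on_def by blast
      then have "poly R = poly [:c:]" by auto
      then have "R = [:c:]" by (simp only: poly_eq_poly_eq_iff)
      then show False using d by simp
    qed
  qed
qed

text \<open>Compare \<open>P ^ (d * k)\<close> with \<open>R ^ (m * k + 1)\<close>: the quotient vanishes at infinity.\<close>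
lemma poly_le_lemniscate:
  fixes P R :: "complex poly"
  assumes d: "0 < degree R" and m: "0 < degree P" and fr: "frontier \<Omega> = {z. cmod (poly R z) = 1}"
    and P: "\<And>w. w \<in> K \<Longrightarrow> cmod (poly P w) \<le> 1" and z: "1 \<le> cmod (poly R z)" "poly P z \<noteq> 0"
  shows "ln (cmod (poly P z)) / real (degree P) \<le> ln (cmod (poly R z)) / real (degree R)"
proof -
  let ?d = "degree R" and ?m = "degree P"
  have pw: "cmod (poly P z) ^ (?d * k) \<le> cmod (poly R z) ^ (?m * k + 1)" for k
  proof -
    define A where "A = P ^ (?d * k)"
    define B where "B = R ^ (?m * k + 1)"
    have R0: "R \<noteq> 0" "P \<noteq> 0" using d m by auto
    have "degree A = ?m * (?d * k)" unfolding A_def using R0 by (simp add: degree_power_eq)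
    moreover have "degree B = ?d * (?m * k + 1)"
      using degree_power_eq[OF R0(1), of "?m * k + 1"] by (simp only: B_def mult.commute)
    ultimately have "degree A < degree B" using d by (simp add: algebra_simps)
    then have "((\<lambda>x. poly A x / poly B x) \<longlongrightarrow> 0) at_infinity" by (rule poly_divide_tendsto_0_at_infinity)
    then have "eventually (\<lambda>x. dist (poly A x / poly B x) 0 < 1) at_infinity" by (rule tendstoD) simp
    then obtain b where b: "\<forall>x. b \<le> norm x \<longrightarrow> dist (poly A x / poly B x) 0 < 1"
      unfolding eventually_at_infinity by blast
    define \<rho> where "\<rho> = \<bar>b\<bar> + cmod z + 1"
    have rho: "b \<le> \<rho>" "cmod z < \<rho>" unfolding \<rho>_def using norm_ge_zero[of z] by linarith+
    define D where "D = {x. 1 \<le> cmod (poly R x)} \<inter> cball 0 \<rho>"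
    have "closed {x. 1 \<le> cmod (poly R x)}" by (intro closed_Collect_le continuous_intros)
    then have D: "closed D" "bounded D" unfolding D_def by auto
    have nz: "poly B x \<noteq> 0" if "x \<in> D" for x using that by (auto simp: D_def B_def)
    have "cmod (poly A z / poly B z) \<le> 1"
    proof (rule maximum_modulus_frontier[of "\<lambda>x. poly A x / poly B x" D 1 z])
      show "(\<lambda>x. poly A x / poly B x) holomorphic_on interior D"
        using nz interior_subset by (intro holomorphic_intros) blast
      show "continuous_on (closure D) (\<lambda>x. poly A x / poly B x)"
        using nz D(1) by (intro continuous_intros) auto
      show "z \<in> D" using z rho by (simp add: D_def)
      fix x assume xf: "x \<in> frontier D"
      have "cmod (poly R x) = 1 \<or> cmod x = \<rho>"
        by (rule frontier_superlevel_cball[OF _ xf[unfolded D_def]]) (intro continuous_intros)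
      then show "cmod (poly A x / poly B x) \<le> 1"
      proof
        assume 1: "cmod (poly R x) = 1"
        then have "x \<in> K" using fr frontier_\<Omega> by blast
        then show ?thesis using P[of x] 1 by (simp add: A_def B_def norm_divide norm_power norm_mult power_le_one)
      next
        assume "cmod x = \<rho>"
        then have "dist (poly A x / poly B x) 0 < 1" using b rho by simp
        then show ?thesis by simp
      qed
    qed (rule D(2))
    moreover have "0 < cmod (poly B z)" using z by (auto simp: B_def)
    ultimately have "cmod (poly A z) \<le> cmod (poly B z)" by (simp add: norm_divide)
    then show ?thesis by (simp add: A_def B_def norm_power norm_mult)
  qed
  let ?p = "ln (cmod (poly P z))" and ?r = "ln (cmod (poly R z))"
  \<comment> \<open>Logarithms are taken and divided by the exponent parameter, which is
    \<open>Suc k\<close> to be nonzero; the surplus factor of R fades as k grows.\<close>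
  have lim: "real ?d * ?p \<le> (real ?m + 1 / real (Suc k)) * ?r" for k
  proof -
    have "ln (cmod (poly P z) ^ (?d * Suc k)) \<le> ln (cmod (poly R z) ^ (?m * Suc k + 1))"
      using pw[of "Suc k"] z by (intro ln_mono) auto
    then have "real (?d * Suc k) * ?p \<le> real (?m * Suc k + 1) * ?r"
      using z by (simp add: ln_realpow del: of_nat_Suc of_nat_mult of_nat_add mult_Suc_right power_Suc)
    moreover have "real (?d * Suc k) * ?p = real (Suc k) * (real ?d * ?p)" by (simp only: of_nat_mult mult_ac)
    moreover have "real (?m * Suc k + 1) * ?r = real (Suc k) * ((real ?m + 1 / real (Suc k)) * ?r)"
    proof -
      have "b * ((a + 1 / b) * c) = (a * b + 1) * c" if "b \<noteq> 0" for a b c :: real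
        using that by (simp add: field_simps)
      from this[of "real (Suc k)" "real ?m" ?r] show ?thesis by (simp only: of_nat_add of_nat_mult of_nat_1)
    qed
    ultimately have "real (Suc k) * (real ?d * ?p) \<le> real (Suc k) * ((real ?m + 1 / real (Suc k)) * ?r)"
      by (simp only:)
    then show ?thesis by (simp only: mult_le_cancel_left_pos of_nat_0_less_iff zero_less_Suc)
  qed
  have "(\<lambda>k. (real ?m + 1 / real (Suc k)) * ?r) \<longlonglongrightarrow> (real ?m + 0) * ?r"
    by (intro tendsto_intros LIMSEQ_Suc[OF lim_1_over_n])
  then have "real ?d * ?p \<le> (real ?m + 0) * ?r"
    by (rule LIMSEQ_le_const) (use lim in blast)
  then show ?thesis using d m by (simp add: field_simps)
qed

text \<open>By \<open>poly_le_lemniscate\<close>, ln |R| / d majorizes the Green function far out,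
  and the latter is at least ln (|z| - r) - I. Exponentiating and dividing by |z| ^ d leaves finite
  limits on both sides at infinity.\<close>

lemma lemniscate_lead_coeff:
  fixes R :: "complex poly"
  assumes d: "0 < degree R" and fr: "frontier \<Omega> = {z. cmod (poly R z) = 1}"
  shows "exp (- (real (degree R) * I)) \<le> cmod (lead_coeff R)"
proof -
  let ?d = "degree R"
  obtain R0 where R0: "r < R0" "0 < R0" "\<And>z. R0 \<le> cmod z \<Longrightarrow> z \<in> \<Omega>" using large_in_\<Omega> by metis
  have "filterlim (poly R) at_infinity at_infinity" by (rule filterlim_poly_at_infinity[OF d])
  then have e1: "eventually (\<lambda>z. 1 \<le> cmod (poly R z)) at_infinity"
    using filterlim_at_infinity[of 0 "poly R"] by auto
  have e2: "eventually (\<lambda>z. R0 \<le> cmod z) at_infinity" unfolding eventually_at_infinity by blast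
  have ev: "eventually (\<lambda>z. exp (- (real ?d * I)) * (1 - r / cmod z) ^ ?d \<le> cmod (poly R z / z ^ ?d)) at_infinity"
    using e1 e2
  proof eventually_elim
    case (elim z)
    have z: "z \<in> \<Omega>" "r < cmod z" "0 < cmod z" using R0 elim r_nonneg by (auto intro!: R0(3))
    have zK: "z \<notin> K" using z \<Omega>_disjoint by blast
    have "ln (cmod z - r) - I \<le> p z" by (rule p_large[OF z(2)])
    also have "\<dots> = g z" using g_eq_p[OF z(1)] by simp
    also have "\<dots> \<le> ln (cmod (poly R z)) / real ?d"
    proof (rule green_least)
      have "0 \<le> ln (cmod (poly R z))" using elim by simp
      then show "0 \<le> ln (cmod (poly R z)) / real ?d" by simp
    qed (rule poly_le_lemniscate[OF d _ fr _ elim(1)])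
    finally have "real ?d * (ln (cmod z - r) - I) \<le> ln (cmod (poly R z))" using d by (simp add: field_simps)
    then have "exp (real ?d * (ln (cmod z - r) - I)) \<le> exp (ln (cmod (poly R z)))" by simp
    also have "exp (ln (cmod (poly R z))) = cmod (poly R z)" using elim by (intro exp_ln) linarith
    also have "exp (real ?d * (ln (cmod z - r) - I)) = exp (- (real ?d * I)) * exp (real ?d * ln (cmod z - r))"
      by (simp add: exp_add[symmetric] algebra_simps)
    also have "exp (real ?d * ln (cmod z - r)) = (cmod z - r) ^ ?d" using z by (simp add: exp_of_nat_mult)
    finally have 1: "exp (- (real ?d * I)) * (cmod z - r) ^ ?d \<le> cmod (poly R z)" .
    have "(cmod z - r) ^ ?d = (1 - r / cmod z) ^ ?d * cmod z ^ ?d"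
      using z by (simp add: power_mult_distrib[symmetric] field_simps)
    then have "exp (- (real ?d * I)) * (1 - r / cmod z) ^ ?d * cmod z ^ ?d \<le> cmod (poly R z)" using 1 by simp
    then show ?case using z by (simp add: norm_divide norm_power field_simps)
  qed
  have t1: "((\<lambda>z. cmod (poly R z / z ^ ?d)) \<longlongrightarrow> cmod (lead_coeff R)) at_infinity"
    by (intro tendsto_norm poly_divide_tendsto_aux)
  have "((\<lambda>z::complex. r / cmod z) \<longlongrightarrow> 0) at_infinity"
    by (rule tendsto_divide_0[OF tendsto_const]) (simp add: filterlim_norm_at_top filterlim_at_top_imp_at_infinity)
  then have "((\<lambda>z::complex. exp (- (real ?d * I)) * (1 - r / cmod z) ^ ?d) \<longlongrightarrow> exp (- (real ?d * I)) * (1 - 0) ^ ?d) at_infinity"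
    by (intro tendsto_intros)
  from tendsto_le[OF _ t1 this ev] show ?thesis by (simp add: trivial_limit_at_infinity)
qed

end

subsection \<open>Monic polynomials in the space of square integrable functions\<close>

context bounded_prob
begin

lemma integrable_continuous_bounded:
  fixes f :: "complex \<Rightarrow> 'b :: {banach, second_countable_topology}"
  assumes f: "continuous_on UNIV f"
  shows "integrable \<nu> f"
proof -
  have "bounded (f ` cball 0 r)"
    by (intro compact_imp_bounded compact_continuous_image continuous_on_subset[OF f]) auto
  then obtain B where "\<forall>y\<in>f ` cball 0 r. norm y \<le> B" unfolding bounded_iff by blast
  then have B: "\<And>x. x \<in> cball 0 r \<Longrightarrow> norm (f x) \<le> B" by blast
  show ?thesis
  proof (rule integrable_const_bound[of _ B])
    show "AE x in \<nu>. norm (f x) \<le> B" using AE_bounded by eventually_elim (rule B, simp)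
    show "f \<in> borel_measurable \<nu>" by (intro borel_measurable_nu borel_measurable_continuous_onI f)
  qed
qed

definition ip :: "complex poly \<Rightarrow> complex poly \<Rightarrow> complex" where
  "ip P Q = (\<integral>z. poly P z * cnj (poly Q z) \<partial>\<nu>)"

lemma ip_integrable: "integrable \<nu> (\<lambda>z. poly P z * cnj (poly Q z))"
  by (intro integrable_continuous_bounded continuous_intros)

lemma norm_sq_integrable: "integrable \<nu> (\<lambda>z. (cmod (poly P z))\<^sup>2)"
  by (intro integrable_continuous_bounded continuous_intros)

lemma ip_add_left: "ip (P + P') Q = ip P Q + ip P' Q"
  unfolding ip_def by (simp add: distrib_right Bochner_Integration.integral_add ip_integrable)

lemma ip_diff_left: "ip (P - P') Q = ip P Q - ip P' Q"
  unfolding ip_def by (simp add: left_diff_distrib Bochner_Integration.integral_diff ip_integrable)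

lemma ip_smult_left: "ip (smult c P) Q = c * ip P Q"
  unfolding ip_def by (simp add: mult.assoc)

lemma ip_zero_left [simp]: "ip 0 Q = 0"
  by (simp add: ip_def)

lemma ip_sum_left: "ip (\<Sum>k\<in>A. P k) Q = (\<Sum>k\<in>A. ip (P k) Q)"
  by (induction A rule: infinite_finite_induct) (auto simp: ip_add_left)

lemma ip_cnj: "ip Q P = cnj (ip P Q)"
proof -
  have "cnj (ip P Q) = (\<integral>z. cnj (poly P z * cnj (poly Q z)) \<partial>\<nu>)"
    unfolding ip_def by (rule Bochner_Integration.integral_cnj[symmetric])
  then show ?thesis by (simp add: ip_def mult.commute)
qed

lemma ip_add_right: "ip P (Q + Q') = ip P Q + ip P Q'"
  by (simp add: ip_cnj[of P "Q + Q'"] ip_cnj[of P Q] ip_cnj[of P Q'] ip_add_left)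

lemma ip_smult_right: "ip P (smult c Q) = cnj c * ip P Q"
  by (simp add: ip_cnj[of P "smult c Q"] ip_cnj[of P Q] ip_smult_left)

lemma ip_self: "ip P P = of_real (\<integral>z. (cmod (poly P z))\<^sup>2 \<partial>\<nu>)"
  unfolding ip_def complex_norm_square[symmetric] by (rule integral_complex_of_real)

text \<open>Gram-Schmidt applied to the monomial of degree d and the orthogonal polynomials of lower
  degree; positivity of the norms is what allows the divisions.\<close>

lemma orthogonal_poly_exists:
  assumes pos: "\<And>P. lead_coeff P = 1 \<Longrightarrow> 0 < (\<integral>z. (cmod (poly P z))\<^sup>2 \<partial>\<nu>)"
  shows "\<exists>Q. lead_coeff Q = 1 \<and> degree Q = d \<and> (\<forall>s. degree s < d \<longrightarrow> ip Q s = 0)"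
proof (induction d rule: less_induct)
  case (less d)
  then have "\<forall>k. \<exists>Q. k < d \<longrightarrow> lead_coeff Q = 1 \<and> degree Q = k \<and> (\<forall>s. degree s < k \<longrightarrow> ip Q s = 0)" by blast
  from choice[OF this] obtain q :: "nat \<Rightarrow> complex poly" where
    q0: "\<forall>k. k < d \<longrightarrow> lead_coeff (q k) = 1 \<and> degree (q k) = k \<and> (\<forall>s. degree s < k \<longrightarrow> ip (q k) s = 0)" by blast
  have q: "lead_coeff (q k) = 1" "degree (q k) = k" "\<And>s. degree s < k \<Longrightarrow> ip (q k) s = 0" if "k < d" for k
    using q0 that by blast+
  have qq: "ip (q k) (q k) \<noteq> 0" if "k < d" for k
    using pos[OF q(1)[OF that]] by (simp add: ip_self)
  have qo: "ip (q k) (q j) = 0" if "k < d" "j < d" "k \<noteq> j" for k j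
  proof (cases "j < k")
    case True then show ?thesis using q(3)[OF that(1), of "q j"] q(2)[OF that(2)] by simp
  next
    case False
    then have "ip (q j) (q k) = 0" using q(3)[OF that(2), of "q k"] q(2)[OF that(1)] that by simp
    then show ?thesis using ip_cnj[of "q k" "q j"] by simp
  qed
  define c where "c k = ip (monom 1 d) (q k) / ip (q k) (q k)" for k
  define T where "T = (\<Sum>k<d. smult (c k) (q k))"
  define Q where "Q = monom 1 d - T"
  have cT: "coeff T i = 0" if "d \<le> i" for i
    unfolding T_def coeff_sum
  proof (rule sum.neutral, rule ballI)
    fix k assume "k \<in> {..<d}"
    then have "degree (q k) < i" using q(2)[of k] that by auto
    then show "coeff (smult (c k) (q k)) i = 0" by (simp add: coeff_eq_0)
  qed
  have "coeff Q d = 1" using cT[of d] by (simp add: Q_def)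
  moreover have "degree Q \<le> d"
    by (rule degree_le) (simp add: Q_def cT)
  ultimately have dQ: "degree Q = d" by (metis le_antisym le_degree zero_neq_one)
  have lQ: "lead_coeff Q = 1" using \<open>coeff Q d = 1\<close> by (simp add: dQ)
  have Qq: "ip Q (q j) = 0" if j: "j < d" for j
  proof -
    have "ip T (q j) = (\<Sum>k<d. c k * ip (q k) (q j))" unfolding T_def by (simp add: ip_sum_left ip_smult_left)
    also have "\<dots> = (\<Sum>k<d. if k = j then c j * ip (q j) (q j) else 0)"
      by (intro sum.cong refl) (use qo j in auto)
    also have "\<dots> = ip (monom 1 d) (q j)" using j qq[OF j] by (simp add: c_def)
    finally show ?thesis by (simp add: Q_def ip_diff_left)
  qed
  have "ip Q s = 0" if "degree s < m" "m \<le> d" for s m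
    using that
  proof (induction m arbitrary: s)
    case (Suc m)
    \<comment> \<open>Since q m is monic of degree m, this removes the coefficient at m and lowers
      the degree bound by one. The zero polynomial is treated apart because its degree is 0.\<close>
    define s' where "s' = s - smult (coeff s m) (q m)"
    have m: "m < d" using Suc.prems by simp
    have "coeff s' i = 0" if "m \<le> i" for i
    proof (cases "i = m")
      case True
      then show ?thesis using q(1,2)[OF m] by (simp add: s'_def)
    next
      case False
      then show ?thesis using q(2)[OF m] that Suc.prems by (simp add: s'_def coeff_eq_0)
    qed
    then have "s' = 0 \<or> degree s' < m" by (metis leading_coeff_0_iff not_le)
    then have "ip Q s' = 0"
    proof
      assume "s' = 0" then show ?thesis by (simp add: ip_def)
    qed (use Suc.IH Suc.prems in simp)
    moreover have "s = s' + smult (coeff s m) (q m)" by (simp add: s'_def)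
    ultimately show ?case by (metis Qq[OF m] add.right_neutral ip_add_right ip_smult_right mult_zero_right)
  qed simp
  then show ?case using lQ dQ by blast
qed

end

lemma prod_list_max_exp:
  assumes "0 < \<delta>"
  shows "(\<Prod>w\<leftarrow>ws. max \<delta> (cmod (z - w))) = exp (\<Sum>w\<leftarrow>ws. trunc_ln \<delta> (z - w))"
proof (induction ws)
  case (Cons a ws)
  have "0 < max \<delta> (cmod (z - a))" using assms by (simp add: less_max_iff_disj)
  then show ?case using Cons by (simp add: exp_add trunc_ln_def)
qed simp

lemma tendsto_prod_list_max:
  assumes "(\<delta> \<longlongrightarrow> (0::real)) G"
  shows "((\<lambda>n. \<Prod>w\<leftarrow>ws. max (\<delta> n) (cmod (z - w))) \<longlongrightarrow> (\<Prod>w\<leftarrow>ws. cmod (z - w))) G"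
proof (induction ws)
  case (Cons a ws)
  have "((\<lambda>n. max (\<delta> n) (cmod (z - a))) \<longlongrightarrow> max 0 (cmod (z - a))) G"
    by (intro tendsto_max assms tendsto_const)
  from tendsto_mult[OF this Cons.IH] show ?case by (simp add: max_def)
qed simp

section \<open>Norms of monic polynomials in one variable\<close>

context equilibrium
begin

text \<open>Jensen's inequality for the truncated logarithms of the linear factors.\<close>
lemma integral_norm_monic_ge:
  fixes P :: "complex poly"
  assumes "lead_coeff P = 1"
  shows "exp (real (degree P) * I) \<le> (\<integral>z. cmod (poly P z) \<partial>\<mu>)"
proof -
  have "P \<noteq> 0" using assms by auto
  from poly_split[OF this] obtain ws where ws: "P = smult (lead_coeff P) (\<Prod>w\<leftarrow>ws. [:- w, 1:])"
    "length ws = degree P" by metis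
  have Pws: "poly P z = (\<Prod>w\<leftarrow>ws. z - w)" for z
    by (subst ws(1)) (simp add: assms poly_prod_roots)
  have nP: "cmod (poly P z) = (\<Prod>w\<leftarrow>ws. cmod (z - w))" for z
    unfolding Pws by (induction ws) (auto simp: norm_mult)
  define T where "T \<delta> z = (\<Prod>w\<leftarrow>ws. max \<delta> (cmod (z - w)))" for \<delta> z
  have Tc: "continuous_on UNIV (T \<delta>)" for \<delta>
    unfolding T_def by (induction ws) (auto intro!: continuous_intros)
  have Ti: "integrable \<mu> (T \<delta>)" for \<delta> by (rule integrable_continuous_bounded[OF Tc])
  have low: "exp (real (degree P) * I) \<le> (\<integral>z. T \<delta> z \<partial>\<mu>)" if d: "0 < \<delta>" for \<delta>
  proof -
    define m where "m = (\<Sum>w\<leftarrow>ws. trunc_pot \<mu> \<delta> w)"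
    have kc: "continuous_on UNIV (\<lambda>z. \<Sum>w\<leftarrow>ws. trunc_ln \<delta> (z - w))"
      by (induction ws) (auto intro!: continuous_intros d)
    have ki: "integrable \<mu> (\<lambda>z. \<Sum>w\<leftarrow>ws. trunc_ln \<delta> (z - w))" by (rule integrable_continuous_bounded[OF kc])
    have im: "(\<integral>z. (\<Sum>w\<leftarrow>us. trunc_ln \<delta> (z - w)) \<partial>\<mu>) = (\<Sum>w\<leftarrow>us. trunc_pot \<mu> \<delta> w)" for us
    proof (induction us)
      case (Cons a us)
      have "integrable \<mu> (\<lambda>z. trunc_ln \<delta> (z - a))" using trunc_ln_integrable[OF d, of a] by (simp add: trunc_ln_minus_commute[of \<delta> a])
      moreover have "continuous_on UNIV (\<lambda>z. \<Sum>w\<leftarrow>us. trunc_ln \<delta> (z - w))"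
        by (induction us) (auto intro!: continuous_intros d)
      then have "integrable \<mu> (\<lambda>z. \<Sum>w\<leftarrow>us. trunc_ln \<delta> (z - w))" by (rule integrable_continuous_bounded)
      moreover have "(\<integral>z. trunc_ln \<delta> (z - a) \<partial>\<mu>) = trunc_pot \<mu> \<delta> a"
        unfolding trunc_pot_def by (simp add: trunc_ln_minus_commute[of \<delta> a])
      ultimately show ?case using Cons by (simp add: Bochner_Integration.integral_add)
    qed simp
    have "real (length ws) * I \<le> m"
      unfolding m_def by (induction ws) (use frostman[OF d] in \<open>auto simp: algebra_simps intro!: add_mono\<close>)
    then have "exp (real (degree P) * I) \<le> exp m" using ws(2) by simp
    \<comment> \<open>Jensen's inequality in tangent form: the integrand is the tangent of exp at
      the mean m, which lies below exp and has integral exp m.\<close>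
    also have "\<dots> = (\<integral>z. exp m * (1 + ((\<Sum>w\<leftarrow>ws. trunc_ln \<delta> (z - w)) - m)) \<partial>\<mu>)"
      using ki im[of ws] by (simp add: Bochner_Integration.integral_add Bochner_Integration.integral_diff m_def)
    also have "\<dots> \<le> (\<integral>z. T \<delta> z \<partial>\<mu>)"
    proof (rule integral_mono)
      show "integrable \<mu> (\<lambda>z. exp m * (1 + ((\<Sum>w\<leftarrow>ws. trunc_ln \<delta> (z - w)) - m)))" using ki by simp
      fix z
      have "exp m * (1 + ((\<Sum>w\<leftarrow>ws. trunc_ln \<delta> (z - w)) - m)) \<le> exp m * exp ((\<Sum>w\<leftarrow>ws. trunc_ln \<delta> (z - w)) - m)"
        by (intro mult_left_mono exp_ge_add_one_self) auto
      also have "\<dots> = T \<delta> z" unfolding T_def prod_list_max_exp[OF d] by (simp add: exp_add[symmetric])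
      finally show "exp m * (1 + ((\<Sum>w\<leftarrow>ws. trunc_ln \<delta> (z - w)) - m)) \<le> T \<delta> z" .
    qed (rule Ti)
    finally show ?thesis .
  qed
  have "(\<lambda>n. \<integral>z. T (1 / real (Suc n)) z \<partial>\<mu>) \<longlonglongrightarrow> (\<integral>z. cmod (poly P z) \<partial>\<mu>)"
  proof (rule integral_dominated_convergence[where w = "T 1"])
    show "(\<lambda>z. cmod (poly P z)) \<in> borel_measurable \<mu>" "T (1 / real (Suc n)) \<in> borel_measurable \<mu>" for n
      by (intro borel_measurable_nu borel_measurable_continuous_onI Tc continuous_intros)+
    show "AE z in \<mu>. (\<lambda>n. T (1 / real (Suc n)) z) \<longlonglongrightarrow> cmod (poly P z)"
      unfolding T_def nP by (intro AE_I2 tendsto_prod_list_max LIMSEQ_Suc[OF lim_1_over_n])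
    show "AE z in \<mu>. norm (T (1 / real (Suc n)) z) \<le> T 1 z" for n
    proof (rule AE_I2)
      fix z
      have d: "0 < 1 / real (Suc n)" "1 / real (Suc n) \<le> 1" by (auto simp: field_simps)
      have "(\<Sum>w\<leftarrow>ws. trunc_ln (1 / real (Suc n)) (z - w)) \<le> (\<Sum>w\<leftarrow>ws. trunc_ln 1 (z - w))"
        by (intro sum_list_mono trunc_ln_mono d)
      then show "norm (T (1 / real (Suc n)) z) \<le> T 1 z"
        unfolding T_def prod_list_max_exp[OF d(1)] prod_list_max_exp[OF zero_less_one] by simp
    qed
  qed (rule Ti)
  then show ?thesis
    by (rule LIMSEQ_le_const) (use low in \<open>auto intro!: exI[of _ 0]\<close>)
qed

lemma integral_norm_sq_monic:
  fixes P :: "complex poly"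
  assumes "lead_coeff P = 1"
  shows "(exp (real (degree P) * I))\<^sup>2 \<le> (\<integral>z. (cmod (poly P z))\<^sup>2 \<partial>\<mu>)"
    and "(\<integral>z. (cmod (poly P z))\<^sup>2 \<partial>\<mu>) = (exp (real (degree P) * I))\<^sup>2 \<Longrightarrow>
      AE z in \<mu>. cmod (poly P z) = exp (real (degree P) * I)"
proof -
  define c where "c = exp (real (degree P) * I)"
  have c: "0 < c" by (simp add: c_def)
  define q where "q = (\<integral>z. (cmod (poly P z))\<^sup>2 \<partial>\<mu>)"
  have i1: "integrable \<mu> (\<lambda>z. cmod (poly P z))" by (intro integrable_continuous_bounded continuous_intros)
  have eq: "(\<integral>z. (cmod (poly P z) - c)\<^sup>2 \<partial>\<mu>) = q - 2 * c * (\<integral>z. cmod (poly P z) \<partial>\<mu>) + c\<^sup>2"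
  proof -
    have "(\<integral>z. (cmod (poly P z) - c)\<^sup>2 \<partial>\<mu>) = (\<integral>z. (cmod (poly P z))\<^sup>2 - 2 * c * cmod (poly P z) + c\<^sup>2 \<partial>\<mu>)"
      by (intro Bochner_Integration.integral_cong refl) (simp add: power2_diff)
    also have "\<dots> = q - 2 * c * (\<integral>z. cmod (poly P z) \<partial>\<mu>) + c\<^sup>2"
      unfolding q_def using i1 norm_sq_integrable[of P]
      by (simp add: Bochner_Integration.integral_add Bochner_Integration.integral_diff)
    finally show ?thesis .
  qed
  have "c * c \<le> c * (\<integral>z. cmod (poly P z) \<partial>\<mu>)"
    using integral_norm_monic_ge[OF assms] c by (intro mult_left_mono) (auto simp: c_def)
  then have ub: "(\<integral>z. (cmod (poly P z) - c)\<^sup>2 \<partial>\<mu>) \<le> q - c\<^sup>2" using eq by (simp add: power2_eq_square)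
  moreover have nn: "0 \<le> (\<integral>z. (cmod (poly P z) - c)\<^sup>2 \<partial>\<mu>)" by (intro integral_nonneg_AE) auto
  ultimately show "(exp (real (degree P) * I))\<^sup>2 \<le> (\<integral>z. (cmod (poly P z))\<^sup>2 \<partial>\<mu>)"
    unfolding c_def q_def by linarith
  assume "(\<integral>z. (cmod (poly P z))\<^sup>2 \<partial>\<mu>) = (exp (real (degree P) * I))\<^sup>2"
  then have 0: "(\<integral>z. (cmod (poly P z) - c)\<^sup>2 \<partial>\<mu>) = 0" using ub nn unfolding c_def q_def by linarith
  have "integrable \<mu> (\<lambda>z. (cmod (poly P z) - c)\<^sup>2)" by (intro integrable_continuous_bounded continuous_intros)
  then have "AE z in \<mu>. (cmod (poly P z) - c)\<^sup>2 = 0"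
    using 0 integral_nonneg_eq_0_iff_AE[of \<mu> "\<lambda>z. (cmod (poly P z) - c)\<^sup>2"] by simp
  then show "AE z in \<mu>. cmod (poly P z) = exp (real (degree P) * I)"
    by eventually_elim (simp add: c_def)
qed

text \<open>The lower bound for monic polynomials makes all norms positive, so Gram-Schmidt applies
  in every degree.\<close>

lemma orthogonal_poly_exists':
  "\<exists>Q. lead_coeff Q = 1 \<and> degree Q = d \<and> (\<forall>s. degree s < d \<longrightarrow> ip Q s = 0)"
proof (rule orthogonal_poly_exists)
  fix P :: "complex poly" assume "lead_coeff P = 1"
  from integral_norm_sq_monic(1)[OF this] show "0 < (\<integral>z. (cmod (poly P z))\<^sup>2 \<partial>\<mu>)"
    by (rule order.strict_trans2[rotated]) simp
qed

lemma orthogonal_poly_minimal: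
  fixes P Q :: "complex poly"
  assumes Q: "lead_coeff Q = 1" "\<And>s. degree s < degree Q \<Longrightarrow> ip Q s = 0" and d: "0 < degree Q"
    and P: "lead_coeff P = 1" "degree P = degree Q"
  shows "(\<integral>z. (cmod (poly Q z))\<^sup>2 \<partial>\<mu>) \<le> (\<integral>z. (cmod (poly P z))\<^sup>2 \<partial>\<mu>)"
proof -
  define s where "s = P - Q"
  have "degree s \<le> degree Q" unfolding s_def by (rule degree_diff_le) (use P in auto)
  moreover have "coeff s (degree Q) = 0" using P Q(1) by (simp add: s_def)
  ultimately have "degree s < degree Q" using d by (metis degree_0 le_neq_implies_less leading_coeff_0_iff)
  then have "ip Q s = 0" by (rule Q(2))
  moreover from this have "ip s Q = 0" using ip_cnj[of s Q] by simp
  moreover have "P = Q + s" by (simp add: s_def)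
  ultimately have "ip P P = ip Q Q + ip s s" by (simp add: ip_add_left ip_add_right)
  then have "(\<integral>z. (cmod (poly P z))\<^sup>2 \<partial>\<mu>) = (\<integral>z. (cmod (poly Q z))\<^sup>2 \<partial>\<mu>) + (\<integral>z. (cmod (poly s z))\<^sup>2 \<partial>\<mu>)"
    unfolding ip_self by (simp flip: of_real_add)
  moreover have "0 \<le> (\<integral>z. (cmod (poly s z))\<^sup>2 \<partial>\<mu>)" by (intro integral_nonneg_AE) auto
  ultimately show ?thesis by linarith
qed

end

section \<open>The case of equality in one variable\<close>

context regular_equilibrium
begin

text \<open>Equality makes |Q| constant almost everywhere, and Q scaled to modulus 1 defines the
  lemniscate. Conversely, R divided by its leading coefficient a is monic and bounded on K by 1 /
  |a| \<le> exp (d I), so minimality of Q gives the upper bound.\<close>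

lemma orthogonal_poly_equality:
  fixes Q :: "complex poly"
  assumes Q: "lead_coeff Q = 1" "\<And>s. degree s < degree Q \<Longrightarrow> ip Q s = 0" and d: "0 < degree Q"
  shows "(\<integral>z. (cmod (poly Q z))\<^sup>2 \<partial>\<mu>) = (exp (real (degree Q) * I))\<^sup>2 \<longleftrightarrow>
    (\<exists>R :: complex poly. degree R = degree Q \<and> frontier (unbounded_component K) = {z. cmod (poly R z) = 1})"
proof
  let ?c = "exp (real (degree Q) * I)"
  assume "(\<integral>z. (cmod (poly Q z))\<^sup>2 \<partial>\<mu>) = ?c\<^sup>2"
  from integral_norm_sq_monic(2)[OF Q(1) this] have AE: "AE z in \<mu>. cmod (poly Q z) = ?c" .
  define R where "R = smult (of_real (exp (- (real (degree Q) * I)))) Q"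
  have dR: "degree R = degree Q" by (simp add: R_def)
  have "frontier \<Omega> = {z. cmod (poly R z) = 1}"
  proof (rule frontier_eq_lemniscate)
    show "0 < degree R" using d by (simp add: dR)
    show "cmod (lead_coeff R) = exp (- (real (degree R) * I))"
      using Q(1) by (simp add: dR) (simp add: R_def)
    show "AE w in \<mu>. cmod (poly R w) = 1"
      using AE
    proof eventually_elim
      case (elim w)
      have "cmod (poly R w) = exp (- (real (degree Q) * I)) * ?c" using elim by (simp add: R_def norm_mult)
      also have "\<dots> = 1" by (simp only: exp_minus_inverse mult.commute)
      finally show ?case .
    qed
  qed
  then show "\<exists>R :: complex poly. degree R = degree Q \<and> frontier (unbounded_component K) = {z. cmod (poly R z) = 1}"
    using dR unfolding \<Omega>_def by blast
next
  let ?c = "exp (real (degree Q) * I)"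
  assume "\<exists>R :: complex poly. degree R = degree Q \<and> frontier (unbounded_component K) = {z. cmod (poly R z) = 1}"
  then obtain R :: "complex poly" where R: "degree R = degree Q" "frontier \<Omega> = {z. cmod (poly R z) = 1}"
    unfolding \<Omega>_def by blast
  have d': "0 < degree R" using d R by simp
  define a where "a = lead_coeff R"
  have a: "a \<noteq> 0" using d' by (auto simp: a_def)
  have la: "exp (- (real (degree Q) * I)) \<le> cmod a"
    using lemniscate_lead_coeff[OF d' R(2)] by (simp add: a_def R(1))
  define P where "P = smult (1 / a) R"
  have P: "lead_coeff P = 1" "degree P = degree Q" using a R(1) by (auto simp: P_def a_def)
  have ia: "1 / cmod a \<le> ?c"
  proof -
    have "1 \<le> ?c * cmod a"
      using mult_left_mono[OF la, of ?c] by (simp add: exp_minus)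
    then show ?thesis using a by (simp add: field_simps)
  qed
  have "cmod (poly P w) \<le> ?c" if "w \<in> K" for w
  proof -
    have "cmod (poly R w) \<le> 1"
      by (rule norm_le_off_\<Omega>) (use R(2) that \<Omega>_disjoint in auto)
    then have "cmod (poly P w) \<le> 1 / cmod a" using a by (simp add: P_def norm_mult norm_divide divide_right_mono)
    then show ?thesis using ia by linarith
  qed
  then have "AE w in \<mu>. (cmod (poly P w))\<^sup>2 \<le> ?c\<^sup>2"
    using AE_K by (auto elim!: eventually_mono intro!: power_mono)
  then have "(\<integral>z. (cmod (poly P z))\<^sup>2 \<partial>\<mu>) \<le> ?c\<^sup>2"
    by (intro integral_le_const norm_sq_integrable)
  moreover have "(\<integral>z. (cmod (poly Q z))\<^sup>2 \<partial>\<mu>) \<le> (\<integral>z. (cmod (poly P z))\<^sup>2 \<partial>\<mu>)"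
    by (rule orthogonal_poly_minimal[OF Q d P])
  ultimately show "(\<integral>z. (cmod (poly Q z))\<^sup>2 \<partial>\<mu>) = ?c\<^sup>2"
    using integral_norm_sq_monic(1)[OF Q(1)] by linarith
qed

end

text \<open>If the Leja polynomials decayed faster than every geometric rate on \<open>K\<close>, suitable
  multiples of them would force the Green function to be infinite.\<close>
lemma regular_compact_lower_rate:
  assumes reg: "regular_compact K" and F: "leja_polys K F"
  shows "\<exists>c>0. \<exists>N. \<forall>n\<ge>N. \<exists>z\<in>K. c ^ n \<le> cmod (poly (F n) z)"
proof (rule ccontr)
  assume neg: "\<not> ?thesis"
  have Fp: "lead_coeff (F n) = 1" "degree (F n) = n" "poly (F n) x = 0 \<Longrightarrow> x \<in> K" for n x
    using F unfolding leja_polys_def by blast+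
  have "bounded K" using reg by (simp add: regular_compact_def compact_imp_bounded)
  then obtain b where b: "\<forall>x\<in>K. cmod x \<le> b" by (auto simp: bounded_iff)
  \<comment> \<open>At distance at least 1 from K, so that every root factor of F n has modulus at
    least 1 there and ln |F n x0| \<ge> 0.\<close>
  define x0 :: complex where "x0 = of_real (\<bar>b\<bar> + 1)"
  have x0: "1 \<le> cmod (x0 - w)" if "w \<in> K" for w
  proof -
    have "cmod w \<le> b" using b that by blast
    moreover have "cmod x0 = \<bar>b\<bar> + 1" unfolding x0_def by (simp only: norm_of_real abs_of_nonneg add_nonneg_nonneg abs_ge_zero zero_le_one)
    moreover have "cmod x0 \<le> cmod (x0 - w) + cmod w" using norm_triangle_ineq[of "x0 - w" w] by simp
    ultimately show ?thesis by linarith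
  qed
  have Fx: "poly (F n) x0 \<noteq> 0" "0 \<le> ln (cmod (poly (F n) x0))" for n
  proof -
    have "F n \<noteq> 0" using Fp(1)[of n] by auto
    from poly_split[OF this] obtain ws where ws: "F n = smult (lead_coeff (F n)) (\<Prod>w\<leftarrow>ws. [:- w, 1:])"
      "\<And>w. w \<in> set ws \<longleftrightarrow> poly (F n) w = 0" by metis
    show nz: "poly (F n) x0 \<noteq> 0" using Fp(3)[of n x0] x0[of x0] by auto
    have "0 \<le> (\<Sum>w\<leftarrow>ws. ln (cmod (x0 - w)))"
    proof (rule sum_list_nonneg)
      fix y assume "y \<in> set (map (\<lambda>w. ln (cmod (x0 - w))) ws)"
      then obtain w where "w \<in> set ws" "y = ln (cmod (x0 - w))" by auto
      then show "0 \<le> y" using x0[of w] ws(2) Fp(3) by auto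
    qed
    then show "0 \<le> ln (cmod (poly (F n) x0))" using ln_cmod_poly[OF ws(1) nz] Fp(1)[of n] by simp
  qed
  have "ereal M \<le> green_infty K x0" for M
  proof -
    have "\<not> (\<forall>n\<ge>1. \<exists>z\<in>K. exp (- M) ^ n \<le> cmod (poly (F n) z))" using neg exp_gt_zero by blast
    then obtain n where n: "1 \<le> n" "\<forall>z\<in>K. cmod (poly (F n) z) < exp (- M) ^ n" by (auto simp: not_le)
    define P where "P = smult (of_real (exp (M * real n))) (F n)"
    have dP: "degree P = n" by (simp add: P_def Fp)
    have e: "exp (M * real n) * exp (- M) ^ n = 1"
      by (simp add: exp_of_nat2_mult[symmetric] exp_add[symmetric])
    have "cmod (poly P w) \<le> 1" if "w \<in> K" for w
    proof -
      have "cmod (poly P w) = exp (M * real n) * cmod (poly (F n) w)" by (simp add: P_def norm_mult)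
      also have "\<dots> \<le> exp (M * real n) * exp (- M) ^ n" using n(2) that by (intro mult_left_mono) auto
      finally show ?thesis using e by simp
    qed
    moreover have "poly P x0 \<noteq> 0" using Fx(1) by (simp add: P_def)
    ultimately have 1: "ereal (ln (cmod (poly P x0)) / real (degree P)) \<le> green_infty K x0"
      unfolding green_infty_def using n(1) dP by (intro Sup_upper) (auto intro!: exI[of _ P])
    have "ln (cmod (poly P x0)) = M * real n + ln (cmod (poly (F n) x0))"
      using Fx(1)[of n] by (simp add: P_def norm_mult ln_mult)
    then have "M \<le> ln (cmod (poly P x0)) / real (degree P)" using n(1) Fx(2)[of n] dP by (simp add: field_simps)
    then show ?thesis using 1 order_trans by (metis ereal_less_eq(3))
  qed
  then have "green_infty K x0 = \<infinity>" by (rule ereal_top)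
  then show False using reg by (simp add: regular_compact_def)
qed

text \<open>An equilibrium measure could by definition have infinite energy. Regularity bounds the
  Leja polynomials from below by a geometric rate, the resulting measure \<sigma> has finite energy,
  and minimality transfers this to \<mu>.\<close>

lemma regular_equilibrium_exists:
  assumes reg: "regular_compact K" and eq: "equilibrium_measure K \<mu>"
  shows "\<exists>r I F. regular_equilibrium K \<mu> r I F \<and> log_capacity K = exp I"
proof -
  have K: "compact K" "K \<noteq> {}" using reg by (auto simp: regular_compact_def)
  obtain r where r: "\<forall>x\<in>K. cmod x \<le> r" using compact_imp_bounded[OF K(1)] by (auto simp: bounded_iff)
  then have Kr: "K \<subseteq> cball 0 r" by auto
  have Kb: "K \<in> sets borel" using K by (simp add: borel_compact)
  obtain F where F: "leja_polys K F" using leja_polys_exists[OF K] by blast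
  obtain c where c: "0 < c" "\<exists>N. \<forall>n\<ge>N. \<exists>z\<in>K. c ^ n \<le> cmod (poly (F n) z)"
    using regular_compact_lower_rate[OF reg F] by blast
  then obtain \<sigma> where \<sigma>: "prob_on K \<sigma>" "\<forall>\<delta>>0. ln c \<le> trunc_energy \<sigma> \<delta>"
    using F unfolding leja_polys_def by blast
  have mu: "prob_on K \<mu>" "log_energy \<mu> = robin_const K" using eq by (auto simp: equilibrium_measure_def)
  have rob: "robin_const K \<le> log_energy \<nu>" if "prob_on K \<nu>" for \<nu>
    unfolding robin_const_def using that by (intro INF_lower) simp
  interpret S: bounded_prob \<sigma> r by (rule prob_on_bounded_prob(1)[OF \<sigma>(1) Kb Kr])
  interpret M: bounded_prob \<mu> r by (rule prob_on_bounded_prob(1)[OF mu(1) Kb Kr])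
  have "log_energy \<sigma> \<le> ereal (- ln c)" using \<sigma>(2) by (simp add: S.log_energy_le_iff)
  then have ub: "log_energy \<mu> \<le> ereal (- ln c)" using rob[OF \<sigma>(1)] mu(2) by simp
  then obtain e where e: "log_energy \<mu> = ereal e"
    using M.log_energy_lower by (cases "log_energy \<mu>") auto
  define I where "I = - e"
  have lI: "log_energy \<mu> = ereal (- I)" using e by (simp add: I_def)
  have "equilibrium K \<mu> r I"
  proof
    show "I \<le> trunc_energy \<mu> \<delta>" if "0 < \<delta>" for \<delta>
      using M.log_energy_le_iff[of I] lI that by simp
    fix \<nu> a assume \<nu>: "prob_on K \<nu>" and a: "\<And>\<delta>. 0 < \<delta> \<Longrightarrow> a \<le> trunc_energy \<nu> \<delta>"
    interpret N: bounded_prob \<nu> r by (rule prob_on_bounded_prob(1)[OF \<nu> Kb Kr])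
    have "log_energy \<nu> \<le> ereal (- a)" using a by (simp add: N.log_energy_le_iff)
    then have "ereal (- I) \<le> ereal (- a)" using rob[OF \<nu>] mu(2) lI by (metis order_trans)
    then show "a \<le> I" by simp
  qed (use K Kr mu in auto)
  then have "regular_equilibrium K \<mu> r I F"
    by (intro regular_equilibrium.intro regular_equilibrium_axioms.intro reg F)
  moreover have "log_capacity K = exp I"
  proof -
    have "robin_const K = ereal (- I)" using mu(2) lI by simp
    then show ?thesis unfolding log_capacity_def by simp
  qed
  ultimately show ?thesis by blast
qed

subsection \<open>The graded lexicographic enumeration\<close>

lemma grlex_irrefl: "\<not> grlex_less n \<beta> \<beta>"
  by (simp add: grlex_less_def)

lemma grlex_trans:
  assumes "grlex_less n \<alpha> \<beta>" "grlex_less n \<beta> \<gamma>"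
  shows "grlex_less n \<alpha> \<gamma>"
proof (cases "mdeg n \<alpha> = mdeg n \<beta> \<and> mdeg n \<beta> = mdeg n \<gamma>")
  case True
  then obtain l m where l: "l < n" "\<beta> l < \<alpha> l" "\<forall>k<l. \<beta> k = \<alpha> k" and m: "m < n" "\<gamma> m < \<beta> m" "\<forall>k<m. \<gamma> k = \<beta> k"
    using assms by (auto simp: grlex_less_def)
  have "\<gamma> (min l m) < \<alpha> (min l m)" using l m by (cases l m rule: linorder_cases) auto
  moreover have "\<forall>k<min l m. \<gamma> k = \<alpha> k" using l m by auto
  moreover have "min l m < n" using l by auto
  ultimately show ?thesis using True unfolding grlex_less_def by (intro disjI2 conjI exI[of _ "min l m"]) simp_all
qed (use assms in \<open>auto simp: grlex_less_def\<close>)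

lemma grlex_total:
  assumes "\<alpha> \<in> multi_indices n" "\<beta> \<in> multi_indices n" "\<alpha> \<noteq> \<beta>"
  shows "grlex_less n \<alpha> \<beta> \<or> grlex_less n \<beta> \<alpha>"
proof (cases "mdeg n \<alpha> = mdeg n \<beta>")
  case True
  have "\<exists>l. \<alpha> l \<noteq> \<beta> l" using assms(3) by auto
  define l where "l = (LEAST l. \<alpha> l \<noteq> \<beta> l)"
  have l: "\<alpha> l \<noteq> \<beta> l" unfolding l_def by (rule LeastI_ex[OF \<open>\<exists>l. \<alpha> l \<noteq> \<beta> l\<close>])
  have k: "\<forall>k<l. \<alpha> k = \<beta> k" unfolding l_def using not_less_Least by blast
  have "l < n"
  proof (rule ccontr)
    assume "\<not> l < n"
    then show False using l assms(1,2) by (simp add: multi_indices_def)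
  qed
  then show ?thesis using True l k unfolding grlex_less_def by (metis linorder_neqE_nat)
qed (auto simp: grlex_less_def)

lemma finite_mdeg_le: "finite {\<beta> \<in> multi_indices n. mdeg n \<beta> \<le> d}"
proof (rule finite_subset)
  show "{\<beta> \<in> multi_indices n. mdeg n \<beta> \<le> d} \<subseteq> {f. \<forall>x. (x \<in> {..<n} \<longrightarrow> f x \<in> {..d}) \<and> (x \<notin> {..<n} \<longrightarrow> f x = 0)}"
  proof clarify
    fix \<beta> x assume b: "\<beta> \<in> multi_indices n" "mdeg n \<beta> \<le> d"
    have "\<beta> x \<le> d" if "x < n"
    proof -
      have "\<beta> x \<le> mdeg n \<beta>" unfolding mdeg_def using that by (intro member_le_sum) auto
      then show ?thesis using b by simp
    qed
    then show "(x \<in> {..<n} \<longrightarrow> \<beta> x \<in> {..d}) \<and> (x \<notin> {..<n} \<longrightarrow> \<beta> x = 0)"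
      using b by (auto simp: multi_indices_def)
  qed
  show "finite {f :: nat \<Rightarrow> nat. \<forall>x. (x \<in> {..<n} \<longrightarrow> f x \<in> {..d}) \<and> (x \<notin> {..<n} \<longrightarrow> f x = 0)}"
    by (rule finite_set_of_finite_funs) auto
qed

text \<open>Its cardinality is the position of \<beta> in the enumeration.\<close>

definition preds :: "nat \<Rightarrow> (nat \<Rightarrow> nat) \<Rightarrow> (nat \<Rightarrow> nat) set" where
  "preds n \<beta> = {\<gamma> \<in> multi_indices n. grlex_less n \<gamma> \<beta>}"

lemma finite_preds: "finite (preds n \<beta>)"
  by (rule finite_subset[OF _ finite_mdeg_le[of n "mdeg n \<beta>"]]) (auto simp: preds_def grlex_less_def)

lemma card_preds_strict_mono:
  assumes "grlex_less n \<gamma> \<beta>" "\<gamma> \<in> multi_indices n"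
  shows "card (preds n \<gamma>) < card (preds n \<beta>)"
proof (rule psubset_card_mono[OF finite_preds])
  have "\<gamma> \<in> preds n \<beta>" "\<gamma> \<notin> preds n \<gamma>" using assms grlex_irrefl by (auto simp: preds_def)
  moreover have "preds n \<gamma> \<subseteq> preds n \<beta>" unfolding preds_def using grlex_trans[OF _ assms(1)] by blast
  ultimately show "preds n \<gamma> \<subset> preds n \<beta>" by blast
qed

lemma card_preds_inj: "inj_on (\<lambda>\<beta>. card (preds n \<beta>)) (multi_indices n)"
proof (rule inj_onI)
  fix \<beta> \<gamma> assume b: "\<beta> \<in> multi_indices n" "\<gamma> \<in> multi_indices n" and eq: "card (preds n \<beta>) = card (preds n \<gamma>)"
  show "\<beta> = \<gamma>"
  proof (rule ccontr)
    assume "\<beta> \<noteq> \<gamma>"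
    then have "grlex_less n \<beta> \<gamma> \<or> grlex_less n \<gamma> \<beta>" using grlex_total b by blast
    then show False using card_preds_strict_mono b eq by fastforce
  qed
qed

text \<open>Positions have no gaps: a predecessor \<gamma> of maximal position precedes \<beta>
  immediately, because every other predecessor of \<beta> already precedes \<gamma>. Stepping down
  by one position reaches every smaller value.\<close>

lemma card_preds_down_closed:
  assumes "\<beta> \<in> multi_indices n" "i \<le> card (preds n \<beta>)"
  shows "\<exists>\<gamma>\<in>multi_indices n. card (preds n \<gamma>) = i"
  using assms
proof (induction "card (preds n \<beta>)" arbitrary: \<beta> rule: less_induct)
  case less
  show ?case
  proof (cases "i = card (preds n \<beta>)")
    case False
    then have "0 < card (preds n \<beta>)" using less.prems by simp
    then have ne: "preds n \<beta> \<noteq> {}" by auto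
    let ?R = "(\<lambda>\<delta>. card (preds n \<delta>)) ` preds n \<beta>"
    have fR: "finite ?R" using finite_preds by simp
    have "Max ?R \<in> ?R" using fR ne by (intro Max_in) auto
    then obtain \<gamma> where g: "\<gamma> \<in> preds n \<beta>" and M: "Max ?R = card (preds n \<gamma>)" by auto
    have mx: "card (preds n \<delta>) \<le> card (preds n \<gamma>)" if "\<delta> \<in> preds n \<beta>" for \<delta>
      unfolding M[symmetric] by (rule Max_ge[OF fR]) (rule imageI[OF that])
    have gm: "\<gamma> \<in> multi_indices n" "grlex_less n \<gamma> \<beta>" using g by (auto simp: preds_def)
    have sub: "preds n \<beta> \<subseteq> insert \<gamma> (preds n \<gamma>)"
    proof
      fix \<delta> assume d: "\<delta> \<in> preds n \<beta>"
      then have dm: "\<delta> \<in> multi_indices n" by (simp add: preds_def)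
      have "\<not> grlex_less n \<gamma> \<delta>" using card_preds_strict_mono[OF _ gm(1), of \<delta>] mx[OF d] by (meson not_le)
      then have "\<delta> = \<gamma> \<or> grlex_less n \<delta> \<gamma>" using grlex_total[OF dm gm(1)] by blast
      then show "\<delta> \<in> insert \<gamma> (preds n \<gamma>)" using dm by (auto simp: preds_def)
    qed
    have "card (preds n \<beta>) \<le> card (insert \<gamma> (preds n \<gamma>))" by (rule card_mono[OF _ sub]) (simp add: finite_preds)
    also have "\<dots> \<le> Suc (card (preds n \<gamma>))" by (rule card_insert_le_m1) auto
    finally have "card (preds n \<beta>) \<le> Suc (card (preds n \<gamma>))" .
    then have "i \<le> card (preds n \<gamma>)" using False less.prems by simp
    then show ?thesis using less.hyps[OF card_preds_strict_mono[OF gm(2,1)] gm(1)] by blast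
  qed (use less.prems in blast)
qed

text \<open>Exponents of powers of one variable. They show that positions are unbounded, and along
  them the Chebyshev constants are compared with a single capacity.\<close>

definition axis_index :: "nat \<Rightarrow> nat \<Rightarrow> nat \<Rightarrow> nat" where
  "axis_index j d = (\<lambda>k. if k = j then d else 0)"

lemma axis_index_multi: "j < n \<Longrightarrow> axis_index j d \<in> multi_indices n"
  by (auto simp: axis_index_def multi_indices_def)

lemma inj_axis_index: "inj (axis_index j)"
  by (rule injI) (metis axis_index_def)

lemma mdeg_axis_index: "j < n \<Longrightarrow> mdeg n (axis_index j d) = d"
  by (simp add: mdeg_def axis_index_def)

lemma rank_surj:
  assumes "1 \<le> n"
  shows "\<exists>\<beta>\<in>multi_indices n. card (preds n \<beta>) = i"
proof -
  have "infinite (range (\<lambda>d. card (preds n (axis_index 0 d))))"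
  proof (rule range_inj_infinite, rule injI)
    fix x y assume "card (preds n (axis_index 0 x)) = card (preds n (axis_index 0 y))"
    then have "axis_index 0 x = axis_index 0 y"
      using card_preds_inj[of n] axis_index_multi[of 0 n] assms by (auto simp: inj_on_def)
    then show "x = y" using inj_axis_index[of 0] by (simp add: inj_eq)
  qed
  then obtain d where "i < card (preds n (axis_index 0 d))" unfolding infinite_nat_iff_unbounded by auto
  then show ?thesis using card_preds_down_closed[of "axis_index 0 d" n i] axis_index_multi[of 0 n d] assms by auto
qed

lemma mi_enum_props:
  assumes "1 \<le> n"
  shows "mi_enum n i \<in> multi_indices n" "card (preds n (mi_enum n i)) = i"
proof -
  have "\<exists>!\<beta>. \<beta> \<in> multi_indices n \<and> card (preds n \<beta>) = i"
    using rank_surj[OF assms, of i] card_preds_inj[of n] by (auto simp: inj_on_def)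
  from theI'[OF this] show "mi_enum n i \<in> multi_indices n" "card (preds n (mi_enum n i)) = i"
    unfolding mi_enum_def preds_def by auto
qed

lemma mi_enum_rank:
  assumes "1 \<le> n" "\<beta> \<in> multi_indices n"
  shows "mi_enum n (card (preds n \<beta>)) = \<beta>"
  using mi_enum_props[OF assms(1)] assms(2) card_preds_inj[of n] by (auto simp: inj_on_def)

lemma mdeg_mi_enum_pos:
  assumes "1 \<le> n" "1 \<le> i"
  shows "0 < mdeg n (mi_enum n i)"
proof (rule ccontr)
  assume "\<not> ?thesis"
  then have 0: "mdeg n (mi_enum n i) = 0" by simp
  have "preds n (mi_enum n i) = {}"
  proof (rule ccontr)
    assume "preds n (mi_enum n i) \<noteq> {}"
    then obtain \<gamma> where "grlex_less n \<gamma> (mi_enum n i)" by (auto simp: preds_def)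
    then obtain l where "l < n" "mi_enum n i l < \<gamma> l" "mdeg n \<gamma> = 0" using 0 by (auto simp: grlex_less_def)
    then show False by (auto simp: mdeg_def)
  qed
  then show False using mi_enum_props(2)[OF assms(1), of i] assms(2) by simp
qed

subsection \<open>Products of monic polynomials\<close>

lemma monic_polys_altdef:
  "P \<in> monic_polys n \<alpha> \<longleftrightarrow> (\<exists>c. P = (\<lambda>z. monom_n n \<alpha> z + (\<Sum>\<beta>\<in>preds n \<alpha>. c \<beta> * monom_n n \<beta> z)))"
  by (simp add: monic_polys_def preds_def)

lemma grlex_less_of_le:
  assumes "\<beta> \<in> multi_indices n" "\<alpha> \<in> multi_indices n" "\<And>j. \<beta> j \<le> \<alpha> j" "\<beta> \<noteq> \<alpha>"
  shows "grlex_less n \<beta> \<alpha>"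
proof -
  obtain j where j: "\<beta> j \<noteq> \<alpha> j" using assms(4) by auto
  have "j < n"
  proof (rule ccontr)
    assume "\<not> j < n"
    then show False using j assms(1,2) by (simp add: multi_indices_def)
  qed
  then have "mdeg n \<beta> < mdeg n \<alpha>"
  proof -
    assume jn: "j < n"
    have "\<beta> j < \<alpha> j" using assms(3)[of j] j by linarith
    then show ?thesis unfolding mdeg_def using jn assms(3) by (intro sum_strict_mono_ex1) auto
  qed
  then show ?thesis by (simp add: grlex_less_def)
qed

text \<open>Expanding the product yields exponents that are componentwise at most \<alpha>. All
  except \<alpha> have smaller total degree and so precede it; the remaining predecessors receive
  coefficient 0.\<close>

lemma prod_poly_monic:
  assumes Q: "\<And>j. j < n \<Longrightarrow> lead_coeff (Q j) = 1 \<and> degree (Q j) = \<alpha> j" and \<alpha>: "\<alpha> \<in> multi_indices n"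
  shows "(\<lambda>z. \<Prod>j<n. poly (Q j) (z j)) \<in> monic_polys n \<alpha>"
proof -
  define Box where "Box = {\<beta> \<in> multi_indices n. \<forall>j. \<beta> j \<le> \<alpha> j}"
  define C where "C \<beta> = (\<Prod>j<n. coeff (Q j) (\<beta> j))" for \<beta>
  have sub: "Box - {\<alpha>} \<subseteq> preds n \<alpha>" unfolding Box_def preds_def using grlex_less_of_le[OF _ \<alpha>] by auto
  have aB: "\<alpha> \<in> Box" using \<alpha> by (simp add: Box_def)
  have fB: "finite Box" using finite_subset[OF sub finite_preds] by simp
  have C1: "C \<alpha> = 1" unfolding C_def
  proof (rule prod.neutral, rule ballI)
    fix j assume "j \<in> {..<n}"
    then show "coeff (Q j) (\<alpha> j) = 1" using Q[of j] by auto
  qed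
  have eq: "(\<Prod>j<n. poly (Q j) (z j)) = (\<Sum>\<beta>\<in>Box. C \<beta> * monom_n n \<beta> z)" for z
  proof -
    have "(\<Prod>j<n. poly (Q j) (z j)) = (\<Prod>j<n. \<Sum>k\<in>{..\<alpha> j}. coeff (Q j) k * z j ^ k)"
      using Q by (intro prod.cong) (auto simp: poly_altdef)
    also have "\<dots> = (\<Sum>g\<in>PiE {..<n} (\<lambda>j. {..\<alpha> j}). \<Prod>j<n. coeff (Q j) (g j) * z j ^ g j)"
      by (rule prod_sum_PiE) auto
    also have "\<dots> = (\<Sum>\<beta>\<in>Box. C \<beta> * monom_n n \<beta> z)"
    proof (rule sum.reindex_bij_witness[where i = "\<lambda>\<beta>. restrict \<beta> {..<n}" and j = "\<lambda>g k. if k < n then g k else 0"])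
      fix g assume g: "g \<in> PiE {..<n} (\<lambda>j. {..\<alpha> j})"
      show "restrict (\<lambda>k. if k < n then g k else 0) {..<n} = g"
        using g by (intro ext) (auto simp: PiE_def extensional_def)
      show "(\<lambda>k. if k < n then g k else 0) \<in> Box" using g by (auto simp: Box_def multi_indices_def PiE_def Pi_def)
      show "C (\<lambda>k. if k < n then g k else 0) * monom_n n (\<lambda>k. if k < n then g k else 0) z =
          (\<Prod>j<n. coeff (Q j) (g j) * z j ^ g j)"
        by (simp add: C_def monom_n_def prod.distrib)
    next
      fix \<beta> assume b: "\<beta> \<in> Box"
      show "(\<lambda>k. if k < n then restrict \<beta> {..<n} k else 0) = \<beta>"
        using b by (intro ext) (auto simp: Box_def multi_indices_def)
      show "restrict \<beta> {..<n} \<in> PiE {..<n} (\<lambda>j. {..\<alpha> j})" using b by (auto simp: Box_def)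
    qed
    finally show ?thesis .
  qed
  have "(\<Sum>\<beta>\<in>Box. C \<beta> * monom_n n \<beta> z) =
      monom_n n \<alpha> z + (\<Sum>\<beta>\<in>preds n \<alpha>. (if \<beta> \<in> Box then C \<beta> else 0) * monom_n n \<beta> z)" for z
  proof -
    have "(\<Sum>\<beta>\<in>Box. C \<beta> * monom_n n \<beta> z) = C \<alpha> * monom_n n \<alpha> z + (\<Sum>\<beta>\<in>Box - {\<alpha>}. C \<beta> * monom_n n \<beta> z)"
      by (rule sum.remove[OF fB aB])
    also have "(\<Sum>\<beta>\<in>Box - {\<alpha>}. C \<beta> * monom_n n \<beta> z) =
        (\<Sum>\<beta>\<in>Box - {\<alpha>}. (if \<beta> \<in> Box then C \<beta> else 0) * monom_n n \<beta> z)"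
      by (intro sum.cong) auto
    also have "\<dots> = (\<Sum>\<beta>\<in>preds n \<alpha>. (if \<beta> \<in> Box then C \<beta> else 0) * monom_n n \<beta> z)"
    proof (rule sum.mono_neutral_left[OF finite_preds sub], rule ballI)
      fix \<beta> assume b: "\<beta> \<in> preds n \<alpha> - (Box - {\<alpha>})"
      have "\<beta> \<noteq> \<alpha>" using b grlex_irrefl by (auto simp: preds_def)
      then show "(if \<beta> \<in> Box then C \<beta> else 0) * monom_n n \<beta> z = 0" using b by auto
    qed
    finally show ?thesis by (simp add: C1)
  qed
  then show ?thesis unfolding monic_polys_altdef eq by (intro exI[of _ "\<lambda>\<beta>. if \<beta> \<in> Box then C \<beta> else 0"]) simp
qed

section \<open>Orthogonal polynomials of the product measure\<close>

text \<open>The factors are constrained for all indices, since \<open>product_prob_space\<close>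
  requires every factor to be a probability space, including those outside the index set.\<close>

locale product_equilibrium =
  fixes n :: nat and Ks :: "nat \<Rightarrow> complex set" and mu :: "nat \<Rightarrow> complex measure"
    and r I :: "nat \<Rightarrow> real" and F :: "nat \<Rightarrow> nat \<Rightarrow> complex poly"
  assumes n: "1 \<le> n" and RE: "\<And>j. regular_equilibrium (Ks j) (mu j) (r j) (I j) (F j)"
begin

lemma EQ: "equilibrium (Ks j) (mu j) (r j) (I j)"
  using RE[of j] by (rule regular_equilibrium.axioms(1))

lemma BP: "bounded_prob (mu j) (r j)"
proof -
  interpret equilibrium "Ks j" "mu j" "r j" "I j" by (rule EQ)
  show ?thesis by (rule bounded_prob_axioms)
qed

lemma prob_mu: "prob_space (mu j)"
  using BP[of j] by (rule bounded_prob.axioms(1))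

sublocale product_prob_space mu "{..<n}"
  by (intro product_prob_space.intro product_sigma_finite.intro product_prob_space_axioms.intro
      prob_mu prob_space_imp_sigma_finite)

definition \<nu> :: "(nat \<Rightarrow> complex) measure" where "\<nu> = PiM {..<n} mu"

lemma prob_nu: "prob_space \<nu>"
  unfolding \<nu>_def by (intro prob_space_PiM prob_mu)

lemma component_measurable: "j < n \<Longrightarrow> (\<lambda>z. z j) \<in> \<nu> \<rightarrow>\<^sub>M borel"
proof -
  assume j: "j < n"
  have "(\<lambda>z. z j) \<in> PiM {..<n} mu \<rightarrow>\<^sub>M mu j" using j by (intro measurable_component_singleton) auto
  then show ?thesis
    using measurable_cong_sets[OF refl bounded_prob.sets_nu[OF BP[of j]], of "PiM {..<n} mu"] by (simp add: \<nu>_def)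
qed

lemma monom_measurable: "monom_n n \<beta> \<in> borel_measurable \<nu>"
  unfolding monom_n_def by (intro borel_measurable_prod borel_measurable_power component_measurable) auto

lemma monic_measurable:
  assumes "P \<in> monic_polys n \<alpha>"
  shows "P \<in> borel_measurable \<nu>"
proof -
  obtain c where "P = (\<lambda>z. monom_n n \<alpha> z + (\<Sum>\<beta>\<in>preds n \<alpha>. c \<beta> * monom_n n \<beta> z))"
    using assms unfolding monic_polys_altdef by blast
  then show ?thesis
    by (auto intro!: borel_measurable_add borel_measurable_sum borel_measurable_times monom_measurable)
qed

lemma AE_nu: "AE z in \<nu>. \<forall>j\<in>{..<n}. z j \<in> Ks j"
proof (rule AE_ball_countable')
  fix j assume "j \<in> {..<n}"
  then show "AE z in \<nu>. z j \<in> Ks j" unfolding \<nu>_def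
    by (intro AE_PiM_component prob_mu equilibrium.AE_K[OF EQ])
qed auto

lemma monom_bounded:
  assumes "\<forall>j\<in>{..<n}. z j \<in> Ks j"
  shows "cmod (monom_n n \<beta> z) \<le> (\<Prod>j<n. r j ^ \<beta> j)"
proof -
  have "cmod (monom_n n \<beta> z) = (\<Prod>j<n. cmod (z j) ^ \<beta> j)" by (simp add: monom_n_def prod_norm[symmetric] norm_power)
  also have "\<dots> \<le> (\<Prod>j<n. r j ^ \<beta> j)"
    using assms equilibrium.norm_le_r[OF EQ] by (intro prod_mono conjI power_mono) auto
  finally show ?thesis .
qed

lemma monic_bounded:
  assumes "P \<in> monic_polys n \<alpha>"
  shows "\<exists>B. \<forall>z. (\<forall>j\<in>{..<n}. z j \<in> Ks j) \<longrightarrow> cmod (P z) \<le> B"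
proof -
  obtain c where P: "P = (\<lambda>z. monom_n n \<alpha> z + (\<Sum>\<beta>\<in>preds n \<alpha>. c \<beta> * monom_n n \<beta> z))"
    using assms unfolding monic_polys_altdef by blast
  show ?thesis
  proof (intro exI allI impI)
    fix z :: "nat \<Rightarrow> complex" assume z: "\<forall>j\<in>{..<n}. z j \<in> Ks j"
    have "cmod (P z) \<le> cmod (monom_n n \<alpha> z) + (\<Sum>\<beta>\<in>preds n \<alpha>. cmod (c \<beta> * monom_n n \<beta> z))"
      unfolding P by (intro order_trans[OF norm_triangle_ineq] add_mono norm_sum) simp
    also have "\<dots> \<le> (\<Prod>j<n. r j ^ \<alpha> j) + (\<Sum>\<beta>\<in>preds n \<alpha>. cmod (c \<beta>) * (\<Prod>j<n. r j ^ \<beta> j))"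
      unfolding norm_mult by (intro add_mono sum_mono mult_left_mono monom_bounded z) auto
    finally show "cmod (P z) \<le> (\<Prod>j<n. r j ^ \<alpha> j) + (\<Sum>\<beta>\<in>preds n \<alpha>. cmod (c \<beta>) * (\<Prod>j<n. r j ^ \<beta> j))" .
  qed
qed

lemma integrable_AE_bounded:
  fixes f :: "(nat \<Rightarrow> complex) \<Rightarrow> 'b :: {banach, second_countable_topology}"
  assumes "f \<in> borel_measurable \<nu>" "\<And>z. (\<forall>j\<in>{..<n}. z j \<in> Ks j) \<Longrightarrow> norm (f z) \<le> B"
  shows "integrable \<nu> f"
proof -
  interpret prob_space \<nu> by (rule prob_nu)
  show ?thesis
    by (rule integrable_const_bound[of _ B]) (use AE_nu assms in \<open>auto elim!: eventually_mono\<close>)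
qed

definition q :: "(nat \<Rightarrow> complex poly) \<Rightarrow> (nat \<Rightarrow> complex) \<Rightarrow> complex" where
  "q Q z = (\<Prod>j<n. poly (Q j) (z j))"

definition N :: "nat \<Rightarrow> complex poly \<Rightarrow> real" where
  "N j Q = (\<integral>z. (cmod (poly Q z))\<^sup>2 \<partial>mu j)"

lemma integral_prod:
  fixes f :: "nat \<Rightarrow> complex \<Rightarrow> 'b :: {real_normed_field, banach, second_countable_topology}"
  assumes "\<And>j. continuous_on UNIV (f j)"
  shows "(\<integral>z. (\<Prod>j<n. f j (z j)) \<partial>\<nu>) = (\<Prod>j<n. \<integral>z. f j z \<partial>mu j)"
  unfolding \<nu>_def by (rule product_integral_prod) (auto intro!: bounded_prob.integrable_continuous_bounded[OF BP] assms)

definition orth_family :: "(nat \<Rightarrow> nat) \<Rightarrow> (nat \<Rightarrow> complex poly) \<Rightarrow> bool" where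
  "orth_family \<alpha> Q \<longleftrightarrow> (\<forall>j. lead_coeff (Q j) = 1 \<and> degree (Q j) = \<alpha> j \<and>
     (\<forall>s. degree s < \<alpha> j \<longrightarrow> bounded_prob.ip (mu j) (Q j) s = 0))"

lemma orth_family_exists: "\<exists>Q. orth_family \<alpha> Q"
proof -
  have "\<forall>j. \<exists>Q. lead_coeff Q = 1 \<and> degree Q = \<alpha> j \<and> (\<forall>s. degree s < \<alpha> j \<longrightarrow> bounded_prob.ip (mu j) Q s = 0)"
    using equilibrium.orthogonal_poly_exists'[OF EQ] by blast
  from choice[OF this] show ?thesis unfolding orth_family_def by blast
qed

lemma norm_q:
  "(\<integral>z. (cmod (q Q z))\<^sup>2 \<partial>\<nu>) = (\<Prod>j<n. N j (Q j))"
proof -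
  have "(\<integral>z. (cmod (q Q z))\<^sup>2 \<partial>\<nu>) = (\<integral>z. (\<Prod>j<n. (cmod (poly (Q j) (z j)))\<^sup>2) \<partial>\<nu>)"
    by (simp add: q_def prod_norm[symmetric] prod_power_distrib)
  also have "\<dots> = (\<Prod>j<n. N j (Q j))" unfolding N_def
    by (rule integral_prod) (intro continuous_intros)
  finally show ?thesis .
qed

text \<open>The integral factorizes. For \<alpha> each factor is a squared norm, as a monic
  polynomial of the same degree differs from Q j by lower terms. A predecessor of \<alpha> has some
  exponent below that of \<alpha>, since otherwise \<alpha> would precede or equal it; that factor
  vanishes.\<close>

lemma ip_monom_q:
  assumes Q: "orth_family \<alpha> Q" and \<alpha>: "\<alpha> \<in> multi_indices n"
  shows "(\<integral>z. monom_n n \<alpha> z * cnj (q Q z) \<partial>\<nu>) = of_real (\<Prod>j<n. N j (Q j))"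
    and "\<beta> \<in> preds n \<alpha> \<Longrightarrow> (\<integral>z. monom_n n \<beta> z * cnj (q Q z) \<partial>\<nu>) = 0"
proof -
  have Qp: "lead_coeff (Q j) = 1" "degree (Q j) = \<alpha> j"
    "degree s < \<alpha> j \<Longrightarrow> bounded_prob.ip (mu j) (Q j) s = 0" for j s
    using Q unfolding orth_family_def by blast+
  have prod: "(\<integral>z. monom_n n \<beta> z * cnj (q Q z) \<partial>\<nu>) = (\<Prod>j<n. bounded_prob.ip (mu j) (monom 1 (\<beta> j)) (Q j))" for \<beta>
  proof -
    have "(\<integral>z. monom_n n \<beta> z * cnj (q Q z) \<partial>\<nu>) = (\<integral>z. (\<Prod>j<n. z j ^ \<beta> j * cnj (poly (Q j) (z j))) \<partial>\<nu>)"
      by (simp add: monom_n_def q_def prod.distrib)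
    also have "\<dots> = (\<Prod>j<n. \<integral>z. z ^ \<beta> j * cnj (poly (Q j) z) \<partial>mu j)"
      by (rule integral_prod) (intro continuous_intros)
    also have "\<dots> = (\<Prod>j<n. bounded_prob.ip (mu j) (monom 1 (\<beta> j)) (Q j))"
      by (simp add: bounded_prob.ip_def[OF BP] poly_monom)
    finally show ?thesis .
  qed
  have "bounded_prob.ip (mu j) (monom 1 (\<alpha> j)) (Q j) = of_real (N j (Q j))" for j
  proof -
    interpret B: bounded_prob "mu j" "r j" by (rule BP)
    define s where "s = monom 1 (\<alpha> j) - Q j"
    have "B.ip s (Q j) = 0"
    proof (cases "\<alpha> j = 0")
      case True
      then have "Q j = 1" using Qp(1,2)[of j] by (metis degree_eq_zeroE coeff_pCons_0 one_pCons degree_pCons_0)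
      then have "s = 0" using True by (simp add: s_def)
      then show ?thesis by simp
    next
      case False
      have "degree s \<le> \<alpha> j" unfolding s_def by (rule degree_diff_le) (auto simp: degree_monom_le Qp)
      moreover have "coeff s (\<alpha> j) = 0" using Qp(1,2)[of j] by (simp add: s_def)
      ultimately have "degree s < \<alpha> j" using False by (metis degree_0 gr0I le_neq_implies_less leading_coeff_0_iff)
      then have "B.ip (Q j) s = 0" by (rule Qp(3))
      then show ?thesis using B.ip_cnj[of s "Q j"] by simp
    qed
    moreover have "monom 1 (\<alpha> j) = Q j + s" by (simp add: s_def)
    ultimately have "B.ip (monom 1 (\<alpha> j)) (Q j) = B.ip (Q j) (Q j)" by (simp add: B.ip_add_left)
    then show ?thesis by (simp add: B.ip_self N_def)
  qed
  then show "(\<integral>z. monom_n n \<alpha> z * cnj (q Q z) \<partial>\<nu>) = of_real (\<Prod>j<n. N j (Q j))" by (simp add: prod)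
  assume b: "\<beta> \<in> preds n \<alpha>"
  have "\<exists>j<n. \<beta> j < \<alpha> j"
  proof (rule ccontr)
    assume "\<not> ?thesis"
    then have ge: "\<alpha> j \<le> \<beta> j" for j
      using \<alpha> by (cases "j < n") (auto simp: multi_indices_def not_less)
    then show False
      using grlex_less_of_le[of \<alpha> n \<beta>] \<alpha> b grlex_trans[of n \<alpha> \<beta> \<alpha>] grlex_irrefl by (auto simp: preds_def)
  qed
  then obtain j where j: "j < n" "\<beta> j < \<alpha> j" by blast
  interpret B: bounded_prob "mu j" "r j" by (rule BP)
  have "degree (monom (1::complex) (\<beta> j)) < \<alpha> j" using j(2) by (simp add: degree_monom_eq)
  then have "B.ip (Q j) (monom 1 (\<beta> j)) = 0" by (rule Qp(3))
  then have "B.ip (monom 1 (\<beta> j)) (Q j) = 0" using B.ip_cnj[of "monom 1 (\<beta> j)" "Q j"] by simp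
  then show "(\<integral>z. monom_n n \<beta> z * cnj (q Q z) \<partial>\<nu>) = 0" unfolding prod using j(1) by (intro prod_zero) auto
qed

lemma q_monic:
  assumes "orth_family \<alpha> Q" "\<alpha> \<in> multi_indices n"
  shows "q Q \<in> monic_polys n \<alpha>"
  unfolding q_def[abs_def]
proof (rule prod_poly_monic[OF _ assms(2)])
  show "lead_coeff (Q j) = 1 \<and> degree (Q j) = \<alpha> j" for j
    using assms(1) unfolding orth_family_def by blast
qed

text \<open>The inner product of any P in the class with the product polynomial q is the squared
  norm of q. Expanding the integral of |P - q| squared, which is nonnegative, leaves the difference
  of the squared norms.\<close>

lemma norm_q_minimal:
  assumes Q: "orth_family \<alpha> Q" and \<alpha>: "\<alpha> \<in> multi_indices n" and P: "P \<in> monic_polys n \<alpha>"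
  shows "(\<Prod>j<n. N j (Q j)) \<le> (\<integral>z. (cmod (P z))\<^sup>2 \<partial>\<nu>)"
proof -
  note qm = q_monic[OF Q \<alpha>]
  obtain c where c: "P = (\<lambda>z. monom_n n \<alpha> z + (\<Sum>\<beta>\<in>preds n \<alpha>. c \<beta> * monom_n n \<beta> z))"
    using P unfolding monic_polys_altdef by blast
  obtain B where B: "\<forall>z. (\<forall>j\<in>{..<n}. z j \<in> Ks j) \<longrightarrow> cmod (P z) \<le> B" using monic_bounded[OF P] by blast
  obtain B' where B': "\<forall>z. (\<forall>j\<in>{..<n}. z j \<in> Ks j) \<longrightarrow> cmod (q Q z) \<le> B'" using monic_bounded[OF qm] by blast
  have "cnj \<in> borel_measurable borel" by (intro borel_measurable_continuous_onI continuous_intros)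
  then have mq: "(\<lambda>z. cnj (q Q z)) \<in> borel_measurable \<nu>" by (rule measurable_compose[OF monic_measurable[OF qm]])
  have i1: "integrable \<nu> (\<lambda>z. monom_n n \<beta> z * cnj (q Q z))" for \<beta>
  proof (rule integrable_AE_bounded)
    show "(\<lambda>z. monom_n n \<beta> z * cnj (q Q z)) \<in> borel_measurable \<nu>" by (intro borel_measurable_times monom_measurable mq)
    fix z :: "nat \<Rightarrow> complex" assume z: "\<forall>j\<in>{..<n}. z j \<in> Ks j"
    then have "cmod (monom_n n \<beta> z) * cmod (q Q z) \<le> (\<Prod>j<n. r j ^ \<beta> j) * B'"
      using B' by (intro mult_mono monom_bounded prod_nonneg) (auto intro!: zero_le_power equilibrium.r_nonneg[OF EQ])
    then show "norm (monom_n n \<beta> z * cnj (q Q z)) \<le> (\<Prod>j<n. r j ^ \<beta> j) * B'" by (simp add: norm_mult)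
  qed
  have Pq: "P z * cnj (q Q z) = monom_n n \<alpha> z * cnj (q Q z) + (\<Sum>\<beta>\<in>preds n \<alpha>. c \<beta> * (monom_n n \<beta> z * cnj (q Q z)))" for z
    unfolding c by (simp add: distrib_right sum_distrib_right mult.assoc)
  have ipq: "(\<integral>z. P z * cnj (q Q z) \<partial>\<nu>) = of_real (\<Prod>j<n. N j (Q j))"
  proof -
    have "(\<integral>z. P z * cnj (q Q z) \<partial>\<nu>) = (\<integral>z. monom_n n \<alpha> z * cnj (q Q z) \<partial>\<nu>)
        + (\<Sum>\<beta>\<in>preds n \<alpha>. c \<beta> * (\<integral>z. monom_n n \<beta> z * cnj (q Q z) \<partial>\<nu>))"
      unfolding Pq using i1
      by (simp add: Bochner_Integration.integral_add Bochner_Integration.integral_sum Bochner_Integration.integrable_sum)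
    also have "\<dots> = of_real (\<Prod>j<n. N j (Q j))"
      using ip_monom_q[OF Q \<alpha>] by (simp add: sum.neutral)
    finally show ?thesis .
  qed
  have iPq: "integrable \<nu> (\<lambda>z. P z * cnj (q Q z))"
    unfolding Pq by (intro Bochner_Integration.integrable_add Bochner_Integration.integrable_sum integrable_mult_right i1)
  have iP: "integrable \<nu> (\<lambda>z. (cmod (P z))\<^sup>2)"
    by (rule integrable_AE_bounded[of _ "B\<^sup>2"])
       (use monic_measurable[OF P] B in \<open>auto intro!: power_mono borel_measurable_power\<close>)
  have iq: "integrable \<nu> (\<lambda>z. (cmod (q Q z))\<^sup>2)"
    by (rule integrable_AE_bounded[of _ "B'\<^sup>2"])
       (use monic_measurable[OF qm] B' in \<open>auto intro!: power_mono borel_measurable_power\<close>)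
  have "0 \<le> (\<integral>z. (cmod (P z - q Q z))\<^sup>2 \<partial>\<nu>)" by (intro integral_nonneg_AE) auto
  also have "\<dots> = (\<integral>z. (cmod (P z))\<^sup>2 - 2 * Re (P z * cnj (q Q z)) + (cmod (q Q z))\<^sup>2 \<partial>\<nu>)"
    by (intro Bochner_Integration.integral_cong refl) (simp add: cmod_power2 power2_diff algebra_simps)
  also have "\<dots> = (\<integral>z. (cmod (P z))\<^sup>2 \<partial>\<nu>) - 2 * (\<integral>z. Re (P z * cnj (q Q z)) \<partial>\<nu>) + (\<integral>z. (cmod (q Q z))\<^sup>2 \<partial>\<nu>)"
  proof -
    define u where "u z = Re (P z * cnj (q Q z))" for z
    have "integrable \<nu> u" unfolding u_def by (rule integrable_Re[OF iPq])
    then show ?thesis unfolding u_def[symmetric] using iP iq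
      by (simp add: Bochner_Integration.integral_add Bochner_Integration.integral_diff)
  qed
  also have "(\<integral>z. Re (P z * cnj (q Q z)) \<partial>\<nu>) = (\<Prod>j<n. N j (Q j))"
    unfolding integral_Re[OF iPq] ipq by (rule Re_complex_of_real)
  finally show ?thesis by (simp add: norm_q)
qed

text \<open>V need not be identified with the product of the one-variable polynomials: both minimize
  the norm, so the norms agree.\<close>

lemma l2norm_orth:
  assumes Q: "orth_family \<alpha> Q" and \<alpha>: "\<alpha> \<in> multi_indices n" and V: "is_monic_orth_poly n \<nu> \<alpha> V"
  shows "l2norm \<nu> V = sqrt (\<Prod>j<n. N j (Q j))"
proof (rule antisym)
  have "l2norm \<nu> V \<le> l2norm \<nu> (q Q)" using V q_monic[OF Q \<alpha>] by (simp add: is_monic_orth_poly_def)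
  then show "l2norm \<nu> V \<le> sqrt (\<Prod>j<n. N j (Q j))" by (simp add: l2norm_def norm_q)
  show "sqrt (\<Prod>j<n. N j (Q j)) \<le> l2norm \<nu> V"
    unfolding l2norm_def using V norm_q_minimal[OF Q \<alpha>] by (simp add: is_monic_orth_poly_def)
qed

definition cap :: "nat \<Rightarrow> real" where "cap j = exp (I j)"

lemma cap_pos: "0 < cap j" by (simp add: cap_def)

lemma N_ge:
  assumes "orth_family \<alpha> Q"
  shows "(cap j ^ \<alpha> j)\<^sup>2 \<le> N j (Q j)"
proof -
  have "lead_coeff (Q j) = 1" "degree (Q j) = \<alpha> j" using assms unfolding orth_family_def by blast+
  then show ?thesis
    using equilibrium.integral_norm_sq_monic(1)[OF EQ, of "Q j" j] by (simp add: N_def cap_def exp_of_nat_mult)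
qed

text \<open>For \<alpha> j = 0 the polynomial is 1 and equality is automatic, whence the first
  alternative.\<close>

lemma N_eq_iff:
  assumes Q: "orth_family \<alpha> Q"
  shows "N j (Q j) = (cap j ^ \<alpha> j)\<^sup>2 \<longleftrightarrow> \<alpha> j = 0 \<or> (\<exists>R :: complex poly. degree R = \<alpha> j \<and>
     frontier (unbounded_component (Ks j)) = {z. cmod (poly R z) = 1})"
proof -
  have Qp: "lead_coeff (Q j) = 1" "degree (Q j) = \<alpha> j"
    using Q unfolding orth_family_def by blast+
  have Qp3: "bounded_prob.ip (mu j) (Q j) s = 0" if "degree s < degree (Q j)" for s
    using Q that unfolding orth_family_def Qp(2) by blast
  interpret R: regular_equilibrium "Ks j" "mu j" "r j" "I j" "F j" by (rule RE)
  show ?thesis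
  proof (cases "\<alpha> j = 0")
    case True
    then have "Q j = 1" using Qp(1,2) by (metis degree_eq_zeroE coeff_pCons_0 one_pCons degree_pCons_0)
    then show ?thesis using True by (simp add: N_def)
  next
    case False
    then show ?thesis
      using R.orthogonal_poly_equality[OF Qp(1) Qp3] Qp(2) by (simp add: N_def cap_def exp_of_nat_mult)
  qed
qed

lemma prod_cap_le_l2norm:
  assumes \<alpha>: "\<alpha> \<in> multi_indices n" and P: "P \<in> monic_polys n \<alpha>"
  shows "(\<Prod>j<n. cap j ^ \<alpha> j) \<le> l2norm \<nu> P"
proof -
  obtain Q where Q: "orth_family \<alpha> Q" using orth_family_exists by blast
  have "(\<Prod>j<n. cap j ^ \<alpha> j)\<^sup>2 = (\<Prod>j<n. (cap j ^ \<alpha> j)\<^sup>2)" by (simp add: prod_power_distrib)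
  also have "\<dots> \<le> (\<Prod>j<n. N j (Q j))" by (intro prod_mono conjI N_ge[OF Q]) simp
  also have "\<dots> \<le> (\<integral>z. (cmod (P z))\<^sup>2 \<partial>\<nu>)" by (rule norm_q_minimal[OF Q \<alpha> P])
  finally show ?thesis unfolding l2norm_def by (intro real_le_rsqrt)
qed

lemma l2norm_eq_iff:
  assumes \<alpha>: "\<alpha> \<in> multi_indices n" and V: "is_monic_orth_poly n \<nu> \<alpha> V"
  shows "l2norm \<nu> V = (\<Prod>j<n. cap j ^ \<alpha> j) \<longleftrightarrow> (\<forall>j<n. \<alpha> j = 0 \<or> (\<exists>R :: complex poly. degree R = \<alpha> j \<and>
     frontier (unbounded_component (Ks j)) = {z. cmod (poly R z) = 1}))"
proof -
  obtain Q where Q: "orth_family \<alpha> Q" using orth_family_exists by blast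
  define C where "C j = (cap j ^ \<alpha> j)\<^sup>2" for j
  have C0: "0 < C j" for j unfolding C_def by (intro zero_less_power cap_pos)
  have CN: "C j \<le> N j (Q j)" for j using N_ge[OF Q] by (simp add: C_def)
  have sq: "sqrt (\<Prod>j<n. C j) = (\<Prod>j<n. cap j ^ \<alpha> j)"
  proof -
    have "0 \<le> (\<Prod>j<n. cap j ^ \<alpha> j)" by (intro prod_nonneg ballI zero_le_power less_imp_le cap_pos)
    moreover have "(\<Prod>j<n. C j) = (\<Prod>j<n. cap j ^ \<alpha> j)\<^sup>2" by (simp add: C_def prod_power_distrib)
    ultimately show ?thesis by (simp only: real_sqrt_abs abs_of_nonneg)
  qed
  have "l2norm \<nu> V = (\<Prod>j<n. cap j ^ \<alpha> j) \<longleftrightarrow> (\<Prod>j<n. N j (Q j)) = (\<Prod>j<n. C j)"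
    unfolding l2norm_orth[OF Q \<alpha> V] sq[symmetric] by simp
  also have "\<dots> \<longleftrightarrow> (\<forall>j<n. N j (Q j) = C j)"
  proof
    assume eq: "(\<Prod>j<n. N j (Q j)) = (\<Prod>j<n. C j)"
    show "\<forall>j<n. N j (Q j) = C j"
    proof (rule ccontr)
      assume "\<not> ?thesis"
      then obtain k where k: "k < n" "C k < N k (Q k)" using CN by (metis order_le_less)
      have "(\<Prod>j<n. C j) = C k * (\<Prod>j\<in>{..<n} - {k}. C j)" using k(1) by (intro prod.remove) auto
      also have "\<dots> < N k (Q k) * (\<Prod>j\<in>{..<n} - {k}. C j)"
        using k(2) C0 by (intro mult_strict_right_mono prod_pos) auto
      also have "\<dots> \<le> N k (Q k) * (\<Prod>j\<in>{..<n} - {k}. N j (Q j))"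
        using C0 CN k(2) by (intro mult_left_mono prod_mono conjI) (auto intro: less_imp_le order.trans[OF less_imp_le])
      also have "\<dots> = (\<Prod>j<n. N j (Q j))" using k(1) by (intro prod.remove[symmetric]) auto
      finally show False using eq by simp
    qed
  qed simp
  also have "\<dots> \<longleftrightarrow> (\<forall>j<n. \<alpha> j = 0 \<or> (\<exists>R :: complex poly. degree R = \<alpha> j \<and>
     frontier (unbounded_component (Ks j)) = {z. cmod (poly R z) = 1}))"
    unfolding C_def N_eq_iff[OF Q] ..
  finally show ?thesis .
qed

text \<open>The power R ^ c has the same unit level set as R and c times its degree. Indices with c
  \<alpha> j = 0, in particular all of them for c = 0, fall under the first alternative of the
  criterion.\<close>

lemma l2norm_power_eq:
  assumes \<alpha>: "\<alpha> \<in> multi_indices n" and V: "is_monic_orth_poly n \<nu> \<alpha> V"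
    and eq: "l2norm \<nu> V = (\<Prod>j<n. cap j ^ \<alpha> j)" and V': "is_monic_orth_poly n \<nu> (\<lambda>j. c * \<alpha> j) V'"
  shows "l2norm \<nu> V' = (\<Prod>j<n. cap j ^ (c * \<alpha> j))"
proof -
  have c\<alpha>: "(\<lambda>j. c * \<alpha> j) \<in> multi_indices n" using \<alpha> by (simp add: multi_indices_def)
  have "c * \<alpha> j = 0 \<or> (\<exists>R :: complex poly. degree R = c * \<alpha> j \<and>
     frontier (unbounded_component (Ks j)) = {z. cmod (poly R z) = 1})" if "j < n" for j
  proof (cases "c * \<alpha> j = 0")
    case False
    then have "\<alpha> j \<noteq> 0" by simp
    have "\<alpha> j = 0 \<or> (\<exists>R :: complex poly. degree R = \<alpha> j \<and>
        frontier (unbounded_component (Ks j)) = {z. cmod (poly R z) = 1})"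
      using iffD1[OF l2norm_eq_iff[OF \<alpha> V] eq] that by (elim allE impE)
    with \<open>\<alpha> j \<noteq> 0\<close> have "\<exists>R :: complex poly. degree R = \<alpha> j \<and>
        frontier (unbounded_component (Ks j)) = {z. cmod (poly R z) = 1}"
      by simp
    then obtain R :: "complex poly" where R: "degree R = \<alpha> j"
        "frontier (unbounded_component (Ks j)) = {z. cmod (poly R z) = 1}" by (elim exE conjE)
    have "R \<noteq> 0" using R(1) False by auto
    then have "degree (R ^ c) = c * \<alpha> j" using R(1) by (simp add: degree_power_eq)
    moreover have "cmod (poly (R ^ c) z) = 1 \<longleftrightarrow> cmod (poly R z) = 1" for z
      using False power_eq_iff_eq_base[of c "cmod (poly R z)" 1] by (simp add: norm_power)
    ultimately show ?thesis using R(2) by (intro disjI2 exI[of _ "R ^ c"]) simp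
  qed simp
  then show ?thesis using l2norm_eq_iff[OF c\<alpha> V'] by simp
qed

subsection \<open>Bounds for the Chebyshev constants\<close>

lemma Ks_ne: "PiE {..<n} Ks \<noteq> {}"
proof -
  have "Ks j \<noteq> {}" for j using regular_equilibrium.reg[OF RE, of j] by (simp add: regular_compact_def)
  then show ?thesis by (simp add: PiE_eq_empty_iff)
qed

lemma sup_norm_upper:
  assumes "P \<in> monic_polys n \<alpha>" "z \<in> PiE {..<n} Ks"
  shows "cmod (P z) \<le> sup_norm (PiE {..<n} Ks) P"
proof -
  obtain B where B: "\<forall>z. (\<forall>j\<in>{..<n}. z j \<in> Ks j) \<longrightarrow> cmod (P z) \<le> B" using monic_bounded[OF assms(1)] by blast
  show ?thesis unfolding sup_norm_def
    using assms(2) B by (intro cSUP_upper bdd_aboveI[of _ B]) (auto simp: PiE_def Pi_def)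
qed

lemma sup_norm_nonneg:
  assumes "P \<in> monic_polys n \<alpha>"
  shows "0 \<le> sup_norm (PiE {..<n} Ks) P"
proof -
  obtain z where "z \<in> PiE {..<n} Ks" using Ks_ne by blast
  from sup_norm_upper[OF assms this] show ?thesis by (rule order_trans[OF norm_ge_zero])
qed

lemma l2norm_le_sup_norm:
  assumes P: "P \<in> monic_polys n \<alpha>"
  shows "l2norm \<nu> P \<le> sup_norm (PiE {..<n} Ks) P"
proof -
  interpret prob_space \<nu> by (rule prob_nu)
  let ?s = "sup_norm (PiE {..<n} Ks) P"
  have s0: "0 \<le> ?s" by (rule sup_norm_nonneg[OF P])
  have AE: "AE z in \<nu>. (cmod (P z))\<^sup>2 \<le> ?s\<^sup>2"
    using AE_nu AE_space
  proof eventually_elim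
    case (elim z)
    then have "z \<in> PiE {..<n} Ks" by (auto simp: \<nu>_def space_PiM PiE_def)
    then show ?case by (intro power_mono sup_norm_upper[OF P]) auto
  qed
  have "integrable \<nu> (\<lambda>z. (cmod (P z))\<^sup>2)"
    using AE monic_measurable[OF P] by (intro integrable_const_bound[of _ "?s\<^sup>2"]) auto
  then have "(\<integral>z. (cmod (P z))\<^sup>2 \<partial>\<nu>) \<le> ?s\<^sup>2" using AE by (rule integral_le_const)
  then show ?thesis unfolding l2norm_def using s0 by (intro real_le_lsqrt) auto
qed

text \<open>The product measure is a probability measure carried by the product set, so sup norms
  dominate the norms already bounded from below.\<close>

lemma cheb_t_lower:
  assumes \<alpha>: "\<alpha> \<in> multi_indices n"
  shows "(\<Prod>j<n. cap j ^ \<alpha> j) \<le> cheb_t n (PiE {..<n} Ks) \<alpha>"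
  unfolding cheb_t_def
proof (rule cINF_greatest)
  show "monic_polys n \<alpha> \<noteq> {}" using orth_family_exists[of \<alpha>] q_monic[OF _ \<alpha>] by blast
  show "(\<Prod>j<n. cap j ^ \<alpha> j) \<le> sup_norm (PiE {..<n} Ks) P" if "P \<in> monic_polys n \<alpha>" for P
    using prod_cap_le_l2norm[OF \<alpha> that] l2norm_le_sup_norm[OF that] by linarith
qed

lemma tau_minus_lower:
  assumes m: "0 < m" "\<And>j. j < n \<Longrightarrow> m \<le> cap j"
  shows "ereal m \<le> tau_minus n (PiE {..<n} Ks)"
  unfolding tau_minus_def
proof (rule Liminf_bounded, unfold eventually_sequentially, intro exI[of _ 1] allI impI)
  \<comment> \<open>Starting at 1 leaves out the constant monomial, for which the root would have
    exponent 1 / 0.\<close>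
  fix i :: nat assume i: "1 \<le> i"
  define \<alpha> where "\<alpha> = mi_enum n i"
  have \<alpha>: "\<alpha> \<in> multi_indices n" "0 < mdeg n \<alpha>"
    unfolding \<alpha>_def using mi_enum_props(1)[OF n] mdeg_mi_enum_pos[OF n i] by auto
  have "m ^ mdeg n \<alpha> = (\<Prod>j<n. m ^ \<alpha> j)" by (simp add: mdeg_def power_sum)
  also have "\<dots> \<le> (\<Prod>j<n. cap j ^ \<alpha> j)" using m by (intro prod_mono conjI power_mono) auto
  also have "\<dots> \<le> cheb_t n (PiE {..<n} Ks) \<alpha>" by (rule cheb_t_lower[OF \<alpha>(1)])
  finally have "(m ^ mdeg n \<alpha>) powr (1 / real (mdeg n \<alpha>)) \<le> cheb_t n (PiE {..<n} Ks) \<alpha> powr (1 / real (mdeg n \<alpha>))"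
    using m by (intro powr_mono2) auto
  moreover have "(m ^ mdeg n \<alpha>) powr (1 / real (mdeg n \<alpha>)) = m"
    using m(1) \<alpha>(2) by (simp add: powr_realpow[symmetric] powr_powr)
  ultimately show "ereal m \<le> ereal (cheb_t n (PiE {..<n} Ks) (mi_enum n i) powr (1 / real (mdeg n (mi_enum n i))))"
    by (simp add: \<alpha>_def)
qed

text \<open>A lower limit is bounded by the values along any infinite set of indices. Here the
  leading terms are powers of the single variable z_j, with Leja polynomials of the j-th set as
  competitors.\<close>

lemma tau_minus_upper:
  assumes j: "j < n"
  shows "tau_minus n (PiE {..<n} Ks) \<le> ereal (cap j)"
proof (rule ccontr)
  assume "\<not> ?thesis"
  then have "ereal (cap j) < tau_minus n (PiE {..<n} Ks)" by simp
  then obtain y where y: "ereal (cap j) < ereal y" "ereal y < tau_minus n (PiE {..<n} Ks)"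
    using ereal_dense2 by blast
  \<comment> \<open>Chosen so that exp (I j + \<epsilon>) = y, a rate above the capacity, which
    \<open>F_small\<close> attains for infinitely many degrees.\<close>
  define \<epsilon> where "\<epsilon> = ln y - I j"
  have y0: "0 < y" "cap j < y" using y(1) cap_pos[of j] by auto
  then have "ln (cap j) < ln y" using cap_pos[of j] by (subst ln_less_cancel_iff) auto
  then have \<epsilon>: "0 < \<epsilon>" by (simp add: \<epsilon>_def cap_def)
  define val where "val i = ereal (cheb_t n (PiE {..<n} Ks) (mi_enum n i) powr (1 / real (mdeg n (mi_enum n i))))" for i
  have "eventually (\<lambda>i. ereal y < val i) sequentially"
    using less_LiminfD[OF y(2)[unfolded tau_minus_def]] by (simp add: val_def)
  then obtain i0 where i0: "\<And>i. i0 \<le> i \<Longrightarrow> ereal y < val i" by (auto simp: eventually_sequentially)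
  interpret R: regular_equilibrium "Ks j" "mu j" "r j" "I j" "F j" by (rule RE)
  define D where "D = {d. 1 \<le> d \<and> (\<forall>z\<in>Ks j. cmod (poly (F j d) z) \<le> exp ((I j + \<epsilon>) * real d))}"
  have "infinite D" unfolding infinite_nat_iff_unbounded_le
  proof
    fix m :: nat
    obtain d where "d \<ge> max m 1" "\<forall>z\<in>Ks j. cmod (poly (F j d) z) \<le> exp ((I j + \<epsilon>) * real d)"
      using R.F_small[OF \<epsilon>, of "max m 1"] by blast
    then show "\<exists>d\<ge>m. d \<in> D" unfolding D_def by auto
  qed
  moreover have "inj_on (\<lambda>d. card (preds n (axis_index j d))) D"
  proof (rule inj_onI)
    fix x y assume "card (preds n (axis_index j x)) = card (preds n (axis_index j y))"
    then have "axis_index j x = axis_index j y"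
      using card_preds_inj[of n] axis_index_multi[OF j] by (auto simp: inj_on_def)
    then show "x = y" using inj_axis_index[of j] by (simp add: inj_eq)
  qed
  \<comment> \<open>Distinct degrees have distinct positions in the enumeration, so some degree in D
    has a position beyond i0.\<close>
  ultimately have "infinite ((\<lambda>d. card (preds n (axis_index j d))) ` D)" by (simp add: finite_image_iff)
  then obtain d where d: "d \<in> D" "i0 \<le> card (preds n (axis_index j d))"
    unfolding infinite_nat_iff_unbounded_le by auto
  define \<beta> where "\<beta> = axis_index j d"
  have \<beta>: "\<beta> \<in> multi_indices n" "mdeg n \<beta> = d" "mi_enum n (card (preds n \<beta>)) = \<beta>"
    unfolding \<beta>_def using axis_index_multi[OF j] mdeg_axis_index[OF j] mi_enum_rank[OF n axis_index_multi[OF j]] by auto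
  have d1: "1 \<le> d" "\<And>z. z \<in> Ks j \<Longrightarrow> cmod (poly (F j d) z) \<le> exp ((I j + \<epsilon>) * real d)" using d(1) by (auto simp: D_def)
  define Q where "Q k = (if k = j then F j d else 1)" for k
  define P where "P z = (\<Prod>k<n. poly (Q k) (z k))" for z :: "nat \<Rightarrow> complex"
  have P: "P \<in> monic_polys n \<beta>" unfolding P_def[abs_def]
    by (rule prod_poly_monic[OF _ \<beta>(1)]) (use R.F_props[of d] in \<open>auto simp: Q_def \<beta>_def axis_index_def\<close>)
  have "P z = poly (F j d) (z j)" for z
  proof -
    have "P z = (\<Prod>k<n. if k = j then poly (F j d) (z j) else 1)" unfolding P_def Q_def by (intro prod.cong) auto
    then show ?thesis using j by simp
  qed
  then have "sup_norm (PiE {..<n} Ks) P \<le> exp ((I j + \<epsilon>) * real d)"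
    unfolding sup_norm_def using j d1(2) by (intro cSUP_least Ks_ne) (auto simp: PiE_def Pi_def)
  moreover have "cheb_t n (PiE {..<n} Ks) \<beta> \<le> sup_norm (PiE {..<n} Ks) P"
    unfolding cheb_t_def using P by (intro cINF_lower bdd_belowI2[of _ 0] sup_norm_nonneg)
  ultimately have "cheb_t n (PiE {..<n} Ks) \<beta> \<le> exp ((I j + \<epsilon>) * real d)" by linarith
  also have "\<dots> = y ^ d" using y0(1) by (simp add: \<epsilon>_def exp_of_nat2_mult)
  finally have "cheb_t n (PiE {..<n} Ks) \<beta> \<le> y ^ d" .
  moreover have "0 \<le> (\<Prod>j<n. cap j ^ \<beta> j)" by (intro prod_nonneg ballI zero_le_power less_imp_le cap_pos)
  then have "0 \<le> cheb_t n (PiE {..<n} Ks) \<beta>" using cheb_t_lower[OF \<beta>(1)] by linarith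
  ultimately have "cheb_t n (PiE {..<n} Ks) \<beta> powr (1 / real d) \<le> (y ^ d) powr (1 / real d)"
    by (intro powr_mono2) auto
  also have "\<dots> = y" using y0(1) d1(1) by (simp add: powr_realpow[symmetric] powr_powr)
  finally have "val (card (preds n \<beta>)) \<le> ereal y" unfolding val_def \<beta>(3) by (simp add: \<beta>(2))
  then show False using i0[of "card (preds n \<beta>)"] d(2) by (simp add: \<beta>_def)
qed

text \<open>The normalizing constant t is at most every capacity, so its power of order |\<alpha>|
  is at most the product of the capacity powers. Its two bounds also show that it is finite and
  positive, so the conversion to a real number and the division are meaningful.\<close>

lemma W2_ge_1:
  assumes \<alpha>: "\<alpha> \<in> multi_indices n" and V: "is_monic_orth_poly n \<nu> \<alpha> V"
  shows "1 \<le> (W2 n (PiE {..<n} Ks) \<nu> \<alpha> V)\<^sup>2"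
proof -
  define m where "m = Min (cap ` {..<n})"
  have ne: "{..<n} \<noteq> {}" using n by (simp add: lessThan_empty_iff)
  have m: "0 < m" "\<And>j. j < n \<Longrightarrow> m \<le> cap j" unfolding m_def using ne cap_pos by auto
  define t where "t = real_of_ereal (tau_minus n (PiE {..<n} Ks))"
  have lo: "ereal m \<le> tau_minus n (PiE {..<n} Ks)" by (rule tau_minus_lower[OF m])
  have tau: "tau_minus n (PiE {..<n} Ks) = ereal t"
    using lo tau_minus_upper[of 0] n unfolding t_def by (cases "tau_minus n (PiE {..<n} Ks)") auto
  have t0: "0 < t" using lo m(1) unfolding tau by simp
  have tc: "t \<le> cap j" if "j < n" for j using tau_minus_upper[OF that] unfolding tau by simp
  have VP: "V \<in> monic_polys n \<alpha>" using V by (simp add: is_monic_orth_poly_def)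
  have "t ^ mdeg n \<alpha> = (\<Prod>j<n. t ^ \<alpha> j)" by (simp add: mdeg_def power_sum)
  also have "\<dots> \<le> (\<Prod>j<n. cap j ^ \<alpha> j)" using t0 tc by (intro prod_mono conjI power_mono) auto
  also have "\<dots> \<le> l2norm \<nu> V" by (rule prod_cap_le_l2norm[OF \<alpha> VP])
  finally have "1 \<le> W2 n (PiE {..<n} Ks) \<nu> \<alpha> V" unfolding W2_def t_def[symmetric] using t0 by simp
  then show ?thesis by (rule one_le_power)
qed

end

theorem theorem4p3:
  fixes n :: nat and Ks :: "nat \<Rightarrow> complex set" and mu :: "nat \<Rightarrow> complex measure"
    and \<alpha> :: "nat \<Rightarrow> nat" and V :: "(nat \<Rightarrow> complex) \<Rightarrow> complex"
  assumes "n \<ge> 1"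
    and "\<forall>j<n. regular_compact (Ks j)"
    and "\<forall>j<n. equilibrium_measure (Ks j) (mu j)"
    and "\<alpha> \<in> multi_indices n"
    and "is_monic_orth_poly n (PiM {..<n} mu) \<alpha> V"
  shows "l2norm (PiM {..<n} mu) V \<ge> (\<Prod>j<n. log_capacity (Ks j) ^ \<alpha> j) \<and>
         (W2 n (PiE {..<n} Ks) (PiM {..<n} mu) \<alpha> V)\<^sup>2 \<ge> 1 \<and>
         (l2norm (PiM {..<n} mu) V = (\<Prod>j<n. log_capacity (Ks j) ^ \<alpha> j) \<longleftrightarrow>
           (\<forall>j<n. \<alpha> j = 0 \<or> (\<exists>R :: complex poly. degree R = \<alpha> j \<and>
               frontier (unbounded_component (Ks j)) = {z. cmod (poly R z) = 1}))) \<and>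
         (l2norm (PiM {..<n} mu) V = (\<Prod>j<n. log_capacity (Ks j) ^ \<alpha> j) \<longrightarrow>
           (\<forall>c::nat. \<forall>V'. is_monic_orth_poly n (PiM {..<n} mu) (\<lambda>j. c * \<alpha> j) V' \<longrightarrow>
             l2norm (PiM {..<n} mu) V' = (\<Prod>j<n. log_capacity (Ks j) ^ (c * \<alpha> j))))"
proof -
  \<comment> \<open>Only the factors with index below \<open>n\<close> are constrained; the others are replaced by factor 0.\<close>
  define \<iota> where "\<iota> j = (if j < n then j else 0)" for j
  have \<iota>: "\<iota> j < n" for j using assms(1) by (simp add: \<iota>_def)
  have "\<forall>j. \<exists>rIF. regular_equilibrium (Ks (\<iota> j)) (mu (\<iota> j)) (fst rIF) (fst (snd rIF)) (snd (snd rIF)) \<and>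
      log_capacity (Ks (\<iota> j)) = exp (fst (snd rIF))"
  proof
    fix j
    obtain r I F where "regular_equilibrium (Ks (\<iota> j)) (mu (\<iota> j)) r I F" "log_capacity (Ks (\<iota> j)) = exp I"
      using regular_equilibrium_exists[of "Ks (\<iota> j)" "mu (\<iota> j)"] assms(2,3) \<iota>[of j] by blast
    then show "\<exists>rIF. regular_equilibrium (Ks (\<iota> j)) (mu (\<iota> j)) (fst rIF) (fst (snd rIF)) (snd (snd rIF)) \<and>
      log_capacity (Ks (\<iota> j)) = exp (fst (snd rIF))" by (intro exI[of _ "(r, I, F)"]) simp
  qed
  from choice[OF this] obtain rIF :: "nat \<Rightarrow> real \<times> real \<times> (nat \<Rightarrow> complex poly)" where
    RE: "\<And>j. regular_equilibrium (Ks (\<iota> j)) (mu (\<iota> j)) (fst (rIF j)) (fst (snd (rIF j))) (snd (snd (rIF j)))"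
    and cap: "\<And>j. log_capacity (Ks (\<iota> j)) = exp (fst (snd (rIF j)))" by blast
  interpret E: product_equilibrium n "\<lambda>j. Ks (\<iota> j)" "\<lambda>j. mu (\<iota> j)" "\<lambda>j. fst (rIF j)"
    "\<lambda>j. fst (snd (rIF j))" "\<lambda>j. snd (snd (rIF j))"
    by (intro product_equilibrium.intro assms(1) RE)
  have nu: "E.\<nu> = PiM {..<n} mu" unfolding E.\<nu>_def by (intro PiM_cong) (auto simp: \<iota>_def)
  have Ks: "PiE {..<n} (\<lambda>j. Ks (\<iota> j)) = PiE {..<n} Ks" by (intro PiE_cong) (auto simp: \<iota>_def)
  have ecap: "(\<Prod>j<n. E.cap j ^ \<beta> j) = (\<Prod>j<n. log_capacity (Ks j) ^ \<beta> j)" for \<beta>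
    unfolding E.cap_def
  proof (rule prod.cong[OF refl])
    fix j assume "j \<in> {..<n}"
    then have "\<iota> j = j" by (simp add: \<iota>_def)
    then show "exp (fst (snd (rIF j))) ^ \<beta> j = log_capacity (Ks j) ^ \<beta> j" using cap[of j] by simp
  qed
  have K\<iota>: "(\<forall>j<n. \<alpha> j = 0 \<or> (\<exists>R :: complex poly. degree R = \<alpha> j \<and>
      frontier (unbounded_component (Ks (\<iota> j))) = {z. cmod (poly R z) = 1})) \<longleftrightarrow>
      (\<forall>j<n. \<alpha> j = 0 \<or> (\<exists>R :: complex poly. degree R = \<alpha> j \<and>
      frontier (unbounded_component (Ks j)) = {z. cmod (poly R z) = 1}))"
    by (intro all_cong) (simp add: \<iota>_def)
  have V: "is_monic_orth_poly n E.\<nu> \<alpha> V" using assms(5) by (simp add: nu)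
  have VP: "V \<in> monic_polys n \<alpha>" using V by (simp add: is_monic_orth_poly_def)
  show ?thesis
    using E.prod_cap_le_l2norm[OF assms(4) VP] E.W2_ge_1[OF assms(4) V] E.l2norm_eq_iff[OF assms(4) V]
      E.l2norm_power_eq[OF assms(4) V]
    unfolding nu Ks ecap K\<iota> by blast
qed

end
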